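(* Fix $\beta\in(0,1)$, $\theta>0$ and $\gamma\ge1$. Let $p_n\ge n$ with $p_n/n\to\gamma$, $r_n=n^{1-\beta}$, and $\delta_n=r_n^{-1}\,\theta\sqrt{2\gamma}$; write $p=p_n$, $r=r_n$, $\delta=\delta_n$. Consider, for data $X_1,\dots,X_n\in\mathbb{R}^p$, testing $H_0^{(n)}:X_i\stackrel{iid}{\sim}N(0,I_p)$ against $H_1^{(n)}:(X_i\mid Q)\stackrel{iid}{\sim}N\big(0,I_p+\tfrac{\delta}{1-\delta}QQ'\big)$ with $Q$ uniformly distributed on the Stiefel manifold $\mathbb{S}(p,r)$, and let $LR_n$ be the likelihood ratio of $H_1^{(n)}$ with respect to $H_0^{(n)}$. As $n\to\infty$, the log-likelihood ratio $\log(LR_n)$ converges weakly to $N\big(-\tfrac{\theta^2}{2},\theta^2\big)$ under $H_0^{(n)}$ and to $N\big(\tfrac{\theta^2}{2},\theta^2\big)$ under $H_1^{(n)}$.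
   Context: $\mathbb{S}(p,r)=\{Q\in\mathbb{R}^{p\times r}:Q'Q=I_r\}$ is the Stiefel manifold; "uniform" means the law invariant under left multiplication by orthogonal $p\times p$ matrices. $r_n=n^{1-\beta}$ is understood as rounded to an integer; $n$ is large enough that $\delta_n<1$. Under $H_1^{(n)}$ the law of the data is the mixture over $Q$ (one $Q$ is drawn, common to all $i$). $LR_n=f_1(X_1,\dots,X_n)/f_0(X_1,\dots,X_n)$, where $f_0,f_1$ are the joint densities of the data under $H_0^{(n)}$ and $H_1^{(n)}$. *)

theory Defs
  imports
    "HOL-Probability.Probability"
    "Jordan_Normal_Form.Determinant"
    "Jordan_Normal_Form.Gauss_Jordan_Elimination"
begin

text \<open>
  As the dimensions grow with the sample size, matrices are those of Jordan_Normal_Form.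
  A point of \<open>\<real>\<^sup>p\<close> that serves as data is a function in the product space
  \<open>\<Pi>\<^sub>M j\<in>{..<p}. lborel\<close>, which carries Lebesgue measure; \<open>Matrix.vec p\<close> turns it into a vector.
\<close>

abbreviation lebesgue_vec :: "nat \<Rightarrow> (nat \<Rightarrow> real) measure" where
  "lebesgue_vec p \<equiv> (\<Pi>\<^sub>M j\<in>{..<p}. lborel)"

abbreviation lebesgue_data :: "nat \<Rightarrow> nat \<Rightarrow> (nat \<Rightarrow> nat \<Rightarrow> real) measure" where
  "lebesgue_data n p \<equiv> (\<Pi>\<^sub>M i\<in>{..<n}. lebesgue_vec p)"

text \<open>The law \<open>N(0, S)\<close>; meaningful for symmetric positive definite \<open>S\<close> only.\<close>

definition centered_normal :: "nat \<Rightarrow> real Matrix.mat \<Rightarrow> (nat \<Rightarrow> real) measure" where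
  "centered_normal p S = density (lebesgue_vec p)
     (\<lambda>x. ennreal (exp (- scalar_prod (Matrix.vec p x) (the (mat_inverse S) *\<^sub>v Matrix.vec p x) / 2)
                   / sqrt ((2 * pi) ^ p * Determinant.det S)))"

definition stiefel :: "nat \<Rightarrow> nat \<Rightarrow> real Matrix.mat set" where
  "stiefel p r = {Q \<in> carrier_mat p r. transpose_mat Q * Q = 1\<^sub>m r}"

definition orthogonal_group :: "nat \<Rightarrow> real Matrix.mat set" where
  "orthogonal_group p = {H \<in> carrier_mat p p. transpose_mat H * H = 1\<^sub>m p \<and> H * transpose_mat H = 1\<^sub>m p}"

text \<open>The type of matrices has no topology, so the Borel \<open>\<sigma>\<close>-algebra of the Stiefel manifold is
  pulled back along the matrix entries. Only the \<open>\<sigma>\<close>-algebra of this measure is of interest.\<close>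

definition stiefel_borel :: "nat \<Rightarrow> nat \<Rightarrow> real Matrix.mat measure" where
  "stiefel_borel p r = vimage_algebra (stiefel p r)
     (\<lambda>Q. \<lambda>(i, j)\<in>{..<p} \<times> {..<r}. Q $$ (i, j)) (\<Pi>\<^sub>M k\<in>{..<p} \<times> {..<r}. borel)"

text \<open>For \<open>r \<le> p\<close> exactly one law satisfies this predicate, because the compact group of orthogonal
  matrices acts transitively on the Stiefel manifold.\<close>

definition uniform_on_stiefel :: "nat \<Rightarrow> nat \<Rightarrow> real Matrix.mat measure \<Rightarrow> bool" where
  "uniform_on_stiefel p r U \<longleftrightarrow>
     prob_space U \<and> sets U = sets (stiefel_borel p r) \<and>
     (\<forall>H \<in> orthogonal_group p. distr U (stiefel_borel p r) (\<lambda>Q. H * Q) = U)"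

definition spiked_cov :: "nat \<Rightarrow> real \<Rightarrow> real Matrix.mat \<Rightarrow> real Matrix.mat" where
  "spiked_cov p \<delta> Q = 1\<^sub>m p + (\<delta> / (1 - \<delta>)) \<cdot>\<^sub>m (Q * transpose_mat Q)"

definition null_law :: "nat \<Rightarrow> nat \<Rightarrow> (nat \<Rightarrow> nat \<Rightarrow> real) measure" where
  "null_law n p = (\<Pi>\<^sub>M i\<in>{..<n}. centered_normal p (1\<^sub>m p))"

text \<open>One \<open>Q\<close>, drawn from \<open>U\<close>, is common to all observations.\<close>

definition alt_law ::
  "nat \<Rightarrow> nat \<Rightarrow> real \<Rightarrow> real Matrix.mat measure \<Rightarrow> (nat \<Rightarrow> nat \<Rightarrow> real) measure" where
  "alt_law n p \<delta> U =
     Giry_Monad.bind U (\<lambda>Q. \<Pi>\<^sub>M i\<in>{..<n}. centered_normal p (spiked_cov p \<delta> Q))"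

text \<open>The ratio \<open>f\<^sub>1 / f\<^sub>0\<close> of the densities of \<open>M\<^sub>1\<close> and \<open>M\<^sub>0\<close> with respect to \<open>L\<close>.\<close>

definition likelihood_ratio :: "'a measure \<Rightarrow> 'a measure \<Rightarrow> 'a measure \<Rightarrow> 'a \<Rightarrow> real" where
  "likelihood_ratio L M1 M0 x = enn2real (RN_deriv L M1 x) / enn2real (RN_deriv L M0 x)"

definition log_LR ::
  "nat \<Rightarrow> nat \<Rightarrow> real \<Rightarrow> real Matrix.mat measure \<Rightarrow> (nat \<Rightarrow> nat \<Rightarrow> real) \<Rightarrow> real" where
  "log_LR n p \<delta> U X =
     ln (likelihood_ratio (lebesgue_data n p) (alt_law n p \<delta> U) (null_law n p) X)"

end

theory Submission
  imports Defs "HOL-Real_Asymp.Real_Asymp"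
begin

text \<open>
  Second moment method. Let \<open>Y\<close> be the likelihood ratio and let \<open>Z\<close> be the likelihood ratio of
  \<open>N(0, I / (1 - a))\<close> against \<open>N(0, I)\<close> with \<open>a = \<theta> \<surd>(2\<gamma>) / p\<close>, a function of the total sum of
  squares, which follows a chi-square law under the null hypothesis. Under the null law
  \<open>E Y\<^sup>2\<close>, \<open>E Y Z\<close> and \<open>E Z\<^sup>2\<close> all tend to \<open>exp (\<theta>\<^sup>2)\<close> (upper bounds for the squares and a
  lower bound for the mixed moment are enough), so \<open>Y - Z\<close> tends to \<open>0\<close> in \<open>L\<^sup>2\<close>, and the central
  limit theorem for \<open>ln Z\<close> gives the limit of \<open>ln Y\<close>. The delicate moment is \<open>E Y\<^sup>2\<close>: it is the mean
  over independent uniform \<open>Q\<close>, \<open>Q'\<close> of \<open>det (I - \<eta>\<^sup>2 M\<^sup>T M)\<close> to the power \<open>- n / 2\<close>, where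
  \<open>M = Q\<^sup>T Q'\<close> and \<open>\<eta> = \<delta> / (1 - \<delta>)\<close>. Convexity reduces it to the moment generating function of the
  squared length of one column of \<open>M\<close>, and Jensen's inequality bounds that by a Gaussian one. Under
  the alternative, \<open>P (ln Y \<le> x)\<close> is the null expectation of the bounded function
  \<open>exp w * indicator {..x} w\<close> at \<open>w = ln Y\<close>, so the second limit follows from the first.
\<close>

subsection \<open>Gaussian integrals\<close>

text \<open>Put \<open>c = \<theta> * sqrt (2 * \<gamma>)\<close>. Since
  \<open>r * \<delta> = c\<close>, the total excess variance of the spike stays bounded while its
  rank grows. Heuristically, averaging over \<open>Q\<close> leaves only its trace visible, and
  \<open>a = c / p\<close> is the isotropic inflation with the same trace to first order; this is
  where \<open>Z\<close> comes from. Expanding \<open>E (Y - Z)^2\<close> shows why two upper bounds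
  and one lower bound with a common limit suffice.

  The obstacle in \<open>E Y^2\<close> is that the determinant is raised to a power growing with
  \<open>n\<close>, so every loss must vanish in the exponent. Convexity puts the weight of all
  \<open>r\<close> columns of \<open>M\<close> on a single one: its squared length is multiplied by
  about \<open>n * c\<^sup>2 / (2 * r)\<close>. That length has mean \<open>r / p\<close> and
  fluctuations of order \<open>sqrt r / p\<close>, so the exponent keeps its limit and fluctuates
  only by order \<open>1 / sqrt r\<close>. As \<open>r\<close> tends to infinity the convexity step
  costs nothing, and no eigenvalue law of \<open>M\<close> is required.\<close>

definition gauss :: "nat \<Rightarrow> (nat \<Rightarrow> real) measure" where
  "gauss p = (\<Pi>\<^sub>M j\<in>{..<p}. std_normal_distribution)"

lemma sets_gauss [measurable_cong]: "sets (gauss p) = sets (\<Pi>\<^sub>M j\<in>{..<p}. (borel :: real measure))"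
  unfolding gauss_def by (intro sets_PiM_cong) auto

lemma product_sigma_finite_std_normal:
  "product_sigma_finite (\<lambda>_. std_normal_distribution)"
  by (intro product_sigma_finite.intro prob_space_imp_sigma_finite prob_space_normal_density) simp

lemma prob_space_gauss: "prob_space (gauss p)"
  unfolding gauss_def by (intro prob_space_PiM prob_space_normal_density) simp

lemma nn_integral_gauss_prod:
  assumes "\<And>j. j < p \<Longrightarrow> f j \<in> borel_measurable borel"
  shows "(\<integral>\<^sup>+x. (\<Prod>j<p. f j (x j)) \<partial>gauss p) = (\<Prod>j<p. \<integral>\<^sup>+t. f j t \<partial>std_normal_distribution)"
  unfolding gauss_def
  by (intro product_sigma_finite.product_nn_integral_prod product_sigma_finite_std_normal)
     (use assms in auto)

text \<open>Completing the square leaves a normal density with mean \<open>b / (1 - a)\<close> and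
  variance \<open>1 / (1 - a)\<close>; \<open>a < 1\<close> keeps that variance positive.\<close>

lemma nn_integral_std_normal_exp:
  assumes "a < 1"
  shows "(\<integral>\<^sup>+t. ennreal (exp (b * t + a * t\<^sup>2 / 2)) \<partial>std_normal_distribution)
    = ennreal (exp (b\<^sup>2 / (2 * (1 - a))) / sqrt (1 - a))"
proof -
  define \<sigma> where "\<sigma> = 1 / sqrt (1 - a)"
  define m where "m = b / (1 - a)"
  have \<sigma>: "\<sigma> > 0" "\<sigma>\<^sup>2 = 1 / (1 - a)" using assms by (auto simp: \<sigma>_def power_divide)
  have eq: "std_normal_density t * exp (b * t + a * t\<^sup>2 / 2)
      = (exp (b\<^sup>2 / (2 * (1 - a))) / sqrt (1 - a)) * normal_density m \<sigma> t" for t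
  proof -
    have "sqrt (2 * pi * \<sigma>\<^sup>2) = sqrt (2 * pi) / sqrt (1 - a)"
      by (simp add: \<sigma> real_sqrt_divide)
    moreover have "- t\<^sup>2 / 2 + (b * t + a * t\<^sup>2 / 2)
        = b\<^sup>2 / (2 * (1 - a)) + - (t - m)\<^sup>2 / (2 * \<sigma>\<^sup>2)"
    proof -
      have b: "b = m * (1 - a)" using assms by (simp add: m_def)
      have "(m * d)\<^sup>2 / (2 * d) = m\<^sup>2 * d / 2" if "d > 0" for d
        using that by (simp add: power2_eq_square field_simps)
      from this[of "1 - a"] have e1: "b\<^sup>2 / (2 * (1 - a)) = m\<^sup>2 * (1 - a) / 2"
        using assms by (simp add: b)
      have e2: "- (t - m)\<^sup>2 / (2 * \<sigma>\<^sup>2) = - (t - m)\<^sup>2 * (1 - a) / 2"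
        using assms by (simp add: \<sigma>(2))
      show ?thesis unfolding e1 e2 by (simp add: b power2_eq_square field_simps)
    qed
    ultimately show ?thesis
      using assms by (simp add: std_normal_density_def normal_density_def mult_exp_exp)
  qed
  have "(\<integral>\<^sup>+t. ennreal (exp (b * t + a * t\<^sup>2 / 2)) \<partial>std_normal_distribution)
     = (\<integral>\<^sup>+t. ennreal ((exp (b\<^sup>2 / (2 * (1 - a))) / sqrt (1 - a))) * ennreal (normal_density m \<sigma> t) \<partial>lborel)"
    using assms by (subst nn_integral_density) (auto simp del: times_divide_eq_left simp flip: ennreal_mult' intro!: nn_integral_cong simp add: eq)
  also have "\<dots> = ennreal (exp (b\<^sup>2 / (2 * (1 - a))) / sqrt (1 - a))"
    using \<sigma> assms by (simp add: nn_integral_cmult nn_integral_eq_integral)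
  finally show ?thesis .
qed

lemma nn_integral_gauss_exp:
  assumes "a < 1"
  shows "(\<integral>\<^sup>+x. ennreal (exp ((\<Sum>j<p. b j * x j) + a * (\<Sum>j<p. (x j)\<^sup>2) / 2)) \<partial>gauss p)
    = ennreal (exp ((\<Sum>j<p. (b j)\<^sup>2) / (2 * (1 - a))) / sqrt (1 - a) ^ p)"
proof -
  have "(\<integral>\<^sup>+x. ennreal (exp ((\<Sum>j<p. b j * x j) + a * (\<Sum>j<p. (x j)\<^sup>2) / 2)) \<partial>gauss p)
    = (\<integral>\<^sup>+x. (\<Prod>j<p. ennreal (exp (b j * x j + a * (x j)\<^sup>2 / 2))) \<partial>gauss p)"
    by (intro nn_integral_cong)
       (simp add: prod_ennreal exp_sum[symmetric] sum.distrib sum_distrib_left sum_divide_distrib)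
  also have "\<dots> = (\<Prod>j<p. ennreal (exp ((b j)\<^sup>2 / (2 * (1 - a))) / sqrt (1 - a)))"
    by (subst nn_integral_gauss_prod) (simp_all add: nn_integral_std_normal_exp[OF assms])
  also have "\<dots> = ennreal (exp ((\<Sum>j<p. (b j)\<^sup>2) / (2 * (1 - a))) / sqrt (1 - a) ^ p)"
    using assms by (simp add: prod_ennreal prod_dividef exp_sum sum_divide_distrib)
  finally show ?thesis .
qed

lemma nn_integral_gauss_exp_linear:
  "(\<integral>\<^sup>+x. ennreal (exp (\<Sum>j<p. b j * x j)) \<partial>gauss p) = ennreal (exp ((\<Sum>j<p. (b j)\<^sup>2) / 2))"
  using nn_integral_gauss_exp[of 0 p b] by simp

text \<open>Linearisation: \<open>exp (s / 2 * u\<^sup>2)\<close> is the mean of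
  \<open>exp (sqrt s * u * z)\<close> over a standard normal \<open>z\<close>. After the exchange of
  integrals \<open>x\<close> enters linearly and a one-dimensional integral in \<open>z\<close>
  remains.\<close>

lemma nn_integral_gauss_exp_square:
  assumes "s * (\<Sum>j<p. (v j)\<^sup>2) < 1" "0 \<le> s"
  shows "(\<integral>\<^sup>+x. ennreal (exp (s / 2 * (\<Sum>j<p. v j * x j)\<^sup>2)) \<partial>gauss p)
    = ennreal (1 / sqrt (1 - s * (\<Sum>j<p. (v j)\<^sup>2)))"
proof -
  interpret prob_space "gauss p" by (rule prob_space_gauss)
  interpret N: prob_space "std_normal_distribution" by (rule prob_space_normal_density) simp
  interpret pair_sigma_finite "gauss p" "std_normal_distribution" ..
  have "(\<integral>\<^sup>+x. ennreal (exp (s / 2 * (\<Sum>j<p. v j * x j)\<^sup>2)) \<partial>gauss p)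
    = (\<integral>\<^sup>+x. \<integral>\<^sup>+z. ennreal (exp ((sqrt s * (\<Sum>j<p. v j * x j)) * z)) \<partial>std_normal_distribution \<partial>gauss p)"
    using nn_integral_std_normal_exp[of 0] assms by (simp add: power_mult_distrib)
  also have "\<dots> = (\<integral>\<^sup>+z. \<integral>\<^sup>+x. ennreal (exp ((sqrt s * (\<Sum>j<p. v j * x j)) * z)) \<partial>gauss p \<partial>std_normal_distribution)"
    by (rule Fubini'[symmetric]) measurable
  also have "\<dots> = (\<integral>\<^sup>+z. ennreal (exp (0 * z + (s * (\<Sum>j<p. (v j)\<^sup>2)) * z\<^sup>2 / 2)) \<partial>std_normal_distribution)"
  proof (intro nn_integral_cong)
    fix z :: real
    have "(\<integral>\<^sup>+x. ennreal (exp ((sqrt s * (\<Sum>j<p. v j * x j)) * z)) \<partial>gauss p)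
      = (\<integral>\<^sup>+x. ennreal (exp (\<Sum>j<p. (sqrt s * z * v j) * x j)) \<partial>gauss p)"
      by (simp add: sum_distrib_left sum_distrib_right ac_simps)
    also have "\<dots> = ennreal (exp ((\<Sum>j<p. (sqrt s * z * v j)\<^sup>2) / 2))"
      by (rule nn_integral_gauss_exp_linear)
    finally show "(\<integral>\<^sup>+x. ennreal (exp ((sqrt s * (\<Sum>j<p. v j * x j)) * z)) \<partial>gauss p)
      = ennreal (exp (0 * z + (s * (\<Sum>j<p. (v j)\<^sup>2)) * z\<^sup>2 / 2))"
      using assms by (simp add: power_mult_distrib sum_distrib_left sum_distrib_right ac_simps)
  qed
  also have "\<dots> = ennreal (1 / sqrt (1 - s * (\<Sum>j<p. (v j)\<^sup>2)))"
    using nn_integral_std_normal_exp[OF assms(1), of 0] by simp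
  finally show ?thesis .
qed

subsection \<open>The spiked likelihood ratio of one observation\<close>

lemma sum_scaled_squares: "(\<Sum>i\<in>A. (c * f i)\<^sup>2) = c\<^sup>2 * (\<Sum>i\<in>A. (f i)\<^sup>2)" for c :: real
  by (simp add: power_mult_distrib sum_distrib_left)

lemma stiefel_orthonormal:
  assumes "Q \<in> stiefel p r" "k < r" "l < r"
  shows "(\<Sum>i<p. Q $$ (i, k) * Q $$ (i, l)) = (if k = l then 1 else 0)"
proof -
  have Q: "Q \<in> carrier_mat p r" and eq: "transpose_mat Q * Q = 1\<^sub>m r"
    using assms by (auto simp: stiefel_def)
  have "(transpose_mat Q * Q) $$ (k, l) = (\<Sum>i<p. Q $$ (i, k) * Q $$ (i, l))"
    using Q assms(2,3) by (auto simp: scalar_prod_def lessThan_atLeast0 intro!: sum.cong)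
  with eq assms(2,3) show ?thesis by simp
qed

lemma stiefel_isometry:
  assumes "Q \<in> stiefel p r"
  shows "(\<Sum>i<p. (\<Sum>l<r. Q $$ (i, l) * g l)\<^sup>2) = (\<Sum>l<r. (g l)\<^sup>2)"
proof -
  have "(\<Sum>i<p. (\<Sum>l<r. Q $$ (i, l) * g l)\<^sup>2)
      = (\<Sum>i<p. \<Sum>k<r. \<Sum>l<r. g k * g l * (Q $$ (i, k) * Q $$ (i, l)))"
    by (simp add: power2_eq_square sum_product ac_simps)
  also have "\<dots> = (\<Sum>k<r. \<Sum>l<r. g k * g l * (\<Sum>i<p. Q $$ (i, k) * Q $$ (i, l)))"
    by (subst sum.swap, rule sum.cong[OF refl], subst sum.swap) (simp add: sum_distrib_left)
  also have "\<dots> = (\<Sum>k<r. \<Sum>l<r. if k = l then g k * g l else 0)"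
    by (intro sum.cong refl) (simp add: stiefel_orthonormal[OF assms])
  finally show ?thesis by (simp add: power2_eq_square)
qed

text \<open>What is left of \<open>x\<close> after subtracting its projection on the columns of
  \<open>Q\<close> has nonnegative squared length.\<close>

lemma stiefel_bessel:
  assumes "Q \<in> stiefel p r"
  shows "(\<Sum>l<r. (\<Sum>i<p. Q $$ (i, l) * x i)\<^sup>2) \<le> (\<Sum>i<p. (x i)\<^sup>2)"
proof -
  define y where "y l = (\<Sum>i<p. Q $$ (i, l) * x i)" for l
  have "0 \<le> (\<Sum>i<p. (x i - (\<Sum>l<r. Q $$ (i, l) * y l))\<^sup>2)"
    by (intro sum_nonneg) auto
  also have "\<dots> = (\<Sum>i<p. (x i)\<^sup>2) - 2 * (\<Sum>i<p. x i * (\<Sum>l<r. Q $$ (i, l) * y l))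
      + (\<Sum>i<p. (\<Sum>l<r. Q $$ (i, l) * y l)\<^sup>2)"
    by (simp add: power2_diff sum.distrib sum_subtractf sum_distrib_left ac_simps)
  also have "(\<Sum>i<p. x i * (\<Sum>l<r. Q $$ (i, l) * y l)) = (\<Sum>l<r. (y l)\<^sup>2)"
    by (simp add: sum_distrib_left, subst sum.swap)
       (simp add: y_def power2_eq_square sum_distrib_left ac_simps)
  also have "(\<Sum>i<p. (\<Sum>l<r. Q $$ (i, l) * y l)\<^sup>2) = (\<Sum>l<r. (y l)\<^sup>2)"
    by (rule stiefel_isometry[OF assms])
  finally show ?thesis by (simp add: y_def)
qed

text \<open>The density ratio of the spiked normal law to the standard one: the covariance has
  determinant \<open>(1 / (1 - \<delta>)) ^ r\<close> and inverse \<open>I - \<delta> Q Q'\<close>.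
  Matrix entries are used because measurability in \<open>Q\<close> is available for
  entries.\<close>

definition spike_lr :: "nat \<Rightarrow> nat \<Rightarrow> real \<Rightarrow> real Matrix.mat \<Rightarrow> (nat \<Rightarrow> real) \<Rightarrow> real" where
  "spike_lr p r \<delta> Q x = sqrt (1 - \<delta>) ^ r * exp (\<delta> / 2 * (\<Sum>l<r. (\<Sum>i<p. Q $$ (i, l) * x i)\<^sup>2))"

text \<open>A spiked vector is \<open>z + sqrt \<eta> * Q g\<close> with \<open>z\<close>,
  \<open>g\<close> independent standard normal. Given \<open>g\<close> the law is shifted by
  \<open>v = sqrt \<eta> * Q g\<close>, with likelihood ratio
  \<open>exp (<v, x> - |v|\<^sup>2 / 2)\<close>, and orthonormal columns give
  \<open>|v|\<^sup>2 = \<eta> * |g|\<^sup>2\<close>. The computation is a Gaussian integral in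
  \<open>g\<close> with \<open>1 + \<eta> = 1 / (1 - \<delta>)\<close>.\<close>

lemma spike_lr_mixture:
  assumes "0 \<le> \<delta>" "\<delta> < 1"
  defines "\<eta> \<equiv> \<delta> / (1 - \<delta>)"
  shows "ennreal (spike_lr p r \<delta> Q x) =
    (\<integral>\<^sup>+g. ennreal (exp (sqrt \<eta> * (\<Sum>i<p. (\<Sum>l<r. Q $$ (i, l) * g l) * x i) - \<eta> / 2 * (\<Sum>l<r. (g l)\<^sup>2))) \<partial>gauss r)"
proof -
  have \<eta>: "0 \<le> \<eta>" "1 - - \<eta> = 1 / (1 - \<delta>)" using assms by (auto simp: \<eta>_def field_simps)
  have "(\<integral>\<^sup>+g. ennreal (exp (sqrt \<eta> * (\<Sum>i<p. (\<Sum>l<r. Q $$ (i, l) * g l) * x i) - \<eta> / 2 * (\<Sum>l<r. (g l)\<^sup>2))) \<partial>gauss r)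
    = (\<integral>\<^sup>+g. ennreal (exp ((\<Sum>l<r. (sqrt \<eta> * (\<Sum>i<p. Q $$ (i, l) * x i)) * g l) + (- \<eta>) * (\<Sum>l<r. (g l)\<^sup>2) / 2)) \<partial>gauss r)"
  proof (intro nn_integral_cong)
    fix g :: "nat \<Rightarrow> real"
    have "(\<Sum>i<p. (\<Sum>l<r. Q $$ (i, l) * g l) * x i) = (\<Sum>l<r. (\<Sum>i<p. Q $$ (i, l) * x i) * g l)"
      by (simp add: sum_distrib_right, subst sum.swap) (simp add: ac_simps)
    then show "ennreal (exp (sqrt \<eta> * (\<Sum>i<p. (\<Sum>l<r. Q $$ (i, l) * g l) * x i) - \<eta> / 2 * (\<Sum>l<r. (g l)\<^sup>2)))
      = ennreal (exp ((\<Sum>l<r. (sqrt \<eta> * (\<Sum>i<p. Q $$ (i, l) * x i)) * g l) + (- \<eta>) * (\<Sum>l<r. (g l)\<^sup>2) / 2))"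
      by (simp add: mult.assoc flip: sum_distrib_left)
  qed
  also have "\<dots> = ennreal (exp ((\<Sum>l<r. (sqrt \<eta> * (\<Sum>i<p. Q $$ (i, l) * x i))\<^sup>2) / (2 * (1 - - \<eta>))) / sqrt (1 - - \<eta>) ^ r)"
    by (rule nn_integral_gauss_exp) (use \<eta> in auto)
  also have "\<dots> = ennreal (spike_lr p r \<delta> Q x)"
  proof -
    have "(\<Sum>l<r. (sqrt \<eta> * (\<Sum>i<p. Q $$ (i, l) * x i))\<^sup>2) = \<eta> * (\<Sum>l<r. (\<Sum>i<p. Q $$ (i, l) * x i)\<^sup>2)"
      using \<eta>(1) unfolding sum_scaled_squares by simp
    then show ?thesis
      unfolding \<eta>(2) using assms by (simp add: spike_lr_def \<eta>_def real_sqrt_divide power_divide)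
  qed
  finally show ?thesis ..
qed

lemma borel_measurable_spike_lr_gauss [measurable]: "spike_lr p r \<delta> Q \<in> borel_measurable (gauss p)"
  unfolding spike_lr_def by measurable

text \<open>The Gaussian mean shift mixture turns all integrals against a spiked likelihood ratio into
  integrals over \<open>N(0, I\<^sub>r)\<close>, without diagonalisation.\<close>

lemma nn_integral_spike_lr_exp:
  fixes b :: "nat \<Rightarrow> real"
  assumes Q: "Q \<in> stiefel p r" and \<delta>: "0 \<le> \<delta>" "\<delta> < 1" and a: "a < 1"
  defines "\<eta> \<equiv> \<delta> / (1 - \<delta>)"
  assumes A: "\<eta> * a / (1 - a) < 1"
  shows "(\<integral>\<^sup>+x. ennreal (spike_lr p r \<delta> Q x) * ennreal (exp ((\<Sum>i<p. b i * x i) + a * (\<Sum>i<p. (x i)\<^sup>2) / 2)) \<partial>gauss p)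
    = ennreal (exp ((\<Sum>i<p. (b i)\<^sup>2) / (2 * (1 - a))) / sqrt (1 - a) ^ p
       * (exp (\<eta> / (1 - a)\<^sup>2 * (\<Sum>l<r. (\<Sum>i<p. Q $$ (i, l) * b i)\<^sup>2) / (2 * (1 - \<eta> * a / (1 - a))))
          / sqrt (1 - \<eta> * a / (1 - a)) ^ r))" (is "?L = ennreal (?C * _)")
proof -
  interpret P: prob_space "gauss p" by (rule prob_space_gauss)
  interpret R: prob_space "gauss r" by (rule prob_space_gauss)
  interpret pair_sigma_finite "gauss p" "gauss r" ..
  have \<eta>: "0 \<le> \<eta>" using \<delta> by (auto simp: \<eta>_def)
  define E1 where "E1 g x = sqrt \<eta> * (\<Sum>i<p. (\<Sum>l<r. Q $$ (i, l) * g l) * x i) - \<eta> / 2 * (\<Sum>l<r. (g l)\<^sup>2)" for g x :: "nat \<Rightarrow> real"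
  define E2 where "E2 x = (\<Sum>i<p. b i * x i) + a * (\<Sum>i<p. (x i)\<^sup>2) / 2" for x :: "nat \<Rightarrow> real"
  have "?L = (\<integral>\<^sup>+x. (\<integral>\<^sup>+g. ennreal (exp (E1 g x)) \<partial>gauss r) * ennreal (exp (E2 x)) \<partial>gauss p)"
    unfolding spike_lr_mixture[OF \<delta>] E1_def E2_def \<eta>_def ..
  also have "\<dots> = (\<integral>\<^sup>+x. \<integral>\<^sup>+g. ennreal (exp (E1 g x + E2 x)) \<partial>gauss r \<partial>gauss p)"
    unfolding E1_def
    by (subst nn_integral_multc[symmetric]) (auto simp: exp_add ennreal_mult')
  also have "\<dots> = (\<integral>\<^sup>+g. \<integral>\<^sup>+x. ennreal (exp (E1 g x + E2 x)) \<partial>gauss p \<partial>gauss r)"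
    unfolding E1_def E2_def by (rule Fubini'[symmetric]) measurable
  \<comment> \<open>The inner integral contributes \<open>\<eta> / (1 - a)\<close> to the quadratic
    form in \<open>g\<close> and the mixture weight takes off \<open>\<eta>\<close>. The difference
    is \<open>\<eta> * a / (1 - a)\<close>, which assumption \<open>A\<close> keeps below 1.\<close>
  also have "\<dots> = (\<integral>\<^sup>+g. ennreal ?C * ennreal (exp ((\<Sum>l<r. (sqrt \<eta> / (1 - a) * (\<Sum>i<p. Q $$ (i, l) * b i)) * g l)
       + (\<eta> * a / (1 - a)) * (\<Sum>l<r. (g l)\<^sup>2) / 2)) \<partial>gauss r)"
  proof (intro nn_integral_cong)
    fix g :: "nat \<Rightarrow> real"
    define v where "v i = (\<Sum>l<r. Q $$ (i, l) * g l)" for i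
    define G where "G = (\<Sum>l<r. (g l)\<^sup>2)"
    have "(\<integral>\<^sup>+x. ennreal (exp (E1 g x + E2 x)) \<partial>gauss p)
      = (\<integral>\<^sup>+x. ennreal (exp (- \<eta> / 2 * G)) * ennreal (exp ((\<Sum>i<p. (sqrt \<eta> * v i + b i) * x i) + a * (\<Sum>i<p. (x i)\<^sup>2) / 2)) \<partial>gauss p)"
      by (intro nn_integral_cong)
         (simp add: E1_def E2_def v_def[symmetric] G_def[symmetric] ennreal_mult'[symmetric] mult_exp_exp
            sum_distrib_left[of "sqrt \<eta>"] distrib_right sum.distrib mult.assoc)
    also have "\<dots> = ennreal (exp (- \<eta> / 2 * G)) * ennreal (exp ((\<Sum>i<p. (sqrt \<eta> * v i + b i)\<^sup>2) / (2 * (1 - a))) / sqrt (1 - a) ^ p)"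
      by (subst nn_integral_cmult) (simp_all add: nn_integral_gauss_exp[OF a])
    also have "(\<Sum>i<p. (sqrt \<eta> * v i + b i)\<^sup>2) = \<eta> * G + 2 * sqrt \<eta> * (\<Sum>i<p. v i * b i) + (\<Sum>i<p. (b i)\<^sup>2)"
    proof -
      have "(\<Sum>i<p. (sqrt \<eta> * v i + b i)\<^sup>2) = \<eta> * (\<Sum>i<p. (v i)\<^sup>2) + 2 * sqrt \<eta> * (\<Sum>i<p. v i * b i) + (\<Sum>i<p. (b i)\<^sup>2)"
        using \<eta> by (simp add: power2_sum sum.distrib sum_distrib_left power_mult_distrib ac_simps)
      also have "(\<Sum>i<p. (v i)\<^sup>2) = G"
        unfolding v_def G_def by (rule stiefel_isometry[OF Q])
      finally show ?thesis .
    qed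
    also have "(\<Sum>i<p. v i * b i) = (\<Sum>l<r. (\<Sum>i<p. Q $$ (i, l) * b i) * g l)"
      unfolding v_def by (simp add: sum_distrib_right, subst sum.swap) (simp add: ac_simps)
    also have "ennreal (exp (- \<eta> / 2 * G)) *
        ennreal (exp ((\<eta> * G + 2 * sqrt \<eta> * (\<Sum>l<r. (\<Sum>i<p. Q $$ (i, l) * b i) * g l) + (\<Sum>i<p. (b i)\<^sup>2)) / (2 * (1 - a))) / sqrt (1 - a) ^ p)
      = ennreal ?C * ennreal (exp ((\<Sum>l<r. (sqrt \<eta> / (1 - a) * (\<Sum>i<p. Q $$ (i, l) * b i)) * g l) + (\<eta> * a / (1 - a)) * G / 2))"
    proof -
      define S where "S = (\<Sum>l<r. (\<Sum>i<p. Q $$ (i, l) * b i) * g l)"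
      define B where "B = (\<Sum>i<p. (b i)\<^sup>2)"
      have S: "(\<Sum>l<r. (sqrt \<eta> / (1 - a) * (\<Sum>i<p. Q $$ (i, l) * b i)) * g l) = sqrt \<eta> / (1 - a) * S"
        unfolding S_def by (subst sum_distrib_left) (simp only: mult.assoc)
      have "- \<eta> / 2 * G + (\<eta> * G + 2 * sqrt \<eta> * S + B) / (2 * d) = B / (2 * d) + (sqrt \<eta> / d * S + (\<eta> * (1 - d) / d) * G / 2)"
        if "d > 0" for d
        using that by (simp add: field_simps)
      from this[of "1 - a"] have "- \<eta> / 2 * G + (\<eta> * G + 2 * sqrt \<eta> * S + B) / (2 * (1 - a))
        = B / (2 * (1 - a)) + (sqrt \<eta> / (1 - a) * S + (\<eta> * a / (1 - a)) * G / 2)"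
        using a by simp
      then show ?thesis
        unfolding S unfolding S_def[symmetric] B_def[symmetric]
        using a by (simp add: ennreal_mult'[symmetric] mult_exp_exp)
    qed
    finally show "(\<integral>\<^sup>+x. ennreal (exp (E1 g x + E2 x)) \<partial>gauss p) = ennreal ?C * ennreal (exp ((\<Sum>l<r. (sqrt \<eta> / (1 - a) * (\<Sum>i<p. Q $$ (i, l) * b i)) * g l)
       + (\<eta> * a / (1 - a)) * (\<Sum>l<r. (g l)\<^sup>2) / 2))" by (simp only: G_def)
  qed
  also have "\<dots> = ennreal ?C * ennreal (exp ((\<Sum>l<r. (sqrt \<eta> / (1 - a) * (\<Sum>i<p. Q $$ (i, l) * b i))\<^sup>2) / (2 * (1 - \<eta> * a / (1 - a))))
          / sqrt (1 - \<eta> * a / (1 - a)) ^ r)"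
    by (subst nn_integral_cmult, measurable) (simp only: nn_integral_gauss_exp[OF A])
  also have "(\<Sum>l<r. (sqrt \<eta> / (1 - a) * (\<Sum>i<p. Q $$ (i, l) * b i))\<^sup>2)
      = \<eta> / (1 - a)\<^sup>2 * (\<Sum>l<r. (\<Sum>i<p. Q $$ (i, l) * b i)\<^sup>2)"
    using \<eta> unfolding sum_scaled_squares by (simp add: power_divide)
  finally show ?thesis
    using a by (simp only: ennreal_mult') (subst ennreal_mult', simp_all)
qed

lemma nn_integral_spike_lr:
  assumes "Q \<in> stiefel p r" "0 \<le> \<delta>" "\<delta> < 1"
  shows "(\<integral>\<^sup>+x. ennreal (spike_lr p r \<delta> Q x) \<partial>gauss p) = 1"
  using nn_integral_spike_lr_exp[OF assms, of 0 "\<lambda>_. 0"] by simp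

text \<open>At \<open>\<delta> = 2 * \<nu>\<close> the integrand is a constant multiple of a spiked
  likelihood ratio, which integrates to 1. The result is the chi-square moment generating function
  with \<open>r\<close> degrees of freedom.\<close>

lemma nn_integral_gauss_exp_proj:
  assumes "Q \<in> stiefel p r" "0 \<le> \<nu>" "2 * \<nu> < 1"
  shows "(\<integral>\<^sup>+x. ennreal (exp (\<nu> * (\<Sum>l<r. (\<Sum>i<p. Q $$ (i, l) * x i)\<^sup>2))) \<partial>gauss p) = ennreal (1 / sqrt (1 - 2 * \<nu>) ^ r)"
proof -
  define c where "c = sqrt (1 - 2 * \<nu>) ^ r"
  have c: "c > 0" using assms by (simp add: c_def)
  have "1 = (\<integral>\<^sup>+x. ennreal (spike_lr p r (2 * \<nu>) Q x) \<partial>gauss p)"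
    using nn_integral_spike_lr[OF assms(1), of "2 * \<nu>"] assms by simp
  also have "\<dots> = (\<integral>\<^sup>+x. ennreal c * ennreal (exp (\<nu> * (\<Sum>l<r. (\<Sum>i<p. Q $$ (i, l) * x i)\<^sup>2))) \<partial>gauss p)"
    using c by (simp add: spike_lr_def c_def[symmetric] ennreal_mult')
  also have "\<dots> = ennreal c * (\<integral>\<^sup>+x. ennreal (exp (\<nu> * (\<Sum>l<r. (\<Sum>i<p. Q $$ (i, l) * x i)\<^sup>2))) \<partial>gauss p)"
    by (rule nn_integral_cmult) measurable
  finally have "ennreal (1 / c) * 1 = ennreal (1 / c) * (ennreal c * (\<integral>\<^sup>+x. ennreal (exp (\<nu> * (\<Sum>l<r. (\<Sum>i<p. Q $$ (i, l) * x i)\<^sup>2))) \<partial>gauss p))"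
    by simp
  moreover have "ennreal (1 / c) * ennreal c = 1"
    using c by (simp flip: ennreal_mult')
  ultimately show ?thesis by (simp only: mult.assoc[symmetric] mult_1_left mult_1_right c_def)
qed

text \<open>Only the first factor is opened as a mean shift mixture; given \<open>g\<close>, the
  second meets a linear tilt by \<open>sqrt \<eta> * Q1 g\<close>. The terms in
  \<open>|g|\<^sup>2\<close> cancel and \<open>\<eta>\<^sup>2 / 2 * |Q2' Q1 g|\<^sup>2\<close>
  remains. The determinant is left as this integral so that convexity can act on the
  exponent.\<close>

lemma nn_integral_spike_lr_cross:
  assumes Q1: "Q1 \<in> stiefel p r" and Q2: "Q2 \<in> stiefel p r" and \<delta>: "0 \<le> \<delta>" "\<delta> < 1"
  shows "(\<integral>\<^sup>+x. ennreal (spike_lr p r \<delta> Q1 x) * ennreal (spike_lr p r \<delta> Q2 x) \<partial>gauss p)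
    = (\<integral>\<^sup>+g. ennreal (exp ((\<delta> / (1 - \<delta>))\<^sup>2 / 2 * (\<Sum>l<r. (\<Sum>k<r. (\<Sum>i<p. Q1 $$ (i, k) * Q2 $$ (i, l)) * g k)\<^sup>2))) \<partial>gauss r)"
    (is "?L = _")
proof -
  interpret P: prob_space "gauss p" by (rule prob_space_gauss)
  interpret R: prob_space "gauss r" by (rule prob_space_gauss)
  interpret pair_sigma_finite "gauss p" "gauss r" ..
  define \<eta> where "\<eta> = \<delta> / (1 - \<delta>)"
  have \<eta>: "0 \<le> \<eta>" using \<delta> by (auto simp: \<eta>_def)
  define E1 where "E1 g x = sqrt \<eta> * (\<Sum>i<p. (\<Sum>k<r. Q1 $$ (i, k) * g k) * x i) - \<eta> / 2 * (\<Sum>k<r. (g k)\<^sup>2)" for g x :: "nat \<Rightarrow> real"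
  have "?L = (\<integral>\<^sup>+x. (\<integral>\<^sup>+g. ennreal (exp (E1 g x)) \<partial>gauss r) * ennreal (spike_lr p r \<delta> Q2 x) \<partial>gauss p)"
    unfolding spike_lr_mixture[OF \<delta>, of p r Q1] E1_def \<eta>_def ..
  also have "\<dots> = (\<integral>\<^sup>+x. \<integral>\<^sup>+g. ennreal (exp (E1 g x)) * ennreal (spike_lr p r \<delta> Q2 x) \<partial>gauss r \<partial>gauss p)"
    unfolding E1_def by (subst nn_integral_multc[symmetric]) auto
  also have "\<dots> = (\<integral>\<^sup>+g. \<integral>\<^sup>+x. ennreal (exp (E1 g x)) * ennreal (spike_lr p r \<delta> Q2 x) \<partial>gauss p \<partial>gauss r)"
    unfolding E1_def spike_lr_def by (rule Fubini'[symmetric]) measurable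
  also have "\<dots> = (\<integral>\<^sup>+g. ennreal (exp (\<eta>\<^sup>2 / 2 * (\<Sum>l<r. (\<Sum>k<r. (\<Sum>i<p. Q1 $$ (i, k) * Q2 $$ (i, l)) * g k)\<^sup>2))) \<partial>gauss r)"
  proof (intro nn_integral_cong)
    fix g :: "nat \<Rightarrow> real"
    define v where "v i = (\<Sum>k<r. Q1 $$ (i, k) * g k)" for i
    define G where "G = (\<Sum>k<r. (g k)\<^sup>2)"
    have G: "(\<Sum>i<p. (v i)\<^sup>2) = G"
      unfolding v_def G_def by (rule stiefel_isometry[OF Q1])
    \<comment> \<open>The vanishing quadratic term gives the integrand the shape of
      \<open>nn_integral_spike_lr_exp\<close> at \<open>a = 0\<close>.\<close>
    have "(\<integral>\<^sup>+x. ennreal (exp (E1 g x)) * ennreal (spike_lr p r \<delta> Q2 x) \<partial>gauss p)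
      = (\<integral>\<^sup>+x. ennreal (exp (- \<eta> / 2 * G)) * (ennreal (spike_lr p r \<delta> Q2 x) * ennreal (exp ((\<Sum>i<p. (sqrt \<eta> * v i) * x i) + 0 * (\<Sum>i<p. (x i)\<^sup>2) / 2))) \<partial>gauss p)"
    proof (intro nn_integral_cong)
      fix x :: "nat \<Rightarrow> real"
      have "exp (E1 g x) = exp (- \<eta> / 2 * G) * exp ((\<Sum>i<p. (sqrt \<eta> * v i) * x i) + 0 * (\<Sum>i<p. (x i)\<^sup>2) / 2)"
        by (simp add: E1_def G_def[symmetric] v_def[symmetric] mult_exp_exp sum_distrib_left[of "sqrt \<eta>"] mult.assoc)
      then show "ennreal (exp (E1 g x)) * ennreal (spike_lr p r \<delta> Q2 x) = ennreal (exp (- \<eta> / 2 * G)) * (ennreal (spike_lr p r \<delta> Q2 x) * ennreal (exp ((\<Sum>i<p. (sqrt \<eta> * v i) * x i) + 0 * (\<Sum>i<p. (x i)\<^sup>2) / 2)))"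
        by (simp only:) (simp add: ennreal_mult' ac_simps)
    qed
    also have "\<dots> = ennreal (exp (- \<eta> / 2 * G)) * ennreal (exp ((\<Sum>i<p. (sqrt \<eta> * v i)\<^sup>2) / 2) * exp (\<eta> * (\<Sum>l<r. (\<Sum>i<p. Q2 $$ (i, l) * (sqrt \<eta> * v i))\<^sup>2) / 2))"
      by (subst nn_integral_cmult, measurable)
         (subst nn_integral_spike_lr_exp[OF Q2 \<delta>], simp_all add: \<eta>_def)
    also have "(\<Sum>i<p. (sqrt \<eta> * v i)\<^sup>2) = \<eta> * G"
      using \<eta> by (simp add: power_mult_distrib sum_distrib_left[symmetric] G)
    also have "(\<Sum>l<r. (\<Sum>i<p. Q2 $$ (i, l) * (sqrt \<eta> * v i))\<^sup>2) = \<eta> * (\<Sum>l<r. (\<Sum>i<p. Q2 $$ (i, l) * v i)\<^sup>2)"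
    proof -
      have "(\<Sum>i<p. Q2 $$ (i, l) * (sqrt \<eta> * v i))\<^sup>2 = \<eta> * (\<Sum>i<p. Q2 $$ (i, l) * v i)\<^sup>2" for l
      proof -
        have "(\<Sum>i<p. Q2 $$ (i, l) * (sqrt \<eta> * v i)) = sqrt \<eta> * (\<Sum>i<p. Q2 $$ (i, l) * v i)"
          by (simp add: sum_distrib_left ac_simps)
        then show ?thesis using \<eta> by (simp add: power_mult_distrib)
      qed
      then show ?thesis by (simp add: sum_distrib_left)
    qed
    also have "(\<Sum>l<r. (\<Sum>i<p. Q2 $$ (i, l) * v i)\<^sup>2) = (\<Sum>l<r. (\<Sum>k<r. (\<Sum>i<p. Q1 $$ (i, k) * Q2 $$ (i, l)) * g k)\<^sup>2)"
      unfolding v_def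
    proof (rule sum.cong[OF refl])
      fix l
      have "(\<Sum>i<p. Q2 $$ (i, l) * (\<Sum>k<r. Q1 $$ (i, k) * g k)) = (\<Sum>k<r. (\<Sum>i<p. Q1 $$ (i, k) * Q2 $$ (i, l)) * g k)"
        by (simp add: sum_distrib_right sum_distrib_left, subst sum.swap, simp add: ac_simps)
      then show "(\<Sum>i<p. Q2 $$ (i, l) * (\<Sum>k<r. Q1 $$ (i, k) * g k))\<^sup>2 = (\<Sum>k<r. (\<Sum>i<p. Q1 $$ (i, k) * Q2 $$ (i, l)) * g k)\<^sup>2"
        by simp
    qed
    finally show "(\<integral>\<^sup>+x. ennreal (exp (E1 g x)) * ennreal (spike_lr p r \<delta> Q2 x) \<partial>gauss p)
      = ennreal (exp (\<eta>\<^sup>2 / 2 * (\<Sum>l<r. (\<Sum>k<r. (\<Sum>i<p. Q1 $$ (i, k) * Q2 $$ (i, l)) * g k)\<^sup>2)))"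
      by (simp add: ennreal_mult'[symmetric] mult_exp_exp power2_eq_square mult.assoc)
  qed
  finally show ?thesis by (simp add: \<eta>_def)
qed

subsection \<open>The uniform law on the Stiefel manifold\<close>

lemma convex_on_power_nonneg: "convex_on {0::real..} (\<lambda>x. x ^ n)"
proof (cases "even n")
  case True
  then show ?thesis
    using convex_power_even[of n] by (auto intro: convex_on_subset)
qed (rule convex_power_odd)

lemma mean_power_le:
  fixes e :: "nat \<Rightarrow> real"
  assumes "r > 0" "\<And>j. 0 \<le> e j"
  shows "((\<Sum>j<r. e j) / r) ^ n \<le> (\<Sum>j<r. e j ^ n) / r"
  using convex_on_sum[OF _ _ convex_on_power_nonneg[of n], of "{..<r}" "\<lambda>_. 1 / r" e] assms
  by (auto simp: sum_divide_distrib)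

text \<open>Jensen's inequality with equal weights \<open>1 / r\<close> separates the terms of the
  sum at the price of a factor \<open>r\<close> in the exponent. This factor is the origin of
  \<open>T = r * (\<delta> / (1 - \<delta>))\<^sup>2\<close>.\<close>

lemma exp_mean_le:
  fixes e :: "nat \<Rightarrow> real"
  assumes "r > 0"
  shows "exp (\<Sum>j<r. e j) \<le> (\<Sum>j<r. exp (r * e j)) / r"
  using convex_on_sum[OF _ _ exp_convex, of "{..<r}" "\<lambda>_. 1 / r" "\<lambda>j. r * e j"] assms
  by (auto simp: sum_divide_distrib)

text \<open>From \<open>1 + u \<le> exp u\<close> at \<open>u = t / (1 - t)\<close>. The fixed
  \<open>T\<close> in the denominator makes the exponent linear in \<open>t\<close>, so that a
  moment generating function can take over.\<close>

lemma inverse_sqrt_le_exp: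
  assumes "0 \<le> t" "t \<le> T" "T < (1 :: real)"
  shows "1 / sqrt (1 - t) \<le> exp (t / (2 * (1 - T)))"
proof -
  have "1 \<le> exp (t / (1 - t)) * (1 - t)"
    using exp_ge_add_one_self[of "t / (1 - t)"] assms by (simp add: field_simps)
  also have "\<dots> \<le> exp (t / (1 - T)) * (1 - t)"
    using assms by (intro mult_right_mono) (auto intro!: divide_left_mono)
  finally have "sqrt 1 \<le> sqrt (exp (t / (1 - T)) * (1 - t))" by (rule real_sqrt_le_mono)
  also have "\<dots> = exp (t / (2 * (1 - T))) * sqrt (1 - t)"
  proof -
    have "t / d = 2 * (t / (2 * d))" for d by simp
    from this[of "1 - T"] have "exp (t / (1 - T)) = (exp (t / (2 * (1 - T))))\<^sup>2"
      by (simp only: exp_double)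
    then show ?thesis by (simp add: real_sqrt_mult)
  qed
  finally show ?thesis using assms by (simp add: field_simps)
qed

text \<open>The matching lower bound, from \<open>1 - t \<le> exp (- t)\<close>. It agrees with the
  upper bound to first order for small \<open>t\<close> and \<open>T\<close>, which lets upper and
  lower moment bounds share a limit.\<close>

lemma exp_le_inverse_sqrt:
  assumes "t < (1 :: real)"
  shows "exp (t / 2) \<le> 1 / sqrt (1 - t)"
proof -
  have "exp (t / 2) * sqrt (1 - t) \<le> sqrt (exp t * (1 - t))"
  proof -
    have "exp t = (exp (t / 2))\<^sup>2" by (simp add: power2_eq_square mult_exp_exp)
    then show ?thesis by (simp add: real_sqrt_mult)
  qed
  also have "\<dots> \<le> sqrt 1"
  proof (rule real_sqrt_le_mono)
    have "1 - t \<le> exp (- t)" using exp_ge_add_one_self[of "- t"] by simp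
    then show "exp t * (1 - t) \<le> 1" by (simp add: exp_minus field_simps)
  qed
  finally show ?thesis using assms by (simp add: field_simps)
qed

section \<open>Measurability and invariance on the Stiefel manifold\<close>

lemma space_stiefel_borel [simp]: "space (stiefel_borel p r) = stiefel p r"
  by (simp add: stiefel_borel_def)

lemma borel_measurable_stiefel_entry [measurable]:
  assumes "i \<in> {..<p}" "l \<in> {..<r}"
  shows "(\<lambda>Q. Q $$ (i, l)) \<in> borel_measurable (stiefel_borel p r)"
proof -
  have "(\<lambda>Q. \<lambda>(i, j)\<in>{..<p} \<times> {..<r}. Q $$ (i, j)) \<in> stiefel_borel p r \<rightarrow>\<^sub>M (\<Pi>\<^sub>M k\<in>{..<p} \<times> {..<r}. (borel :: real measure))"
    unfolding stiefel_borel_def by (intro measurable_vimage_algebra1) (auto simp: space_PiM)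
  then have "(\<lambda>Q. (\<lambda>(i, j)\<in>{..<p} \<times> {..<r}. Q $$ (i, j)) (i, l)) \<in> borel_measurable (stiefel_borel p r)"
    by (rule measurable_compose) (use assms in \<open>auto intro!: measurable_component_singleton\<close>)
  then show ?thesis using assms by simp
qed

lemma orthogonal_mult_stiefel:
  assumes "H \<in> orthogonal_group p" "Q \<in> stiefel p r"
  shows "H * Q \<in> stiefel p r"
proof -
  have H: "H \<in> carrier_mat p p" "transpose_mat H * H = 1\<^sub>m p" using assms by (auto simp: orthogonal_group_def)
  have Q: "Q \<in> carrier_mat p r" "transpose_mat Q * Q = 1\<^sub>m r" using assms by (auto simp: stiefel_def)
  have "transpose_mat (H * Q) * (H * Q) = (transpose_mat Q * transpose_mat H) * (H * Q)"
    using transpose_mult[OF H(1) Q(1)] by simp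
  also have "\<dots> = transpose_mat Q * (transpose_mat H * (H * Q))"
    using H(1) Q(1) by (intro assoc_mult_mat[of _ r p _ p _ r]) auto
  also have "transpose_mat H * (H * Q) = (transpose_mat H * H) * Q"
    using H(1) Q(1) by (intro assoc_mult_mat[of _ p p _ p _ r, symmetric]) auto
  also have "\<dots> = Q" using H(2) Q(1) by simp
  finally show ?thesis using H(1) Q by (auto simp: stiefel_def)
qed

lemma orthogonal_mult_entry:
  assumes "H \<in> orthogonal_group p" "Q \<in> stiefel p r" "i < p" "l < r"
  shows "(H * Q) $$ (i, l) = (\<Sum>k<p. H $$ (i, k) * Q $$ (k, l))"
proof -
  have "H \<in> carrier_mat p p" "Q \<in> carrier_mat p r" using assms by (auto simp: orthogonal_group_def stiefel_def)
  then show ?thesis using assms by (auto simp: scalar_prod_def lessThan_atLeast0 intro!: sum.cong)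
qed

lemma measurable_orthogonal_mult:
  assumes "H \<in> orthogonal_group p"
  shows "(\<lambda>Q. H * Q) \<in> stiefel_borel p r \<rightarrow>\<^sub>M stiefel_borel p r"
  \<comment> \<open>Only the codomain is unfolded; the domain stays folded so that the measurability
    of entries still applies to it.\<close>
  unfolding stiefel_borel_def[of p r, THEN arg_cong[where f = "measurable (stiefel_borel p r)"]]
proof (rule measurable_vimage_algebra2)
  show "(\<lambda>Q. H * Q) \<in> space (stiefel_borel p r) \<rightarrow> stiefel p r"
    using assms by (auto intro: orthogonal_mult_stiefel)
  have "(\<lambda>Q. \<lambda>k\<in>{..<p} \<times> {..<r}. \<Sum>j<p. H $$ (fst k, j) * Q $$ (j, snd k)) \<in> stiefel_borel p r \<rightarrow>\<^sub>M (\<Pi>\<^sub>M k\<in>{..<p} \<times> {..<r}. (borel :: real measure))"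
  proof (rule measurable_restrict)
    fix k assume "k \<in> {..<p} \<times> {..<r}"
    then have "snd k \<in> {..<r}" by auto
    then show "(\<lambda>Q. \<Sum>j<p. H $$ (fst k, j) * Q $$ (j, snd k)) \<in> borel_measurable (stiefel_borel p r)"
      by (intro borel_measurable_sum borel_measurable_times borel_measurable_const borel_measurable_stiefel_entry)
  qed
  then show "(\<lambda>Q. \<lambda>(i, j)\<in>{..<p} \<times> {..<r}. (H * Q) $$ (i, j)) \<in> stiefel_borel p r \<rightarrow>\<^sub>M (\<Pi>\<^sub>M k\<in>{..<p} \<times> {..<r}. (borel :: real measure))"
    by (rule measurable_cong[THEN iffD1, rotated])
       (auto simp: fun_eq_iff restrict_def orthogonal_mult_entry[OF assms])
qed

lemma nn_integral_uniform_orthogonal_mult: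
  assumes U: "uniform_on_stiefel p r U" and H: "H \<in> orthogonal_group p"
    and F: "F \<in> borel_measurable (stiefel_borel p r)"
  shows "(\<integral>\<^sup>+Q. F (H * Q) \<partial>U) = (\<integral>\<^sup>+Q. F Q \<partial>U)"
proof -
  have s: "sets U = sets (stiefel_borel p r)" and d: "distr U (stiefel_borel p r) (\<lambda>Q. H * Q) = U"
    using U H by (auto simp: uniform_on_stiefel_def)
  have "(\<integral>\<^sup>+Q. F Q \<partial>U) = (\<integral>\<^sup>+Q. F Q \<partial>distr U (stiefel_borel p r) (\<lambda>Q. H * Q))"
    by (simp only: d)
  also have "\<dots> = (\<integral>\<^sup>+Q. F (H * Q) \<partial>U)"
    using F measurable_orthogonal_mult[OF H] by (intro nn_integral_distr) (auto cong: measurable_cong_sets[OF s refl])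
  finally show ?thesis ..
qed

text \<open>The Householder reflection along \<open>x - y\<close>. It supplies the orthogonal matrix
  that carries one test vector to another of the same length.\<close>

lemma ex_reflection:
  fixes x y :: "nat \<Rightarrow> real"
  assumes eq: "(\<Sum>i<p. (x i)\<^sup>2) = (\<Sum>i<p. (y i)\<^sup>2)" and ne: "\<exists>i<p. x i \<noteq> y i"
  obtains H where "H \<in> orthogonal_group p" "\<And>j. j < p \<Longrightarrow> (\<Sum>i<p. H $$ (i, j) * x i) = y j"
proof -
  define u where "u i = x i - y i" for i
  define c where "c = (\<Sum>i<p. (u i)\<^sup>2)"
  obtain i where i: "i < p" "x i \<noteq> y i" using ne by auto
  have "c > 0"
    unfolding c_def by (rule sum_pos2[of _ i]) (use i in \<open>auto simp: u_def\<close>)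
  \<comment> \<open>Equal lengths give \<open>|x - y|\<^sup>2 = 2 * <x - y, x>\<close>, so the
    reflection displaces \<open>x\<close> by exactly \<open>x - y\<close>.\<close>
  have c2: "2 * (\<Sum>i<p. u i * x i) = c"
  proof -
    have "c = 2 * (\<Sum>i<p. u i * x i) + ((\<Sum>i<p. (y i)\<^sup>2) - (\<Sum>i<p. (x i)\<^sup>2))"
      unfolding c_def u_def sum_subtractf[symmetric] sum.distrib[symmetric] sum_distrib_left
      by (intro sum.cong) (auto simp: power2_eq_square algebra_simps)
    then show ?thesis using eq by simp
  qed
  define H where "H = Matrix.mat p p (\<lambda>(i, j). (if i = j then 1 else 0) - 2 * u i * u j / c)"
  have H: "H \<in> carrier_mat p p" by (simp add: H_def)
  have HT: "transpose_mat H = H" by (rule eq_matI) (auto simp: H_def)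
  have sum_sq: "(\<Sum>k<p. K * (u k)\<^sup>2) = K * c" for K
    unfolding c_def sum_distrib_left ..
  have HH: "H * H = 1\<^sub>m p"
  proof (rule eq_matI)
    fix i j assume "i < dim_row (1\<^sub>m p :: real mat)" "j < dim_col (1\<^sub>m p :: real mat)"
    then have ij: "i < p" "j < p" by auto
    have "(H * H) $$ (i, j) = (\<Sum>k<p. ((if i = k then 1 else 0) - 2 * u i * u k / c) * ((if k = j then 1 else 0) - 2 * u k * u j / c))"
      using ij by (auto simp: H_def scalar_prod_def lessThan_atLeast0 intro!: sum.cong)
    also have "\<dots> = (\<Sum>k<p. (if k = i then (if k = j then 1 else 0) - 2 * u k * u j / c else 0) - (if k = j then 2 * u i * u k / c else 0) + 4 * u i * u j / c\<^sup>2 * (u k)\<^sup>2)"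
      using \<open>c > 0\<close> by (intro sum.cong refl) (auto simp: power2_eq_square field_simps)
    also have "\<dots> = ((if i = j then 1 else 0) - 2 * u i * u j / c) - 2 * u i * u j / c + 4 * u i * u j / c\<^sup>2 * c"
      using ij by (simp add: sum.distrib sum_subtractf sum_sq del: times_divide_eq_left)
    also have "\<dots> = 1\<^sub>m p $$ (i, j)"
      using ij \<open>c > 0\<close> by (auto simp: power2_eq_square field_simps)
    finally show "(H * H) $$ (i, j) = 1\<^sub>m p $$ (i, j)" .
  qed (auto simp: H_def)
  show thesis
  proof
    show "H \<in> orthogonal_group p" using H HT HH by (simp add: orthogonal_group_def)
    fix j assume j: "j < p"
    have "(\<Sum>i<p. H $$ (i, j) * x i) = (\<Sum>i<p. (if i = j then x i else 0) - 2 * u j / c * (u i * x i))"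
      using j by (intro sum.cong refl) (auto simp: H_def algebra_simps)
    also have "\<dots> = x j - u j / c * (2 * (\<Sum>i<p. u i * x i))"
      using j unfolding sum_subtractf sum_distrib_left[symmetric] by simp
    also have "\<dots> = y j" using \<open>c > 0\<close> by (simp add: c2) (simp add: u_def)
    finally show "(\<Sum>i<p. H $$ (i, j) * x i) = y j" .
  qed
qed

text \<open>Replacing \<open>Q\<close> by \<open>H * Q\<close> turns \<open>Q' x\<close> into
  \<open>Q' (H' x)\<close>, and the reflection has \<open>H' x = y\<close>. Coincident vectors are
  split off because the reflection would divide by zero.\<close>

lemma nn_integral_uniform_proj_cong:
  fixes x y :: "nat \<Rightarrow> real"
  assumes U: "uniform_on_stiefel p r U" and eq: "(\<Sum>i<p. (x i)\<^sup>2) = (\<Sum>i<p. (y i)\<^sup>2)"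
  shows "(\<integral>\<^sup>+Q. ennreal (exp (\<nu> * (\<Sum>l<r. (\<Sum>i<p. Q $$ (i, l) * x i)\<^sup>2))) \<partial>U)
    = (\<integral>\<^sup>+Q. ennreal (exp (\<nu> * (\<Sum>l<r. (\<Sum>i<p. Q $$ (i, l) * y i)\<^sup>2))) \<partial>U)"
proof (cases "\<exists>i<p. x i \<noteq> y i")
  case True
  obtain H where H: "H \<in> orthogonal_group p" "\<And>j. j < p \<Longrightarrow> (\<Sum>i<p. H $$ (i, j) * x i) = y j"
    using ex_reflection[OF eq True] by metis
  have sp: "space U = stiefel p r"
    using U sets_eq_imp_space_eq[of U "stiefel_borel p r"] by (auto simp: uniform_on_stiefel_def)
  have "(\<integral>\<^sup>+Q. ennreal (exp (\<nu> * (\<Sum>l<r. (\<Sum>i<p. Q $$ (i, l) * x i)\<^sup>2))) \<partial>U)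
    = (\<integral>\<^sup>+Q. ennreal (exp (\<nu> * (\<Sum>l<r. (\<Sum>i<p. (H * Q) $$ (i, l) * x i)\<^sup>2))) \<partial>U)"
    by (rule nn_integral_uniform_orthogonal_mult[OF U H(1), symmetric]) measurable
  also have "\<dots> = (\<integral>\<^sup>+Q. ennreal (exp (\<nu> * (\<Sum>l<r. (\<Sum>i<p. Q $$ (i, l) * y i)\<^sup>2))) \<partial>U)"
  proof (rule nn_integral_cong)
    fix Q assume "Q \<in> space U"
    then have Q: "Q \<in> stiefel p r" using sp by simp
    have "(\<Sum>i<p. (H * Q) $$ (i, l) * x i) = (\<Sum>i<p. Q $$ (i, l) * y i)" if l: "l < r" for l
    proof -
      have "(\<Sum>i<p. (H * Q) $$ (i, l) * x i) = (\<Sum>i<p. \<Sum>k<p. H $$ (i, k) * Q $$ (k, l) * x i)"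
        by (simp add: orthogonal_mult_entry[OF H(1) Q] l sum_distrib_right)
      also have "\<dots> = (\<Sum>k<p. Q $$ (k, l) * (\<Sum>i<p. H $$ (i, k) * x i))"
        by (subst sum.swap) (simp add: sum_distrib_left ac_simps)
      finally show ?thesis by (simp add: H(2))
    qed
    then show "ennreal (exp (\<nu> * (\<Sum>l<r. (\<Sum>i<p. (H * Q) $$ (i, l) * x i)\<^sup>2))) = ennreal (exp (\<nu> * (\<Sum>l<r. (\<Sum>i<p. Q $$ (i, l) * y i)\<^sup>2)))"
      by simp
  qed
  finally show ?thesis .
qed simp

text \<open>A Gaussian vector is a random multiple of a rotation of \<open>a\<close>, so by Jensen's inequality in the
  squared length, whose mean is \<open>p\<close>, the Gaussian moment generating function dominates the one of
  the projection.\<close>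

lemma nn_integral_uniform_proj_le:
  fixes a :: "nat \<Rightarrow> real"
  assumes U: "uniform_on_stiefel p r U" and a: "(\<Sum>i<p. (a i)\<^sup>2) = 1" and \<nu>: "0 \<le> \<nu>" "2 * \<nu> < 1"
  shows "(\<integral>\<^sup>+Q. ennreal (exp (\<nu> * p * (\<Sum>l<r. (\<Sum>i<p. Q $$ (i, l) * a i)\<^sup>2))) \<partial>U) \<le> ennreal (1 / sqrt (1 - 2 * \<nu>) ^ r)"
proof -
  have sU[measurable_cong]: "sets U = sets (stiefel_borel p r)" and "prob_space U"
    using U by (auto simp: uniform_on_stiefel_def)
  have sp: "space U = stiefel p r"
    using sets_eq_imp_space_eq[OF sU] by simp
  interpret U: prob_space U by fact
  interpret P: prob_space "gauss p" by (rule prob_space_gauss)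
  interpret pair_sigma_finite "gauss p" U ..
  define m where "m Q = (\<Sum>l<r. (\<Sum>i<p. Q $$ (i, l) * a i)\<^sup>2)" for Q
  have [measurable]: "m \<in> borel_measurable U" unfolding m_def by measurable
  have "(\<integral>\<^sup>+Q. ennreal (exp (\<nu> * p * m Q)) \<partial>U)
      \<le> (\<integral>\<^sup>+Q. \<integral>\<^sup>+x. ennreal (exp (\<nu> * m Q * (\<Sum>i<p. (x i)\<^sup>2))) \<partial>gauss p \<partial>U)"
  proof (rule nn_integral_mono)
    fix Q assume "Q \<in> space U"
    then have Q: "Q \<in> stiefel p r" using sp by simp
    \<comment> \<open>Bessel's inequality keeps \<open>2 * \<nu> * m Q\<close> below 1, so the
      Gaussian integral over \<open>x\<close> has its closed form.\<close>
    have "m Q \<le> 1" using stiefel_bessel[OF Q, of a] a by (simp add: m_def)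
    moreover have "0 \<le> m Q" unfolding m_def by (intro sum_nonneg) simp
    ultimately have *: "2 * \<nu> * m Q < 1"
      using \<nu> by (smt (verit) mult_left_le)
    \<comment> \<open>Jensen's inequality becomes an explicit comparison, since the moment
      generating function of the squared length is known.\<close>
    have "exp (\<nu> * p * m Q) = exp (2 * \<nu> * m Q / 2) ^ p"
      by (simp add: exp_of_nat_mult[symmetric])
    also have "\<dots> \<le> (1 / sqrt (1 - 2 * \<nu> * m Q)) ^ p"
      by (intro power_mono exp_le_inverse_sqrt * ) simp
    also have "ennreal \<dots> = (\<integral>\<^sup>+x. ennreal (exp (\<nu> * m Q * (\<Sum>i<p. (x i)\<^sup>2))) \<partial>gauss p)"
      using nn_integral_gauss_exp[OF *, of p "\<lambda>_. 0"] by (simp add: power_one_over mult.assoc)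
    finally show "ennreal (exp (\<nu> * p * m Q)) \<le> (\<integral>\<^sup>+x. ennreal (exp (\<nu> * m Q * (\<Sum>i<p. (x i)\<^sup>2))) \<partial>gauss p)"
      by (simp add: ennreal_leI)
  qed
  also have "\<dots> = (\<integral>\<^sup>+x. \<integral>\<^sup>+Q. ennreal (exp (\<nu> * m Q * (\<Sum>i<p. (x i)\<^sup>2))) \<partial>U \<partial>gauss p)"
    by (rule Fubini') measurable
  \<comment> \<open>For fixed \<open>x\<close> the vectors \<open>x\<close> and \<open>c * a\<close>
    have the same length, so invariance exchanges them under the integral over
    \<open>Q\<close>.\<close>
  also have "\<dots> = (\<integral>\<^sup>+x. \<integral>\<^sup>+Q. ennreal (exp (\<nu> * (\<Sum>l<r. (\<Sum>i<p. Q $$ (i, l) * x i)\<^sup>2))) \<partial>U \<partial>gauss p)"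
  proof (rule nn_integral_cong)
    fix x :: "nat \<Rightarrow> real"
    define c where "c = sqrt (\<Sum>i<p. (x i)\<^sup>2)"
    have c: "c\<^sup>2 = (\<Sum>i<p. (x i)\<^sup>2)" unfolding c_def by (simp add: sum_nonneg)
    have "(\<integral>\<^sup>+Q. ennreal (exp (\<nu> * (\<Sum>l<r. (\<Sum>i<p. Q $$ (i, l) * x i)\<^sup>2))) \<partial>U)
      = (\<integral>\<^sup>+Q. ennreal (exp (\<nu> * (\<Sum>l<r. (\<Sum>i<p. Q $$ (i, l) * (c * a i))\<^sup>2))) \<partial>U)"
      by (rule nn_integral_uniform_proj_cong[OF U]) (unfold sum_scaled_squares, simp add: c a)
    also have "\<dots> = (\<integral>\<^sup>+Q. ennreal (exp (\<nu> * m Q * (\<Sum>i<p. (x i)\<^sup>2))) \<partial>U)"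
    proof -
      have "(\<Sum>i<p. Q $$ (i, l) * (c * a i)) = c * (\<Sum>i<p. Q $$ (i, l) * a i)" for Q l
        by (simp add: sum_distrib_left ac_simps)
      then show ?thesis unfolding m_def c[symmetric] by (simp add: sum_scaled_squares ac_simps)
    qed
    finally show "(\<integral>\<^sup>+Q. ennreal (exp (\<nu> * m Q * (\<Sum>i<p. (x i)\<^sup>2))) \<partial>U)
      = (\<integral>\<^sup>+Q. ennreal (exp (\<nu> * (\<Sum>l<r. (\<Sum>i<p. Q $$ (i, l) * x i)\<^sup>2))) \<partial>U)" ..
  qed
  \<comment> \<open>Exchanged back: for fixed \<open>Q\<close> the vector \<open>Q' x\<close> is
    standard normal in dimension \<open>r\<close>, so the integrand no longer depends on
    \<open>Q\<close>.\<close>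
  also have "\<dots> = (\<integral>\<^sup>+Q. \<integral>\<^sup>+x. ennreal (exp (\<nu> * (\<Sum>l<r. (\<Sum>i<p. Q $$ (i, l) * x i)\<^sup>2))) \<partial>gauss p \<partial>U)"
    by (rule Fubini'[symmetric]) measurable
  also have "\<dots> = (\<integral>\<^sup>+Q. ennreal (1 / sqrt (1 - 2 * \<nu>) ^ r) \<partial>U)"
    by (intro nn_integral_cong nn_integral_gauss_exp_proj \<nu>) (simp add: sp)
  finally show ?thesis by (simp add: m_def U.emeasure_space_1)
qed

text \<open>Convexity of \<open>exp\<close> replaces the quadratic form by single columns of
  \<open>Q1' Q2\<close>, each giving a rank one Gaussian integral
  \<open>1 / sqrt (1 - T * W l)\<close>. Convexity of the power moves \<open>n\<close> inside the
  mean over columns, and the square root is traded for an exponential linear in \<open>W l\<close>.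
  What remains depends on the squared length of one column at a time.\<close>

lemma spike_lr_cross_power_le:
  fixes T :: real
  assumes Q1: "Q1 \<in> stiefel p r" and Q2: "Q2 \<in> stiefel p r" and \<delta>: "0 \<le> \<delta>" "\<delta> < 1" and r: "r > 0"
    and T: "T = r * (\<delta> / (1 - \<delta>))\<^sup>2" "T < 1"
  shows "(\<integral>\<^sup>+x. ennreal (spike_lr p r \<delta> Q1 x) * ennreal (spike_lr p r \<delta> Q2 x) \<partial>gauss p) ^ n
    \<le> ennreal ((\<Sum>l<r. exp (n * T / (2 * (1 - T)) * (\<Sum>k<r. (\<Sum>i<p. Q1 $$ (i, k) * Q2 $$ (i, l))\<^sup>2))) / r)"
proof -
  define w where "w k l = (\<Sum>i<p. Q1 $$ (i, k) * Q2 $$ (i, l))" for k l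
  define W where "W l = (\<Sum>k<r. (w k l)\<^sup>2)" for l
  have T0: "0 \<le> T" by (simp add: T)
  \<comment> \<open>\<open>W l\<close> is the squared length of the projection of a unit vector,
    column \<open>l\<close> of \<open>Q2\<close>, on the span of the columns of
    \<open>Q1\<close>.\<close>
  have W: "0 \<le> W l" "l < r \<Longrightarrow> W l \<le> 1" for l
  proof -
    show "0 \<le> W l" unfolding W_def by (intro sum_nonneg) simp
    assume "l < r"
    then have "(\<Sum>i<p. (Q2 $$ (i, l))\<^sup>2) = 1"
      using stiefel_orthonormal[OF Q2, of l l] by (simp add: power2_eq_square)
    then show "W l \<le> 1"
      using stiefel_bessel[OF Q1, of "\<lambda>i. Q2 $$ (i, l)"] by (simp add: W_def w_def)
  qed
  have TW: "T * W l \<le> T" "T * W l < 1" if "l < r" for l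
    using W(2)[OF that] T0 T(2) by (auto simp: mult_left_le intro: le_less_trans[of _ T])
  have "(\<integral>\<^sup>+x. ennreal (spike_lr p r \<delta> Q1 x) * ennreal (spike_lr p r \<delta> Q2 x) \<partial>gauss p)
    = (\<integral>\<^sup>+g. ennreal (exp (\<Sum>l<r. (\<delta> / (1 - \<delta>))\<^sup>2 / 2 * (\<Sum>k<r. w k l * g k)\<^sup>2)) \<partial>gauss r)"
    unfolding nn_integral_spike_lr_cross[OF Q1 Q2 \<delta>] by (simp only: w_def sum_distrib_left)
  also have "\<dots> \<le> (\<integral>\<^sup>+g. (\<Sum>l<r. ennreal (exp (T / 2 * (\<Sum>k<r. w k l * g k)\<^sup>2))) / r \<partial>gauss r)"
  proof (rule nn_integral_mono)
    fix g :: "nat \<Rightarrow> real"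
    have "exp (\<Sum>l<r. (\<delta> / (1 - \<delta>))\<^sup>2 / 2 * (\<Sum>k<r. w k l * g k)\<^sup>2)
      \<le> (\<Sum>l<r. exp (T / 2 * (\<Sum>k<r. w k l * g k)\<^sup>2)) / r"
      using exp_mean_le[OF r, of "\<lambda>l. (\<delta> / (1 - \<delta>))\<^sup>2 / 2 * (\<Sum>k<r. w k l * g k)\<^sup>2"] by (simp add: T mult.assoc)
    then show "ennreal (exp (\<Sum>l<r. (\<delta> / (1 - \<delta>))\<^sup>2 / 2 * (\<Sum>k<r. w k l * g k)\<^sup>2))
      \<le> (\<Sum>l<r. ennreal (exp (T / 2 * (\<Sum>k<r. w k l * g k)\<^sup>2))) / r"
      using r by (simp add: sum_ennreal ennreal_of_nat_eq_real_of_nat divide_ennreal sum_nonneg ennreal_leI)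
  qed
  also have "\<dots> = (\<Sum>l<r. \<integral>\<^sup>+g. ennreal (exp (T / 2 * (\<Sum>k<r. w k l * g k)\<^sup>2)) \<partial>gauss r) / r"
    by (subst nn_integral_divide, measurable) (subst nn_integral_sum, auto)
  also have "(\<Sum>l<r. \<integral>\<^sup>+g. ennreal (exp (T / 2 * (\<Sum>k<r. w k l * g k)\<^sup>2)) \<partial>gauss r) = (\<Sum>l<r. ennreal (1 / sqrt (1 - T * W l)))"
    by (intro sum.cong refl, subst nn_integral_gauss_exp_square) (use TW T0 in \<open>auto simp: W_def\<close>)
  also have "\<dots> / r = ennreal ((\<Sum>l<r. 1 / sqrt (1 - T * W l)) / r)"
  proof -
    have "(\<Sum>l<r. ennreal (1 / sqrt (1 - T * W l))) = ennreal (\<Sum>l<r. 1 / sqrt (1 - T * W l))"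
      using TW(2) by (intro sum_ennreal) (auto simp: less_imp_le)
    moreover have "0 \<le> (\<Sum>l<r. 1 / sqrt (1 - T * W l))"
      using TW(2) by (intro sum_nonneg) (auto simp: less_imp_le)
    ultimately show ?thesis
      using r by (simp add: ennreal_of_nat_eq_real_of_nat divide_ennreal)
  qed
  finally have "(\<integral>\<^sup>+x. ennreal (spike_lr p r \<delta> Q1 x) * ennreal (spike_lr p r \<delta> Q2 x) \<partial>gauss p) ^ n
    \<le> ennreal ((\<Sum>l<r. 1 / sqrt (1 - T * W l)) / r) ^ n"
    by (rule power_mono) simp
  also have "\<dots> = ennreal (((\<Sum>l<r. 1 / sqrt (1 - T * W l)) / r) ^ n)"
    using TW(2) by (intro ennreal_power) (auto intro!: divide_nonneg_nonneg sum_nonneg simp: less_imp_le)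
  also have "\<dots> \<le> ennreal (((\<Sum>l<r. exp (T * W l / (2 * (1 - T)))) / r) ^ n)"
    using TW T0 W T(2)
    by (intro ennreal_leI power_mono divide_right_mono sum_mono inverse_sqrt_le_exp divide_nonneg_nonneg sum_nonneg)
       (auto simp: less_imp_le)
  also have "\<dots> \<le> ennreal ((\<Sum>l<r. exp (T * W l / (2 * (1 - T))) ^ n) / r)"
    by (intro ennreal_leI mean_power_le r) simp
  finally show ?thesis
    by (simp add: exp_of_nat_mult[symmetric] W_def w_def mult.assoc)
qed

text \<open>With \<open>Q2\<close> fixed, its columns are unit vectors, so the projection bound for
  the uniform law applies to each \<open>l\<close> with the same constant. \<open>\<nu>\<close> is
  normalised by \<open>p\<close> because \<open>p\<close> times the squared projection is what
  compares with a chi-square variable.\<close>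

lemma nn_integral_uniform_spike_lr_cross_le:
  fixes T \<nu> :: real
  assumes U: "uniform_on_stiefel p r U" and Q2: "Q2 \<in> stiefel p r" and \<delta>: "0 \<le> \<delta>" "\<delta> < 1" and r: "r > 0" and p: "p > 0"
    and T: "T = r * (\<delta> / (1 - \<delta>))\<^sup>2" "T < 1"
    and \<nu>: "\<nu> = n * T / (2 * (1 - T)) / p" "2 * \<nu> < 1"
  shows "(\<integral>\<^sup>+Q1. (\<integral>\<^sup>+x. ennreal (spike_lr p r \<delta> Q1 x) * ennreal (spike_lr p r \<delta> Q2 x) \<partial>gauss p) ^ n \<partial>U)
    \<le> ennreal (1 / sqrt (1 - 2 * \<nu>) ^ r)"
proof -
  have sU[measurable_cong]: "sets U = sets (stiefel_borel p r)" and "prob_space U"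
    using U by (auto simp: uniform_on_stiefel_def)
  have sp: "space U = stiefel p r"
    using sets_eq_imp_space_eq[OF sU] by simp
  have \<nu>0: "0 \<le> \<nu>" using T by (simp add: \<nu>)
  have \<nu>p: "n * T / (2 * (1 - T)) = \<nu> * p" using p by (simp add: \<nu>)
  have "(\<integral>\<^sup>+Q1. (\<integral>\<^sup>+x. ennreal (spike_lr p r \<delta> Q1 x) * ennreal (spike_lr p r \<delta> Q2 x) \<partial>gauss p) ^ n \<partial>U)
    \<le> (\<integral>\<^sup>+Q1. (\<Sum>l<r. ennreal (exp (\<nu> * p * (\<Sum>k<r. (\<Sum>i<p. Q1 $$ (i, k) * Q2 $$ (i, l))\<^sup>2)))) / r \<partial>U)"
  proof (rule nn_integral_mono)
    fix Q1 assume "Q1 \<in> space U"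
    then have Q1: "Q1 \<in> stiefel p r" using sp by simp
    show "(\<integral>\<^sup>+x. ennreal (spike_lr p r \<delta> Q1 x) * ennreal (spike_lr p r \<delta> Q2 x) \<partial>gauss p) ^ n
      \<le> (\<Sum>l<r. ennreal (exp (\<nu> * p * (\<Sum>k<r. (\<Sum>i<p. Q1 $$ (i, k) * Q2 $$ (i, l))\<^sup>2)))) / r"
      using spike_lr_cross_power_le[OF Q1 Q2 \<delta> r T, of n] r
      by (simp only: \<nu>p) (simp add: sum_ennreal ennreal_of_nat_eq_real_of_nat divide_ennreal sum_nonneg)
  qed
  also have "\<dots> = (\<Sum>l<r. \<integral>\<^sup>+Q1. ennreal (exp (\<nu> * p * (\<Sum>k<r. (\<Sum>i<p. Q1 $$ (i, k) * Q2 $$ (i, l))\<^sup>2))) \<partial>U) / r"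
    by (subst nn_integral_divide, measurable) (subst nn_integral_sum, auto)
  also have "\<dots> \<le> (\<Sum>l<r. ennreal (1 / sqrt (1 - 2 * \<nu>) ^ r)) / r"
  proof (intro divide_right_mono_ennreal sum_mono nn_integral_uniform_proj_le[OF U] \<nu>0 \<nu>(2))
    fix l assume "l \<in> {..<r}"
    then show "(\<Sum>i<p. (Q2 $$ (i, l))\<^sup>2) = 1"
      using stiefel_orthonormal[OF Q2, of l l] by (simp add: power2_eq_square)
  qed
  also have "\<dots> = ennreal (1 / sqrt (1 - 2 * \<nu>) ^ r)"
    using r by (simp add: ennreal_of_nat_eq_real_of_nat divide_ennreal ennreal_mult'[symmetric] \<nu>(2) less_imp_le)
  finally show ?thesis .
qed

subsection \<open>Densities of the two laws\<close>

text \<open>Sylvester's identity: \<open>X\<close> has two factorisations into block triangular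
  matrices, and in each of them one factor has determinant 1. It turns a determinant of size
  \<open>p\<close> into one of size \<open>r\<close>.\<close>

lemma det_one_plus_mult_comm:
  fixes A B :: "'a :: idom Matrix.mat"
  assumes A: "A \<in> carrier_mat p r" and B: "B \<in> carrier_mat r p"
  shows "Determinant.det (1\<^sub>m p + A * B) = Determinant.det (1\<^sub>m r + B * A)"
proof -
  define X where "X = four_block_mat (1\<^sub>m r) (- B) A (1\<^sub>m p)"
  have 1: "X = four_block_mat (1\<^sub>m r) (0\<^sub>m r p) A (1\<^sub>m p) * four_block_mat (1\<^sub>m r) (- B) (0\<^sub>m p r) (1\<^sub>m p + A * B)"
  proof -
    have "A * - B + (1\<^sub>m p + A * B) = 1\<^sub>m p"
      using A B by (intro eq_matI) auto
    then show ?thesis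
      unfolding X_def using A B by (subst mult_four_block_mat[of _ r r _ p _ p _ _ r _ p]) auto
  qed
  have 2: "X = four_block_mat (1\<^sub>m r + B * A) (- B) (0\<^sub>m p r) (1\<^sub>m p) * four_block_mat (1\<^sub>m r) (0\<^sub>m r p) A (1\<^sub>m p)"
  proof -
    have "1\<^sub>m r + B * A + - B * A = 1\<^sub>m r"
      using A B by (intro eq_matI) auto
    then show ?thesis
      unfolding X_def using A B by (subst mult_four_block_mat[of _ r r _ p _ p _ _ r _ p]) auto
  qed
  have "Determinant.det X = Determinant.det (1\<^sub>m p + A * B)"
    unfolding 1 using A B
    by (subst det_mult[of _ "r + p"])
       (auto simp: det_four_block_mat_upper_right_zero[of _ r _ p] det_four_block_mat_lower_left_zero[of _ r _ p])
  moreover have "Determinant.det X = Determinant.det (1\<^sub>m r + B * A)"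
    unfolding 2 using A B
    by (subst det_mult[of _ "r + p"])
       (auto simp: det_four_block_mat_upper_right_zero[of _ r _ p] det_four_block_mat_lower_left_zero[of _ r _ p])
  ultimately show ?thesis by simp
qed

lemma det_spiked_cov:
  assumes Q: "Q \<in> stiefel p r" and \<delta>: "\<delta> < 1"
  shows "Determinant.det (spiked_cov p \<delta> Q) = (1 / (1 - \<delta>)) ^ r"
proof -
  define \<eta> where "\<eta> = \<delta> / (1 - \<delta>)"
  have Q1: "Q \<in> carrier_mat p r" "transpose_mat Q * Q = 1\<^sub>m r" using Q by (auto simp: stiefel_def)
  have "spiked_cov p \<delta> Q = 1\<^sub>m p + (\<eta> \<cdot>\<^sub>m Q) * transpose_mat Q"
    using Q1(1) by (simp add: spiked_cov_def \<eta>_def mult_smult_assoc_mat[of Q p r _ p])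
  then have "Determinant.det (spiked_cov p \<delta> Q) = Determinant.det (1\<^sub>m r + transpose_mat Q * (\<eta> \<cdot>\<^sub>m Q))"
    using Q1(1) by (simp add: det_one_plus_mult_comm[of _ p r])
  also have "transpose_mat Q * (\<eta> \<cdot>\<^sub>m Q) = \<eta> \<cdot>\<^sub>m 1\<^sub>m r"
    using Q1 by (simp add: mult_smult_distrib[of _ r p])
  also have "1\<^sub>m r + \<eta> \<cdot>\<^sub>m 1\<^sub>m r = (1 + \<eta>) \<cdot>\<^sub>m (1\<^sub>m r :: real mat)"
    by (intro eq_matI) auto
  also have "Determinant.det \<dots> = (1 + \<eta>) ^ r" by simp
  finally show ?thesis using \<delta> by (simp add: \<eta>_def field_simps)
qed

text \<open>\<open>P = Q Q'\<close> is idempotent, so the matrices \<open>1 + x P\<close> multiply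
  by the rule \<open>x + y + x * y\<close>, for which \<open>\<eta>\<close> and
  \<open>- \<delta>\<close> are inverse to each other.\<close>

lemma mat_inverse_spiked_cov:
  assumes Q: "Q \<in> stiefel p r" and \<delta>: "\<delta> < 1"
  shows "mat_inverse (spiked_cov p \<delta> Q) = Some (1\<^sub>m p + (- \<delta>) \<cdot>\<^sub>m (Q * transpose_mat Q))"
proof -
  define \<eta> where "\<eta> = \<delta> / (1 - \<delta>)"
  have Q1: "Q \<in> carrier_mat p r" "transpose_mat Q * Q = 1\<^sub>m r" using Q by (auto simp: stiefel_def)
  define P where "P = Q * transpose_mat Q"
  have P: "P \<in> carrier_mat p p" using Q1 by (simp add: P_def)
  have PP: "P * P = P"
  proof -
    have "P * P = Q * (transpose_mat Q * (Q * transpose_mat Q))"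
      unfolding P_def using Q1(1) by (intro assoc_mult_mat[of _ p r _ p _ p]) auto
    also have "transpose_mat Q * (Q * transpose_mat Q) = (transpose_mat Q * Q) * transpose_mat Q"
      using Q1(1) by (intro assoc_mult_mat[of _ r p _ r _ p, symmetric]) auto
    finally show ?thesis using Q1 by (simp add: P_def)
  qed
  have prod: "(1\<^sub>m p + x \<cdot>\<^sub>m P) * (1\<^sub>m p + y \<cdot>\<^sub>m P) = 1\<^sub>m p + (x + y + x * y) \<cdot>\<^sub>m P" for x y :: real
  proof -
    have "(1\<^sub>m p + x \<cdot>\<^sub>m P) * (1\<^sub>m p + y \<cdot>\<^sub>m P) = (1\<^sub>m p + x \<cdot>\<^sub>m P) * 1\<^sub>m p + (1\<^sub>m p + x \<cdot>\<^sub>m P) * (y \<cdot>\<^sub>m P)"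
      using P by (intro mult_add_distrib_mat[of _ p p _ p]) auto
    also have "(1\<^sub>m p + x \<cdot>\<^sub>m P) * (y \<cdot>\<^sub>m P) = 1\<^sub>m p * (y \<cdot>\<^sub>m P) + (x \<cdot>\<^sub>m P) * (y \<cdot>\<^sub>m P)"
      using P by (intro add_mult_distrib_mat[of _ p p _ _ p]) auto
    also have "(x \<cdot>\<^sub>m P) * (y \<cdot>\<^sub>m P) = (x * y) \<cdot>\<^sub>m P"
      using P PP by (simp add: mult_smult_distrib[of _ p p] mult_smult_assoc_mat[of _ p p _ p]) (auto intro!: eq_matI)
    finally show ?thesis using P by (auto intro!: eq_matI simp: algebra_simps)
  qed
  have \<eta>: "\<eta> + - \<delta> + \<eta> * - \<delta> = 0" "- \<delta> + \<eta> + - \<delta> * \<eta> = 0"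
    using \<delta> by (auto simp: \<eta>_def field_simps)
  have S: "spiked_cov p \<delta> Q = 1\<^sub>m p + \<eta> \<cdot>\<^sub>m P" by (simp add: spiked_cov_def \<eta>_def P_def)
  have Sc: "spiked_cov p \<delta> Q \<in> carrier_mat p p" using P by (simp add: S)
  define B where "B = 1\<^sub>m p + (- \<delta>) \<cdot>\<^sub>m P"
  have B: "B \<in> carrier_mat p p" using P by (simp add: B_def)
  have zero: "1\<^sub>m p + 0 \<cdot>\<^sub>m P = 1\<^sub>m p" using P by (intro eq_matI) auto
  have SB: "spiked_cov p \<delta> Q * B = 1\<^sub>m p" "B * spiked_cov p \<delta> Q = 1\<^sub>m p"
    unfolding S B_def prod \<eta> zero by auto
  \<comment> \<open>\<open>mat_inverse\<close> returns an option. Invertibility shows that it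
    succeeds, and uniqueness of inverses then fixes its value.\<close>
  have "mat_inverse (spiked_cov p \<delta> Q) \<noteq> None"
  proof
    assume "mat_inverse (spiked_cov p \<delta> Q) = None"
    then have "spiked_cov p \<delta> Q \<notin> Units (ring_mat TYPE(real) p ())"
      by (rule mat_inverse(1)[OF Sc])
    moreover have "spiked_cov p \<delta> Q \<in> Units (ring_mat TYPE(real) p ())"
      using SB Sc B by (auto simp: Units_def ring_mat_def)
    ultimately show False by blast
  qed
  then obtain B' where B': "mat_inverse (spiked_cov p \<delta> Q) = Some B'" by auto
  have "spiked_cov p \<delta> Q * B' = 1\<^sub>m p" "B' \<in> carrier_mat p p"
    using mat_inverse(2)[OF Sc B'] by auto
  then have "B' = (B * spiked_cov p \<delta> Q) * B'" using SB by simp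
  also have "\<dots> = B * (spiked_cov p \<delta> Q * B')"
    using B Sc \<open>B' \<in> carrier_mat p p\<close> by (intro assoc_mult_mat) auto
  also have "\<dots> = B" using B \<open>spiked_cov p \<delta> Q * B' = 1\<^sub>m p\<close> by simp
  finally show ?thesis using B' by (simp add: B_def P_def)
qed

lemma scalar_prod_spiked_precision:
  assumes Q: "Q \<in> stiefel p r"
  shows "scalar_prod (Matrix.vec p x) ((1\<^sub>m p + (- \<delta>) \<cdot>\<^sub>m (Q * transpose_mat Q)) *\<^sub>v Matrix.vec p x)
    = (\<Sum>i<p. (x i)\<^sup>2) - \<delta> * (\<Sum>l<r. (\<Sum>i<p. Q $$ (i, l) * x i)\<^sup>2)"
proof -
  have Q1: "Q \<in> carrier_mat p r" using Q by (auto simp: stiefel_def)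
  have "scalar_prod (Matrix.vec p x) ((1\<^sub>m p + (- \<delta>) \<cdot>\<^sub>m (Q * transpose_mat Q)) *\<^sub>v Matrix.vec p x)
    = (\<Sum>i<p. x i * (\<Sum>j<p. ((if i = j then 1 else 0) - \<delta> * (\<Sum>l<r. Q $$ (i, l) * Q $$ (j, l))) * x j))"
    using Q1 by (auto simp: scalar_prod_def lessThan_atLeast0 intro!: sum.cong)
  also have "\<dots> = (\<Sum>i<p. (x i)\<^sup>2 - \<delta> * (\<Sum>j<p. \<Sum>l<r. x i * Q $$ (i, l) * (Q $$ (j, l) * x j)))"
  proof (rule sum.cong[OF refl])
    fix i assume i: "i \<in> {..<p}"
    have "(\<Sum>j<p. ((if i = j then 1 else 0) - \<delta> * (\<Sum>l<r. Q $$ (i, l) * Q $$ (j, l))) * x j)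
      = (\<Sum>j<p. (if i = j then x j else 0) - \<delta> * (\<Sum>l<r. Q $$ (i, l) * Q $$ (j, l) * x j))"
      by (rule sum.cong) (auto simp: left_diff_distrib sum_distrib_right)
    also have "\<dots> = x i - \<delta> * (\<Sum>j<p. \<Sum>l<r. Q $$ (i, l) * Q $$ (j, l) * x j)"
      using i by (simp add: sum_subtractf sum_distrib_left)
    finally show "x i * (\<Sum>j<p. ((if i = j then 1 else 0) - \<delta> * (\<Sum>l<r. Q $$ (i, l) * Q $$ (j, l))) * x j)
      = (x i)\<^sup>2 - \<delta> * (\<Sum>j<p. \<Sum>l<r. x i * Q $$ (i, l) * (Q $$ (j, l) * x j))"
      by (simp add: right_diff_distrib power2_eq_square sum_distrib_left ac_simps)
  qed
  also have "\<dots> = (\<Sum>i<p. (x i)\<^sup>2) - \<delta> * (\<Sum>i<p. \<Sum>j<p. \<Sum>l<r. x i * Q $$ (i, l) * (Q $$ (j, l) * x j))"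
    by (simp add: sum_subtractf sum_distrib_left)
  also have "(\<Sum>i<p. \<Sum>j<p. \<Sum>l<r. x i * Q $$ (i, l) * (Q $$ (j, l) * x j)) = (\<Sum>i<p. \<Sum>l<r. \<Sum>j<p. x i * Q $$ (i, l) * (Q $$ (j, l) * x j))"
    by (rule sum.cong[OF refl]) (rule sum.swap)
  also have "\<dots> = (\<Sum>l<r. \<Sum>i<p. \<Sum>j<p. x i * Q $$ (i, l) * (Q $$ (j, l) * x j))"
    by (rule sum.swap)
  also have "\<dots> = (\<Sum>l<r. (\<Sum>i<p. Q $$ (i, l) * x i)\<^sup>2)"
    by (simp add: power2_eq_square sum_product ac_simps)
  finally show ?thesis .
qed

text \<open>The measures are compared on boxes, whose indicators factorise. Sigma-finiteness of the
  family of densities is a separate hypothesis because an \<open>ennreal\<close> density may be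
  infinite on a large set.\<close>

lemma PiM_density:
  assumes I: "finite I" and M: "product_sigma_finite M" and N: "product_sigma_finite (\<lambda>i. density (M i) (f i))"
    and f[measurable]: "\<And>i. i \<in> I \<Longrightarrow> f i \<in> borel_measurable (M i)"
  shows "PiM I (\<lambda>i. density (M i) (f i)) = density (PiM I M) (\<lambda>x. \<Prod>i\<in>I. f i (x i))"
proof -
  interpret M: product_sigma_finite M by fact
  interpret N: product_sigma_finite "\<lambda>i. density (M i) (f i)" by fact
  show ?thesis
  proof (rule N.PiM_eqI[OF I, symmetric])
    show "sets (density (PiM I M) (\<lambda>x. \<Prod>i\<in>I. f i (x i))) = sets (PiM I (\<lambda>i. density (M i) (f i)))"
      by (simp cong: sets_PiM_cong)
    fix A assume "\<And>i. i \<in> I \<Longrightarrow> A i \<in> sets (density (M i) (f i))"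
    then have A[measurable]: "\<And>i. i \<in> I \<Longrightarrow> A i \<in> sets (M i)" by simp
    have "emeasure (density (PiM I M) (\<lambda>x. \<Prod>i\<in>I. f i (x i))) (Pi\<^sub>E I A)
      = (\<integral>\<^sup>+x. (\<Prod>i\<in>I. f i (x i)) * indicator (Pi\<^sub>E I A) x \<partial>PiM I M)"
      using I A by (intro emeasure_density) (auto intro!: sets_PiM_I_finite borel_measurable_prod_ennreal)
    also have "\<dots> = (\<integral>\<^sup>+x. (\<Prod>i\<in>I. f i (x i) * indicator (A i) (x i)) \<partial>PiM I M)"
    proof (rule nn_integral_cong)
      fix x assume "x \<in> space (PiM I M)"
      then have "indicator (Pi\<^sub>E I A) x = (\<Prod>i\<in>I. indicator (A i) (x i) :: ennreal)"
        using I by (auto simp: indicator_def space_PiM PiE_iff prod_zero_iff intro!: prod.neutral[symmetric] prod_zero)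
      then show "(\<Prod>i\<in>I. f i (x i)) * indicator (Pi\<^sub>E I A) x = (\<Prod>i\<in>I. f i (x i) * indicator (A i) (x i))"
        by (simp add: prod.distrib)
    qed
    also have "\<dots> = (\<Prod>i\<in>I. \<integral>\<^sup>+x. f i x * indicator (A i) x \<partial>M i)"
      using I by (intro M.product_nn_integral_prod) auto
    also have "\<dots> = (\<Prod>i\<in>I. emeasure (density (M i) (f i)) (A i))"
      by (intro prod.cong refl) (simp add: emeasure_density)
    finally show "emeasure (density (PiM I M) (\<lambda>x. \<Prod>i\<in>I. f i (x i))) (Pi\<^sub>E I A) = (\<Prod>i\<in>I. emeasure (density (M i) (f i)) (A i))" .
  qed
qed

lemma product_sigma_finite_lborel: "product_sigma_finite (\<lambda>_. lborel)"
  by (intro product_sigma_finite.intro sigma_finite_lborel)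

lemma gauss_eq_density:
  "gauss p = density (lebesgue_vec p) (\<lambda>x. ennreal (exp (- (\<Sum>i<p. (x i)\<^sup>2) / 2) / sqrt (2 * pi) ^ p))"
proof -
  have "gauss p = density (lebesgue_vec p) (\<lambda>x. \<Prod>i<p. ennreal (std_normal_density (x i)))"
    unfolding gauss_def
    by (rule PiM_density) (auto intro: product_sigma_finite_lborel product_sigma_finite_std_normal)
  also have "(\<lambda>x. \<Prod>i<p. ennreal (std_normal_density (x i))) = (\<lambda>x. ennreal (exp (- (\<Sum>i<p. (x i)\<^sup>2) / 2) / sqrt (2 * pi) ^ p))"
  proof
    fix x :: "nat \<Rightarrow> real"
    have "exp (- (\<Sum>i<p. (x i)\<^sup>2) / 2) = (\<Prod>i<p. exp (- (x i)\<^sup>2 / 2))"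
      by (simp add: exp_sum[symmetric] sum_negf sum_divide_distrib)
    then show "(\<Prod>i<p. ennreal (std_normal_density (x i))) = ennreal (exp (- (\<Sum>i<p. (x i)\<^sup>2) / 2) / sqrt (2 * pi) ^ p)"
      by (simp add: prod_ennreal std_normal_density_def prod_dividef)
  qed
  finally show ?thesis .
qed

lemma centered_normal_spiked_cov:
  assumes Q: "Q \<in> stiefel p r" and \<delta>: "\<delta> < 1"
  shows "centered_normal p (spiked_cov p \<delta> Q) = density (gauss p) (\<lambda>x. ennreal (spike_lr p r \<delta> Q x))"
proof -
  have "exp (- (A - \<delta> * B) / 2) / sqrt ((2 * pi) ^ p * (1 / (1 - \<delta>)) ^ r)
    = (exp (- A / 2) / sqrt (2 * pi) ^ p) * (sqrt (1 - \<delta>) ^ r * exp (\<delta> / 2 * B))" for A B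
  proof -
    have "exp (- (A - \<delta> * B) / 2) = exp (- A / 2) * exp (\<delta> / 2 * B)"
      by (simp add: mult_exp_exp field_simps)
    moreover have "sqrt ((2 * pi) ^ p * (1 / (1 - \<delta>)) ^ r) = sqrt (2 * pi) ^ p * (1 / sqrt (1 - \<delta>)) ^ r"
      by (simp only: real_sqrt_mult[of "(2 * pi) ^ p"] real_sqrt_power real_sqrt_divide real_sqrt_one)
    ultimately show ?thesis using \<delta> by (simp add: power_divide)
  qed
  then have *: "ennreal (exp (- ((\<Sum>i<p. (x i)\<^sup>2) - \<delta> * (\<Sum>l<r. (\<Sum>i<p. Q $$ (i, l) * x i)\<^sup>2)) / 2)
                   / sqrt ((2 * pi) ^ p * (1 / (1 - \<delta>)) ^ r))
    = ennreal (exp (- (\<Sum>i<p. (x i)\<^sup>2) / 2) / sqrt (2 * pi) ^ p) * ennreal (spike_lr p r \<delta> Q x)" for x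
    unfolding spike_lr_def by (subst ennreal_mult'[symmetric]) auto
  show ?thesis
    unfolding centered_normal_def mat_inverse_spiked_cov[OF Q \<delta>] option.sel
      scalar_prod_spiked_precision[OF Q] det_spiked_cov[OF Q \<delta>] gauss_eq_density *
    by (rule density_density_eq[symmetric]) (simp_all add: spike_lr_def)
qed

text \<open>The spike of rank 0: the matrix without columns lies on the Stiefel manifold, and its
  spiked covariance is the identity.\<close>

lemma centered_normal_one: "centered_normal p (1\<^sub>m p) = gauss p"
proof -
  have Q: "0\<^sub>m p 0 \<in> stiefel p 0"
    by (auto simp: stiefel_def intro!: eq_matI)
  have "spiked_cov p 0 (0\<^sub>m p 0 :: real mat) = 1\<^sub>m p"
    by (auto simp: spiked_cov_def intro!: eq_matI)
  then have "centered_normal p (1\<^sub>m p) = density (gauss p) (\<lambda>x. ennreal (spike_lr p 0 0 (0\<^sub>m p 0) x))"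
    using centered_normal_spiked_cov[OF Q, of 0] by simp
  then show ?thesis by (simp add: spike_lr_def density_1)
qed

section \<open>Densities of the product laws and of the mixture\<close>

lemma null_law_eq: "null_law n p = (\<Pi>\<^sub>M i\<in>{..<n}. gauss p)"
  by (simp add: null_law_def centered_normal_one)

lemma product_sigma_finite_gauss: "product_sigma_finite (\<lambda>_. gauss p)"
  by (intro product_sigma_finite.intro prob_space_imp_sigma_finite prob_space_gauss)

lemma prob_space_null_law: "prob_space (null_law n p)"
  unfolding null_law_eq by (intro prob_space_PiM prob_space_gauss)

lemma PiM_centered_normal_spiked_cov:
  assumes Q: "Q \<in> stiefel p r" and \<delta>: "0 \<le> \<delta>" "\<delta> < 1"
  shows "(\<Pi>\<^sub>M i\<in>{..<n}. centered_normal p (spiked_cov p \<delta> Q))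
    = density (null_law n p) (\<lambda>X. \<Prod>i<n. ennreal (spike_lr p r \<delta> Q (X i)))"
    and "prob_space (\<Pi>\<^sub>M i\<in>{..<n}. centered_normal p (spiked_cov p \<delta> Q))"
proof -
  have *: "prob_space (density (gauss p) (\<lambda>x. ennreal (spike_lr p r \<delta> Q x)))"
    by (rule prob_spaceI) (simp add: emeasure_density nn_integral_spike_lr[OF Q \<delta>] cong: nn_integral_cong)
  show "(\<Pi>\<^sub>M i\<in>{..<n}. centered_normal p (spiked_cov p \<delta> Q))
    = density (null_law n p) (\<lambda>X. \<Prod>i<n. ennreal (spike_lr p r \<delta> Q (X i)))"
    unfolding centered_normal_spiked_cov[OF Q \<delta>(2)] null_law_eq
    by (rule PiM_density) (auto intro!: product_sigma_finite_gauss product_sigma_finite.intro prob_space_imp_sigma_finite *)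
  show "prob_space (\<Pi>\<^sub>M i\<in>{..<n}. centered_normal p (spiked_cov p \<delta> Q))"
    unfolding centered_normal_spiked_cov[OF Q \<delta>(2)] by (intro prob_space_PiM *)
qed

text \<open>Tonelli's theorem on each measurable set. The subprobability hypothesis makes the family
  a kernel into \<open>subprob_algebra\<close>, which is needed to evaluate
  \<open>bind\<close>.\<close>

lemma bind_density:
  fixes f :: "'a \<Rightarrow> 'b \<Rightarrow> ennreal"
  assumes U: "space U \<noteq> {}" "sigma_finite_measure U" and M: "sigma_finite_measure M"
    and f[measurable]: "(\<lambda>(Q, x). f Q x) \<in> borel_measurable (U \<Otimes>\<^sub>M M)"
    and sub: "\<And>Q. Q \<in> space U \<Longrightarrow> subprob_space (density M (f Q))"
  shows "Giry_Monad.bind U (\<lambda>Q. density M (f Q)) = density M (\<lambda>x. \<integral>\<^sup>+Q. f Q x \<partial>U)"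
proof -
  interpret U: sigma_finite_measure U by fact
  interpret M: sigma_finite_measure M by fact
  interpret pair_sigma_finite U M ..
  have fQ[measurable]: "f Q \<in> borel_measurable M" if "Q \<in> space U" for Q
    using that by measurable
  have [measurable]: "(\<lambda>x. \<integral>\<^sup>+Q. f Q x \<partial>U) \<in> borel_measurable M"
    by measurable
  have em: "emeasure (density M (f Q)) A = (\<integral>\<^sup>+x. f Q x * indicator A x \<partial>M)" if "A \<in> sets M" "Q \<in> space U" for A Q
    using that by (simp add: emeasure_density)
  have K: "(\<lambda>Q. density M (f Q)) \<in> U \<rightarrow>\<^sub>M subprob_algebra M"
  proof (rule measurable_subprob_algebra)
    fix A assume A[measurable]: "A \<in> sets M"
    have "(\<lambda>Q. \<integral>\<^sup>+x. f Q x * indicator A x \<partial>M) \<in> borel_measurable U"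
      by measurable
    then show "(\<lambda>Q. emeasure (density M (f Q)) A) \<in> borel_measurable U"
      by (rule measurable_cong[THEN iffD1, rotated]) (simp add: em A)
  qed (auto intro: sub)
  show ?thesis
  proof (rule measure_eqI)
    show "sets (Giry_Monad.bind U (\<lambda>Q. density M (f Q))) = sets (density M (\<lambda>x. \<integral>\<^sup>+Q. f Q x \<partial>U))"
      using sets_bind[of U "\<lambda>Q. density M (f Q)" M] U by simp
    fix A assume "A \<in> sets (Giry_Monad.bind U (\<lambda>Q. density M (f Q)))"
    then have A[measurable]: "A \<in> sets M" using sets_bind[of U "\<lambda>Q. density M (f Q)" M] U by simp
    have "emeasure (Giry_Monad.bind U (\<lambda>Q. density M (f Q))) A = (\<integral>\<^sup>+Q. \<integral>\<^sup>+x. f Q x * indicator A x \<partial>M \<partial>U)"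
      by (subst emeasure_bind[OF U(1) K A]) (auto simp: em A intro!: nn_integral_cong)
    also have "\<dots> = (\<integral>\<^sup>+x. \<integral>\<^sup>+Q. f Q x * indicator A x \<partial>U \<partial>M)"
      by (rule Fubini'[symmetric]) measurable
    also have "\<dots> = (\<integral>\<^sup>+x. (\<integral>\<^sup>+Q. f Q x \<partial>U) * indicator A x \<partial>M)"
      by (intro nn_integral_cong nn_integral_multc) measurable
    finally show "emeasure (Giry_Monad.bind U (\<lambda>Q. density M (f Q))) A = emeasure (density M (\<lambda>x. \<integral>\<^sup>+Q. f Q x \<partial>U)) A"
      by (simp add: emeasure_density)
  qed
qed

text \<open>Valued in \<open>ennreal\<close> because finiteness is obtained only almost everywhere,
  from the second moment bound.\<close>

definition mixture_lr ::
  "nat \<Rightarrow> nat \<Rightarrow> nat \<Rightarrow> real \<Rightarrow> real Matrix.mat measure \<Rightarrow> (nat \<Rightarrow> nat \<Rightarrow> real) \<Rightarrow> ennreal" where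
  "mixture_lr n p r \<delta> U X = (\<integral>\<^sup>+Q. (\<Prod>i<n. ennreal (spike_lr p r \<delta> Q (X i))) \<partial>U)"

lemma borel_measurable_entry:
  "i \<in> I \<Longrightarrow> j \<in> J \<Longrightarrow> (\<lambda>X. X i j) \<in> borel_measurable (\<Pi>\<^sub>M i\<in>I. \<Pi>\<^sub>M j\<in>J. (borel :: real measure))"
  by (rule measurable_compose[where f = "\<lambda>X. X i" and g = "\<lambda>x. x j"]) (rule measurable_component_singleton, assumption)+

lemma measurable_spike_lr_prod:
  assumes sU: "sets U = sets (stiefel_borel p r)"
  shows "(\<lambda>(Q, X). \<Prod>i<n. ennreal (spike_lr p r \<delta> Q (X i))) \<in> borel_measurable (U \<Otimes>\<^sub>M null_law n p)"
proof -
  have sN: "sets (\<Pi>\<^sub>M i\<in>{..<n}. gauss p) = sets (\<Pi>\<^sub>M i\<in>{..<n}. \<Pi>\<^sub>M j\<in>{..<p}. (borel :: real measure))"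
    by (intro sets_PiM_cong refl sets_gauss)
  have "(\<lambda>QX. ennreal (spike_lr p r \<delta> (fst QX) (snd QX i))) \<in> borel_measurable (U \<Otimes>\<^sub>M (\<Pi>\<^sub>M i\<in>{..<n}. gauss p))" if i: "i \<in> {..<n}" for i
  proof -
    have [measurable]: "(\<lambda>QX. snd QX i j) \<in> borel_measurable (U \<Otimes>\<^sub>M (\<Pi>\<^sub>M i\<in>{..<n}. gauss p))" if "j \<in> {..<p}" for j
    proof -
      have "(\<lambda>X. X i j) \<in> borel_measurable (\<Pi>\<^sub>M i\<in>{..<n}. gauss p)"
        unfolding measurable_cong_sets[OF sN refl] by (rule borel_measurable_entry[OF i that])
      then show ?thesis by (rule measurable_compose[OF measurable_snd])
    qed
    have [measurable]: "(\<lambda>QX. fst QX $$ (j, l)) \<in> borel_measurable (U \<Otimes>\<^sub>M (\<Pi>\<^sub>M i\<in>{..<n}. gauss p))" if "j \<in> {..<p}" "l \<in> {..<r}" for j l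
    proof -
      have "(\<lambda>Q. Q $$ (j, l)) \<in> borel_measurable U"
        unfolding measurable_cong_sets[OF sU refl] by (rule borel_measurable_stiefel_entry[OF that])
      then show ?thesis by (rule measurable_compose[OF measurable_fst])
    qed
    show ?thesis unfolding spike_lr_def by measurable
  qed
  then show ?thesis unfolding null_law_eq case_prod_beta by (rule borel_measurable_prod_ennreal)
qed

lemma alt_law_eq:
  assumes U: "uniform_on_stiefel p r U" and \<delta>: "0 \<le> \<delta>" "\<delta> < 1"
  shows "alt_law n p \<delta> U = density (null_law n p) (mixture_lr n p r \<delta> U)"
proof -
  have sU: "sets U = sets (stiefel_borel p r)" and "prob_space U"
    using U by (auto simp: uniform_on_stiefel_def)
  interpret U: prob_space U by fact
  have sp: "space U = stiefel p r"
    using sets_eq_imp_space_eq[OF sU] by simp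
  have "alt_law n p \<delta> U = Giry_Monad.bind U (\<lambda>Q. density (null_law n p) (\<lambda>X. \<Prod>i<n. ennreal (spike_lr p r \<delta> Q (X i))))"
    unfolding alt_law_def by (intro bind_cong refl PiM_centered_normal_spiked_cov(1) \<delta>) (simp add: sp)
  also have "\<dots> = density (null_law n p) (mixture_lr n p r \<delta> U)"
    unfolding mixture_lr_def
  proof (rule bind_density)
    show "sigma_finite_measure U" "space U \<noteq> {}" by (fact U.sigma_finite_measure_axioms U.not_empty)+
    show "sigma_finite_measure (null_law n p)"
      by (intro prob_space_imp_sigma_finite prob_space_null_law)
    show "(\<lambda>(Q, X). \<Prod>i<n. ennreal (spike_lr p r \<delta> Q (X i))) \<in> borel_measurable (U \<Otimes>\<^sub>M null_law n p)"
      by (rule measurable_spike_lr_prod[OF sU])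
    fix Q assume "Q \<in> space U"
    then have Q: "Q \<in> stiefel p r" by (simp add: sp)
    show "subprob_space (density (null_law n p) (\<lambda>X. \<Prod>i<n. ennreal (spike_lr p r \<delta> Q (X i))))"
      using PiM_centered_normal_spiked_cov[OF Q \<delta>] by (metis prob_space_imp_subprob_space)
  qed
  finally show ?thesis .
qed

lemma borel_measurable_mixture_lr:
  assumes U: "uniform_on_stiefel p r U"
  shows "mixture_lr n p r \<delta> U \<in> borel_measurable (null_law n p)"
proof -
  have sU: "sets U = sets (stiefel_borel p r)" and "prob_space U"
    using U by (auto simp: uniform_on_stiefel_def)
  interpret U: prob_space U by fact
  note [measurable] = measurable_spike_lr_prod[OF sU]
  show ?thesis unfolding mixture_lr_def by measurable
qed

lemma null_law_eq_density:
  "null_law n p = density (lebesgue_data n p) (\<lambda>X. \<Prod>i<n. ennreal (exp (- (\<Sum>j<p. (X i j)\<^sup>2) / 2) / sqrt (2 * pi) ^ p))"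
  unfolding null_law_eq gauss_eq_density
proof (rule PiM_density)
  show "product_sigma_finite (\<lambda>_. lebesgue_vec p)"
    by (intro product_sigma_finite.intro product_sigma_finite.sigma_finite product_sigma_finite_lborel) simp
  show "product_sigma_finite (\<lambda>_. density (lebesgue_vec p) (\<lambda>x. ennreal (exp (- (\<Sum>i<p. (x i)\<^sup>2) / 2) / sqrt (2 * pi) ^ p)))"
    using product_sigma_finite_gauss[of p] by (simp only: gauss_eq_density)
qed auto

lemma sets_alt_law:
  assumes "uniform_on_stiefel p r U" "0 \<le> \<delta>" "\<delta> < 1"
  shows "sets (alt_law n p \<delta> U) = sets (null_law n p)"
  by (simp add: alt_law_eq[OF assms])

text \<open>\<open>RN_deriv\<close> is determined only almost everywhere. Both Lebesgue densities
  carry the factor \<open>f0\<close>, which is strictly positive and cancels in the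
  quotient.\<close>

lemma AE_log_LR:
  assumes U: "uniform_on_stiefel p r U" and \<delta>: "0 \<le> \<delta>" "\<delta> < 1"
  shows "AE X in null_law n p. log_LR n p \<delta> U X = ln (enn2real (mixture_lr n p r \<delta> U X))"
proof -
  let ?L = "lebesgue_data n p"
  define f0 where "f0 X = (\<Prod>i<n. exp (- (\<Sum>j<p. (X i j)\<^sup>2) / 2) / sqrt (2 * pi) ^ p)" for X :: "nat \<Rightarrow> nat \<Rightarrow> real"
  have f0: "f0 X > 0" for X by (auto simp: f0_def intro!: prod_pos)
  have null: "null_law n p = density ?L (\<lambda>X. ennreal (f0 X))"
    unfolding null_law_eq_density by (simp add: f0_def prod_ennreal)
  have f0_meas[measurable]: "f0 \<in> borel_measurable ?L"
  proof -
    have "sets ?L = sets (\<Pi>\<^sub>M i\<in>{..<n}. \<Pi>\<^sub>M j\<in>{..<p}. (borel :: real measure))"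
      by (intro sets_PiM_cong refl) simp
    then have [measurable]: "(\<lambda>X. X i j) \<in> borel_measurable ?L" if "i \<in> {..<n}" "j \<in> {..<p}" for i j
      using borel_measurable_entry[OF that] measurable_cong_sets[OF _ refl] by blast
    show ?thesis unfolding f0_def by measurable
  qed
  have [measurable]: "mixture_lr n p r \<delta> U \<in> borel_measurable ?L"
    using borel_measurable_mixture_lr[OF U, of n \<delta>] unfolding null by simp
  have alt: "alt_law n p \<delta> U = density ?L (\<lambda>X. ennreal (f0 X) * mixture_lr n p r \<delta> U X)"
    unfolding alt_law_eq[OF U \<delta>] null by (rule density_density_eq) auto
  interpret L: sigma_finite_measure ?L
    by (intro product_sigma_finite.sigma_finite product_sigma_finite.intro product_sigma_finite_lborel) simp_all
  have "AE X in ?L. ennreal (f0 X) = RN_deriv ?L (null_law n p) X"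
    by (rule L.RN_deriv_unique) (simp_all add: null)
  moreover have "AE X in ?L. ennreal (f0 X) * mixture_lr n p r \<delta> U X = RN_deriv ?L (alt_law n p \<delta> U) X"
    by (rule L.RN_deriv_unique) (simp_all add: alt)
  ultimately have "AE X in ?L. log_LR n p \<delta> U X = ln (enn2real (mixture_lr n p r \<delta> U X))"
  proof eventually_elim
    case (elim X)
    have "likelihood_ratio ?L (alt_law n p \<delta> U) (null_law n p) X = enn2real (mixture_lr n p r \<delta> U X)"
      unfolding likelihood_ratio_def elim[symmetric] using f0[of X] by (simp add: enn2real_mult)
    then show ?case by (simp add: log_LR_def)
  qed
  then show ?thesis unfolding null by (subst AE_density) auto
qed

lemma borel_measurable_log_LR:
  assumes U: "uniform_on_stiefel p r U"
  shows "log_LR n p \<delta> U \<in> borel_measurable (null_law n p)"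
proof -
  have [measurable_cong]: "sets (null_law n p) = sets (lebesgue_data n p)"
    by (simp add: null_law_eq_density)
  show ?thesis unfolding log_LR_def likelihood_ratio_def by measurable
qed

subsection \<open>Moments under the null law\<close>

lemma nn_integral_null_law_prod:
  assumes "g \<in> borel_measurable (gauss p)"
  shows "(\<integral>\<^sup>+X. (\<Prod>i<n. g (X i)) \<partial>null_law n p) = (\<integral>\<^sup>+x. g x \<partial>gauss p) ^ n"
  unfolding null_law_eq
  by (subst product_sigma_finite.product_nn_integral_prod[OF product_sigma_finite_gauss]) (use assms in auto)

text \<open>The likelihood ratio of \<open>N(0, I / (1 - a))\<close> against \<open>N(0, I)\<close>, the \<open>Z\<close> of the introduction.\<close>

definition scale_lr :: "nat \<Rightarrow> nat \<Rightarrow> real \<Rightarrow> (nat \<Rightarrow> nat \<Rightarrow> real) \<Rightarrow> real" where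
  "scale_lr n p a X = sqrt (1 - a) ^ (n * p) * exp (a / 2 * (\<Sum>i<n. \<Sum>j<p. (X i j)\<^sup>2))"

lemma scale_lr_pos: "a < 1 \<Longrightarrow> 0 < scale_lr n p a X"
  by (simp add: scale_lr_def)

lemma scale_lr_eq_prod:
  "scale_lr n p a X = (\<Prod>i<n. sqrt (1 - a) ^ p * exp (a / 2 * (\<Sum>j<p. (X i j)\<^sup>2)))"
  by (simp add: scale_lr_def prod.distrib exp_sum[symmetric] sum_distrib_left power_mult[symmetric] mult.commute)

lemma ennreal_scale_lr:
  assumes "a < 1"
  shows "ennreal (scale_lr n p a X) = (\<Prod>i<n. ennreal (sqrt (1 - a) ^ p) * ennreal (exp (a / 2 * (\<Sum>j<p. (X i j)\<^sup>2))))"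
  unfolding scale_lr_eq_prod using assms by (simp only: prod_ennreal[symmetric] ennreal_mult'[symmetric] zero_le_power real_sqrt_ge_zero diff_ge_0_iff_ge less_imp_le mult_nonneg_nonneg exp_ge_zero)

lemma borel_measurable_null_law_entry:
  assumes "i \<in> {..<n}" "j \<in> {..<p}"
  shows "(\<lambda>X. X i j) \<in> borel_measurable (null_law n p)"
proof -
  have "sets (null_law n p) = sets (\<Pi>\<^sub>M i\<in>{..<n}. \<Pi>\<^sub>M j\<in>{..<p}. (borel :: real measure))"
    unfolding null_law_eq by (intro sets_PiM_cong refl sets_gauss)
  then show ?thesis
    using borel_measurable_entry[OF assms] measurable_cong_sets[OF _ refl] by blast
qed

lemma borel_measurable_scale_lr [measurable]: "scale_lr n p a \<in> borel_measurable (null_law n p)"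
proof -
  note [measurable] = borel_measurable_null_law_entry
  show ?thesis unfolding scale_lr_def by measurable
qed

text \<open>The exact moment is \<open>((1 - a) / sqrt (1 - 2 * a)) ^ (n * p)\<close>. In terms of
  \<open>t = (a / (1 - a))\<^sup>2\<close> its base is \<open>1 / sqrt (1 - t)\<close>, and
  \<open>t / (1 - t) = a\<^sup>2 / (1 - 2 * a)\<close> gives the exponent.\<close>

lemma nn_integral_scale_lr_square_le:
  assumes "0 \<le> a" "2 * a < 1"
  shows "(\<integral>\<^sup>+X. (ennreal (scale_lr n p a X))\<^sup>2 \<partial>null_law n p) \<le> ennreal (exp (n * p * a\<^sup>2 / (2 * (1 - 2 * a))))"
proof -
  define t where "t = a\<^sup>2 / (1 - a)\<^sup>2"
  have nz: "(1 - a)\<^sup>2 > 0" using assms by simp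
  have t1: "1 - t = (1 - 2 * a) / (1 - a)\<^sup>2"
    using nz unfolding t_def by (subst diff_divide_eq_iff) (auto simp: power2_eq_square algebra_simps)
  have "0 < 1 - t" unfolding t1 using nz assms by (intro divide_pos_pos) auto
  then have t: "0 \<le> t" "t < 1" by (auto simp: t_def)
  have sq: "(1 - a) / sqrt (1 - 2 * a) = 1 / sqrt (1 - t)"
    using assms by (simp add: t1 real_sqrt_divide)
  have "(\<integral>\<^sup>+X. (ennreal (scale_lr n p a X))\<^sup>2 \<partial>null_law n p)
    = (\<integral>\<^sup>+X. (\<Prod>i<n. ennreal ((1 - a) ^ p) * ennreal (exp ((\<Sum>j<p. 0 * X i j) + (2 * a) * (\<Sum>j<p. (X i j)\<^sup>2) / 2))) \<partial>null_law n p)"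
  proof (rule nn_integral_cong)
    fix X :: "nat \<Rightarrow> nat \<Rightarrow> real"
    have e: "(ennreal (sqrt (1 - a) ^ p))\<^sup>2 = ennreal ((1 - a) ^ p)"
      using assms by (simp add: ennreal_power power_mult[symmetric] mult.commute[of p 2]) (simp add: power_mult)
    have e2: "(ennreal (exp (a / 2 * S)))\<^sup>2 = ennreal (exp ((\<Sum>j<p. 0 * X i j) + (2 * a) * S / 2))" for S i
      by (simp add: ennreal_power exp_double[symmetric])
    have a1: "a < 1" using assms by simp
    show "(ennreal (scale_lr n p a X))\<^sup>2 = (\<Prod>i<n. ennreal ((1 - a) ^ p) * ennreal (exp ((\<Sum>j<p. 0 * X i j) + (2 * a) * (\<Sum>j<p. (X i j)\<^sup>2) / 2)))"
      unfolding ennreal_scale_lr[OF a1] prod_power_distrib power_mult_distrib e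
      by (intro prod.cong refl arg_cong2[where f = "(*)"] e2)
  qed
  also have "\<dots> = (\<integral>\<^sup>+x. ennreal ((1 - a) ^ p) * ennreal (exp ((\<Sum>j<p. 0 * x j) + (2 * a) * (\<Sum>j<p. (x j)\<^sup>2) / 2)) \<partial>gauss p) ^ n"
    by (rule nn_integral_null_law_prod) measurable
  also have "\<dots> = (ennreal ((1 - a) ^ p) * ennreal (1 / sqrt (1 - 2 * a) ^ p)) ^ n"
    by (subst nn_integral_cmult, measurable) (subst nn_integral_gauss_exp, use assms in auto)
  also have "\<dots> = ennreal (((1 - a) ^ p / sqrt (1 - 2 * a) ^ p) ^ n)"
    using assms by (simp add: ennreal_mult'[symmetric] ennreal_power)
  also have "((1 - a) ^ p / sqrt (1 - 2 * a) ^ p) ^ n = (1 / sqrt (1 - t)) ^ (n * p)"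
    by (simp only: power_divide[symmetric] sq power_mult[symmetric] mult.commute[of p n])
  also have "\<dots> \<le> exp (t / (2 * (1 - t))) ^ (n * p)"
    using t by (intro power_mono inverse_sqrt_le_exp) auto
  also have "t / (2 * (1 - t)) = a\<^sup>2 / (2 * (1 - 2 * a))"
    unfolding t1 using assms by (simp add: t_def)
  finally show ?thesis by (simp add: exp_of_nat_mult[symmetric] ennreal_leI)
qed

lemma measurable_spike_lr_prod_fst:
  assumes sU: "sets U = sets (stiefel_borel p r)" and X: "X \<in> space (null_law n p)"
  shows "(\<lambda>Q. \<Prod>i<n. ennreal (spike_lr p r \<delta> Q (X i))) \<in> borel_measurable U"
  using measurable_compose[OF measurable_Pair2'[OF X] measurable_spike_lr_prod[OF sU]] by simp

text \<open>\<open>scale_lr\<close> depends on the lengths of the observations only, so for fixed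
  \<open>Q\<close> the mixed moment is \<open>(1 / sqrt (1 - s)) ^ (n * r)\<close> whatever
  \<open>Q\<close> is, and averaging over \<open>U\<close> changes nothing.\<close>

lemma nn_integral_mixture_lr_scale_lr_ge:
  assumes U: "uniform_on_stiefel p r U" and \<delta>: "0 \<le> \<delta>" "\<delta> < 1" and a: "0 \<le> a" "a < 1"
    and A: "\<delta> / (1 - \<delta>) * a / (1 - a) < 1"
  shows "ennreal (exp (n * r * (\<delta> / (1 - \<delta>) * a / (1 - a)) / 2))
    \<le> (\<integral>\<^sup>+X. mixture_lr n p r \<delta> U X * ennreal (scale_lr n p a X) \<partial>null_law n p)"
proof -
  have sU: "sets U = sets (stiefel_borel p r)" and "prob_space U"
    using U by (auto simp: uniform_on_stiefel_def)
  interpret U: prob_space U by fact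
  interpret N: prob_space "null_law n p" by (rule prob_space_null_law)
  interpret pair_sigma_finite U "null_law n p" ..
  have sp: "space U = stiefel p r"
    using sets_eq_imp_space_eq[OF sU] by simp
  define s where "s = \<delta> / (1 - \<delta>) * a / (1 - a)"
  define F where "F Q X = (\<Prod>i<n. ennreal (spike_lr p r \<delta> Q (X i)))" for Q X
  have [measurable]: "(\<lambda>QX. F (fst QX) (snd QX)) \<in> borel_measurable (U \<Otimes>\<^sub>M null_law n p)"
    using measurable_spike_lr_prod[OF sU] unfolding F_def case_prod_beta .
  have FQ: "(\<lambda>Q. F Q X) \<in> borel_measurable U" if "X \<in> space (null_law n p)" for X
    unfolding F_def by (rule measurable_spike_lr_prod_fst[OF sU that])
  have "(\<integral>\<^sup>+X. mixture_lr n p r \<delta> U X * ennreal (scale_lr n p a X) \<partial>null_law n p)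
    = (\<integral>\<^sup>+X. \<integral>\<^sup>+Q. F Q X * ennreal (scale_lr n p a X) \<partial>U \<partial>null_law n p)"
    unfolding mixture_lr_def F_def[symmetric] by (intro nn_integral_cong nn_integral_multc[symmetric] FQ)
  also have "\<dots> = (\<integral>\<^sup>+Q. \<integral>\<^sup>+X. F Q X * ennreal (scale_lr n p a X) \<partial>null_law n p \<partial>U)"
    by (rule Fubini') measurable
  also have "\<dots> = (\<integral>\<^sup>+Q. ennreal ((1 / sqrt (1 - s)) ^ (n * r)) \<partial>U)"
  proof (rule nn_integral_cong)
    fix Q assume "Q \<in> space U"
    then have Q: "Q \<in> stiefel p r" by (simp add: sp)
    have "(\<integral>\<^sup>+X. F Q X * ennreal (scale_lr n p a X) \<partial>null_law n p)
      = (\<integral>\<^sup>+X. (\<Prod>i<n. ennreal (sqrt (1 - a) ^ p) * (ennreal (spike_lr p r \<delta> Q (X i)) * ennreal (exp ((\<Sum>j<p. 0 * X i j) + a * (\<Sum>j<p. (X i j)\<^sup>2) / 2)))) \<partial>null_law n p)"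
    proof (rule nn_integral_cong)
      fix X :: "nat \<Rightarrow> nat \<Rightarrow> real"
      show "F Q X * ennreal (scale_lr n p a X) = (\<Prod>i<n. ennreal (sqrt (1 - a) ^ p) * (ennreal (spike_lr p r \<delta> Q (X i)) * ennreal (exp ((\<Sum>j<p. 0 * X i j) + a * (\<Sum>j<p. (X i j)\<^sup>2) / 2))))"
        unfolding F_def ennreal_scale_lr[OF a(2)] prod.distrib[symmetric] by (rule prod.cong[OF refl]) (simp add: ac_simps)
    qed
    also have "\<dots> = (\<integral>\<^sup>+x. ennreal (sqrt (1 - a) ^ p) * (ennreal (spike_lr p r \<delta> Q x) * ennreal (exp ((\<Sum>j<p. 0 * x j) + a * (\<Sum>j<p. (x j)\<^sup>2) / 2))) \<partial>gauss p) ^ n"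
      by (rule nn_integral_null_law_prod) measurable
    also have "(\<integral>\<^sup>+x. ennreal (sqrt (1 - a) ^ p) * (ennreal (spike_lr p r \<delta> Q x) * ennreal (exp ((\<Sum>j<p. 0 * x j) + a * (\<Sum>j<p. (x j)\<^sup>2) / 2))) \<partial>gauss p)
      = ennreal (sqrt (1 - a) ^ p) * ennreal (1 / sqrt (1 - a) ^ p * (1 / sqrt (1 - s) ^ r))"
      by (subst nn_integral_cmult, measurable) (subst nn_integral_spike_lr_exp[OF Q \<delta> a(2) A], simp add: s_def)
    also have "\<dots> = ennreal ((1 / sqrt (1 - s)) ^ r)"
      using a by (simp add: ennreal_mult'[symmetric] power_one_over)
    also have "\<dots> ^ n = ennreal ((1 / sqrt (1 - s)) ^ (n * r))"
      using A by (simp add: ennreal_power power_mult[symmetric] mult.commute s_def)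
    finally show "(\<integral>\<^sup>+X. F Q X * ennreal (scale_lr n p a X) \<partial>null_law n p)
      = ennreal ((1 / sqrt (1 - s)) ^ (n * r))" .
  qed
  also have "\<dots> = ennreal ((1 / sqrt (1 - s)) ^ (n * r))"
    by (simp add: U.emeasure_space_1)
  finally have *: "(\<integral>\<^sup>+X. mixture_lr n p r \<delta> U X * ennreal (scale_lr n p a X) \<partial>null_law n p) = ennreal ((1 / sqrt (1 - s)) ^ (n * r))" .
  have "exp (real n * real r * s / 2) = exp (s / 2) ^ (n * r)"
    by (simp add: exp_of_nat_mult[symmetric])
  also have "\<dots> \<le> (1 / sqrt (1 - s)) ^ (n * r)"
    using A by (intro power_mono exp_le_inverse_sqrt) (auto simp: s_def)
  finally show ?thesis unfolding * s_def[symmetric] by (rule ennreal_leI)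
qed

text \<open>The square of an average over \<open>Q\<close> is a double average over independent
  \<open>Q1\<close>, \<open>Q2\<close>. After Tonelli the null integral factorises over the
  observations into the \<open>n\<close>-th power of the cross moment.\<close>

lemma nn_integral_mixture_lr_square_le:
  fixes T \<nu> :: real
  assumes U: "uniform_on_stiefel p r U" and \<delta>: "0 \<le> \<delta>" "\<delta> < 1" and r: "r > 0" and p: "p > 0"
    and T: "T = r * (\<delta> / (1 - \<delta>))\<^sup>2" "T < 1"
    and \<nu>: "\<nu> = n * T / (2 * (1 - T)) / p" "2 * \<nu> < 1"
  shows "(\<integral>\<^sup>+X. (mixture_lr n p r \<delta> U X)\<^sup>2 \<partial>null_law n p) \<le> ennreal (exp (r * \<nu> / (1 - 2 * \<nu>)))"
proof -
  have sU: "sets U = sets (stiefel_borel p r)" and "prob_space U"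
    using U by (auto simp: uniform_on_stiefel_def)
  interpret U: prob_space U by fact
  interpret N: prob_space "null_law n p" by (rule prob_space_null_law)
  interpret pair_sigma_finite U "null_law n p" ..
  have sp: "space U = stiefel p r"
    using sets_eq_imp_space_eq[OF sU] by simp
  define F where "F Q X = (\<Prod>i<n. ennreal (spike_lr p r \<delta> Q (X i)))" for Q X
  have F[measurable]: "(\<lambda>QX. F (fst QX) (snd QX)) \<in> borel_measurable (U \<Otimes>\<^sub>M null_law n p)"
    using measurable_spike_lr_prod[OF sU] unfolding F_def case_prod_beta .
  have FX[measurable]: "F Q \<in> borel_measurable (null_law n p)" for Q
    unfolding F_def null_law_eq by measurable
  have FQ[measurable]: "(\<lambda>Q. F Q X) \<in> borel_measurable U" if "X \<in> space (null_law n p)" for X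
    unfolding F_def by (rule measurable_spike_lr_prod_fst[OF sU that])
  have mix: "mixture_lr n p r \<delta> U X = (\<integral>\<^sup>+Q. F Q X \<partial>U)" for X
    by (simp add: mixture_lr_def F_def)
  have [measurable]: "mixture_lr n p r \<delta> U \<in> borel_measurable (null_law n p)"
    by (rule borel_measurable_mixture_lr[OF U])
  have cross: "(\<integral>\<^sup>+X. F Q1 X * F Q2 X \<partial>null_law n p)
    = (\<integral>\<^sup>+x. ennreal (spike_lr p r \<delta> Q1 x) * ennreal (spike_lr p r \<delta> Q2 x) \<partial>gauss p) ^ n" for Q1 Q2
    unfolding F_def prod.distrib[symmetric] by (rule nn_integral_null_law_prod) measurable
  have "(\<integral>\<^sup>+X. (mixture_lr n p r \<delta> U X)\<^sup>2 \<partial>null_law n p) = (\<integral>\<^sup>+X. \<integral>\<^sup>+Q2. mixture_lr n p r \<delta> U X * F Q2 X \<partial>U \<partial>null_law n p)"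
    unfolding power2_eq_square by (intro nn_integral_cong) (subst nn_integral_cmult, auto simp: mix)
  also have "\<dots> = (\<integral>\<^sup>+Q2. \<integral>\<^sup>+X. mixture_lr n p r \<delta> U X * F Q2 X \<partial>null_law n p \<partial>U)"
    by (rule Fubini') measurable
  also have "\<dots> = (\<integral>\<^sup>+Q2. \<integral>\<^sup>+X. \<integral>\<^sup>+Q1. F Q1 X * F Q2 X \<partial>U \<partial>null_law n p \<partial>U)"
    unfolding mix by (intro nn_integral_cong nn_integral_multc[symmetric]) measurable
  also have "\<dots> = (\<integral>\<^sup>+Q2. \<integral>\<^sup>+Q1. \<integral>\<^sup>+X. F Q1 X * F Q2 X \<partial>null_law n p \<partial>U \<partial>U)"
    by (rule nn_integral_cong, rule Fubini') measurable
  \<comment> \<open>Uniformity of \<open>Q1\<close> gives a bound that is the same for every fixed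
    \<open>Q2\<close>.\<close>
  also have "\<dots> \<le> (\<integral>\<^sup>+Q2. ennreal (1 / sqrt (1 - 2 * \<nu>) ^ r) \<partial>U)"
    unfolding cross
    by (intro nn_integral_mono nn_integral_uniform_spike_lr_cross_le[OF U _ \<delta> r p T \<nu>]) (simp add: sp)
  also have "\<dots> = ennreal ((1 / sqrt (1 - 2 * \<nu>)) ^ r)"
    by (simp add: U.emeasure_space_1 power_one_over)
  also have "\<dots> \<le> ennreal (exp (2 * \<nu> / (2 * (1 - 2 * \<nu>))) ^ r)"
  proof (intro ennreal_leI power_mono inverse_sqrt_le_exp)
    show "0 \<le> 2 * \<nu>" using T by (simp add: \<nu>)
    show "0 \<le> 1 / sqrt (1 - 2 * \<nu>)" using \<nu>(2) by simp
  qed (use \<nu>(2) in simp_all)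
  also have "exp (2 * \<nu> / (2 * (1 - 2 * \<nu>))) ^ r = exp (r * \<nu> / (1 - 2 * \<nu>))"
  proof -
    have "2 * \<nu> / (2 * d) = \<nu> / d" for d by simp
    from this[of "1 - 2 * \<nu>"] show ?thesis by (simp only: exp_of_nat_mult[symmetric] times_divide_eq_right)
  qed
  finally show ?thesis .
qed

text \<open>Chebyshev's inequality for the squared difference, whose mean is at most
  \<open>A + B - 2 * C\<close>. The second moment of \<open>Y\<close> also makes \<open>Y\<close>
  finite almost everywhere, which justifies passing to reals.\<close>

lemma deviation_le_of_second_moments:
  fixes Z :: "'a \<Rightarrow> real" and Y :: "'a \<Rightarrow> ennreal"
  assumes N: "prob_space N" and [measurable]: "Y \<in> borel_measurable N" "Z \<in> borel_measurable N"
    and Z0: "\<And>x. 0 \<le> Z x"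
    and A: "(\<integral>\<^sup>+x. (Y x)\<^sup>2 \<partial>N) \<le> ennreal A" and B: "(\<integral>\<^sup>+x. (ennreal (Z x))\<^sup>2 \<partial>N) \<le> ennreal B"
    and C: "ennreal C \<le> (\<integral>\<^sup>+x. Y x * ennreal (Z x) \<partial>N)" and nonneg: "0 \<le> A" "0 \<le> B" "0 \<le> C" and \<epsilon>: "0 < \<epsilon>"
  shows "measure N {x \<in> space N. \<epsilon> \<le> \<bar>enn2real (Y x) - Z x\<bar>} \<le> (A + B - 2 * C) / \<epsilon>\<^sup>2"
    and "AE x in N. Y x < \<infinity>"
proof -
  interpret N: prob_space N by fact
  have fin: "(\<integral>\<^sup>+x. (Y x)\<^sup>2 \<partial>N) \<noteq> \<infinity>" using A by (auto simp: top_unique)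
  have "AE x in N. (Y x)\<^sup>2 \<noteq> \<infinity>" by (rule nn_integral_noteq_infinite[OF _ fin]) measurable
  then show AE: "AE x in N. Y x < \<infinity>"
    by eventually_elim (auto simp: power2_eq_square ennreal_mult_eq_top_iff less_top)
  define D where "D = (\<integral>\<^sup>+x. ennreal ((enn2real (Y x) - Z x)\<^sup>2) \<partial>N)"
  \<comment> \<open>The mixed moment is added on the left instead of being subtracted on the right,
    since subtraction in \<open>ennreal\<close> truncates.\<close>
  have "D + 2 * ennreal C \<le> D + 2 * (\<integral>\<^sup>+x. Y x * ennreal (Z x) \<partial>N)"
    using C by (intro add_left_mono mult_left_mono) auto
  also have "\<dots> = (\<integral>\<^sup>+x. ennreal ((enn2real (Y x) - Z x)\<^sup>2) + 2 * (Y x * ennreal (Z x)) \<partial>N)"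
    unfolding D_def by (simp add: nn_integral_add nn_integral_cmult)
  also have "\<dots> = (\<integral>\<^sup>+x. (Y x)\<^sup>2 + (ennreal (Z x))\<^sup>2 \<partial>N)"
  proof (rule nn_integral_cong_AE, use AE in eventually_elim)
    case (elim x)
    obtain y where y: "Y x = ennreal y" "0 \<le> y" using elim by (cases "Y x") auto
    have 2: "2 = ennreal 2" by simp
    show ?case unfolding y 2 using Z0[of x] y(2)
      by (simp add: ennreal_power flip: ennreal_mult' ennreal_plus del: ennreal_numeral) (simp add: power2_eq_square algebra_simps)
  qed
  also have "\<dots> \<le> ennreal A + ennreal B"
    by (simp add: nn_integral_add) (intro add_mono A B)
  finally have "D + 2 * ennreal C \<le> ennreal (A + B)" using nonneg by simp
  moreover have "D \<noteq> \<infinity>" using calculation by (auto simp: top_unique)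
  moreover have 2: "2 * ennreal C = ennreal (2 * C)" using nonneg by (simp add: ennreal_mult')
  ultimately obtain d where d: "D = ennreal d" "0 \<le> d" "d + 2 * C \<le> A + B"
    using nonneg by (cases D) (auto simp: ennreal_plus[symmetric] simp del: ennreal_plus)
  have "emeasure N {x \<in> space N. \<epsilon> \<le> \<bar>enn2real (Y x) - Z x\<bar>}
     \<le> ennreal (1 / \<epsilon>\<^sup>2) * D"
  proof -
    have "{x \<in> space N. \<epsilon> \<le> \<bar>enn2real (Y x) - Z x\<bar>} = {x \<in> space N. 1 \<le> ennreal (1 / \<epsilon>\<^sup>2) * ennreal ((enn2real (Y x) - Z x)\<^sup>2)}"
    proof -
      have "\<epsilon> \<le> \<bar>w\<bar> \<longleftrightarrow> 1 \<le> ennreal (1 / \<epsilon>\<^sup>2) * ennreal (w\<^sup>2)" for w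
      proof -
        have "\<epsilon> \<le> \<bar>w\<bar> \<longleftrightarrow> \<epsilon>\<^sup>2 \<le> w\<^sup>2" using \<epsilon> by (metis abs_le_square_iff abs_of_pos)
        also have "\<dots> \<longleftrightarrow> 1 \<le> 1 / \<epsilon>\<^sup>2 * w\<^sup>2" using \<epsilon> by (simp add: field_simps)
        finally show ?thesis by (simp add: ennreal_mult'[symmetric])
      qed
      then show ?thesis by auto
    qed
    also have "emeasure N \<dots> \<le> ennreal (1 / \<epsilon>\<^sup>2) * (\<integral>\<^sup>+x. ennreal ((enn2real (Y x) - Z x)\<^sup>2) * indicator (space N) x \<partial>N)"
      by (rule nn_integral_Markov_inequality) auto
    also have "(\<integral>\<^sup>+x. ennreal ((enn2real (Y x) - Z x)\<^sup>2) * indicator (space N) x \<partial>N) = D"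
      unfolding D_def by (rule nn_integral_cong) simp
    finally show ?thesis .
  qed
  also have "\<dots> = ennreal (d / \<epsilon>\<^sup>2)"
    using d by (simp add: ennreal_mult'[symmetric])
  finally have "measure N {x \<in> space N. \<epsilon> \<le> \<bar>enn2real (Y x) - Z x\<bar>} \<le> d / \<epsilon>\<^sup>2"
    using d by (simp add: N.emeasure_eq_measure)
  also have "\<dots> \<le> (A + B - 2 * C) / \<epsilon>\<^sup>2"
    using d by (intro divide_right_mono) auto
  finally show "measure N {x \<in> space N. \<epsilon> \<le> \<bar>enn2real (Y x) - Z x\<bar>} \<le> (A + B - 2 * C) / \<epsilon>\<^sup>2" .
qed

subsection \<open>Central limit theorem\<close>

text \<open>The fourth moment 3 gives \<open>x\<^sup>2 - 1\<close> the variance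
  \<open>3 - 2 + 1 = 2\<close>, the factor 2 under the root in \<open>chi_stat\<close>.\<close>

lemma std_normal_integrals:
  "integrable std_normal_distribution (\<lambda>x. (x\<^sup>2 - 1)\<^sup>2)"
  "(\<integral>x. x\<^sup>2 - 1 \<partial>std_normal_distribution) = 0"
  "(\<integral>x. (x\<^sup>2 - 1)\<^sup>2 \<partial>std_normal_distribution) = 2"
proof -
  have 0: "has_bochner_integral lborel (\<lambda>x. std_normal_density x) 1"
    using std_normal_moment_even[of 0] by simp
  have 2: "has_bochner_integral lborel (\<lambda>x. std_normal_density x * x\<^sup>2) 1"
    using std_normal_moment_even[of 1] by simp
  have 4: "has_bochner_integral lborel (\<lambda>x. std_normal_density x * x ^ 4) 3"
    using std_normal_moment_even[of 2] by (simp add: fact_numeral)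
  have "has_bochner_integral lborel (\<lambda>x. std_normal_density x * x\<^sup>2 - std_normal_density x) (1 - 1)"
    by (intro has_bochner_integral_diff 0 2)
  moreover have "(\<integral>x. x\<^sup>2 - 1 \<partial>std_normal_distribution) = (\<integral>x. std_normal_density x * x\<^sup>2 - std_normal_density x \<partial>lborel)"
    by (subst integral_density) (auto simp: right_diff_distrib)
  ultimately show "(\<integral>x. x\<^sup>2 - 1 \<partial>std_normal_distribution) = 0"
    by (simp add: has_bochner_integral_integral_eq)
  have "has_bochner_integral lborel (\<lambda>x. std_normal_density x * x ^ 4 - 2 * (std_normal_density x * x\<^sup>2) + std_normal_density x) (3 - 2 * 1 + 1)"
    by (intro has_bochner_integral_diff has_bochner_integral_add has_bochner_integral_mult_right 0 2 4)
  moreover have "(\<lambda>x. std_normal_density x * x ^ 4 - 2 * (std_normal_density x * x\<^sup>2) + std_normal_density x) = (\<lambda>x. std_normal_density x * (x\<^sup>2 - 1)\<^sup>2)"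
    by (auto simp: fun_eq_iff power2_eq_square power4_eq_xxxx algebra_simps)
  ultimately have *: "has_bochner_integral lborel (\<lambda>x. std_normal_density x * (x\<^sup>2 - 1)\<^sup>2) 2"
    by simp
  then show "(\<integral>x. (x\<^sup>2 - 1)\<^sup>2 \<partial>std_normal_distribution) = 2"
    by (subst integral_density) (auto simp: has_bochner_integral_integral_eq)
  show "integrable std_normal_distribution (\<lambda>x. (x\<^sup>2 - 1)\<^sup>2)"
    using * by (subst integrable_density) (auto simp: has_bochner_integral_iff)
qed

definition chi_stat :: "nat \<Rightarrow> nat \<Rightarrow> (nat \<Rightarrow> nat \<Rightarrow> real) \<Rightarrow> real" where
  "chi_stat n p X = (\<Sum>i<n. \<Sum>j<p. (X i j)\<^sup>2 - 1) / sqrt (real (n * p) * 2)"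

lemma borel_measurable_chi_stat [measurable]: "chi_stat n p \<in> borel_measurable (null_law n p)"
proof -
  note [measurable] = borel_measurable_null_law_entry
  show ?thesis unfolding chi_stat_def by measurable
qed

text \<open>The characteristic function of a centred chi-square variable with one degree of freedom.
  It serves to identify two laws, so no closed form is computed.\<close>

definition chi_char :: "real \<Rightarrow> complex" where
  "chi_char t = (CLINT x|std_normal_distribution. iexp (t * (x\<^sup>2 - 1)))"

lemma char_chi_stat:
  "char (distr (null_law n p) borel (chi_stat n p)) t = chi_char (t / sqrt (real (n * p) * 2)) ^ (n * p)"
proof -
  interpret S: product_sigma_finite "\<lambda>_::nat. std_normal_distribution" by (rule product_sigma_finite_std_normal)
  interpret G: product_sigma_finite "\<lambda>_::nat. gauss p" by (rule product_sigma_finite_gauss)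
  interpret N1: prob_space "std_normal_distribution" by (rule prob_space_normal_density) simp
  interpret Gp: prob_space "gauss p" by (rule prob_space_gauss)
  define u where "u = t / sqrt (real (n * p) * 2)"
  define f where "f x = iexp (u * (x\<^sup>2 - 1))" for x :: real
  have [measurable]: "f \<in> borel_measurable borel" unfolding f_def by measurable
  have f_int: "integrable std_normal_distribution f"
    by (rule N1.integrable_const_bound[of _ 1]) (auto simp: f_def)
  have g_int: "integrable (gauss p) (\<lambda>x. \<Prod>j<p. f (x j))"
    by (rule Gp.integrable_const_bound[of _ 1]) (auto simp: f_def prod_norm[symmetric])
  have "char (distr (null_law n p) borel (chi_stat n p)) t = (CLINT X|null_law n p. iexp (t * chi_stat n p X))"
    unfolding char_def by (subst integral_distr) auto
  also have "\<dots> = (CLINT X|null_law n p. (\<Prod>i<n. \<Prod>j<p. f (X i j)))"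
  proof (rule Bochner_Integration.integral_cong[OF refl])
    fix X :: "nat \<Rightarrow> nat \<Rightarrow> real"
    have "t * chi_stat n p X = (\<Sum>i<n. \<Sum>j<p. u * ((X i j)\<^sup>2 - 1))"
      by (simp add: chi_stat_def u_def sum_distrib_left sum_divide_distrib)
    then show "iexp (t * chi_stat n p X) = (\<Prod>i<n. \<Prod>j<p. f (X i j))"
      by (simp only: f_def of_real_sum sum_distrib_left exp_sum finite_lessThan)
  qed
  also have "\<dots> = (\<Prod>i<n. CLINT x|gauss p. (\<Prod>j<p. f (x j)))"
    unfolding null_law_eq by (rule G.product_integral_prod) (auto intro: g_int)
  also have "(CLINT x|gauss p. (\<Prod>j<p. f (x j))) = (\<Prod>j<p. CLINT x|std_normal_distribution. f x)"
    unfolding gauss_def by (rule S.product_integral_prod) (auto intro: f_int)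
  finally show ?thesis
    by (simp add: f_def u_def chi_char_def power_mult[symmetric] mult.commute)
qed

text \<open>The central limit theorem concerns one infinite sequence on one space, whereas the null
  law changes its space with \<open>n\<close>. The characteristic function is recorded in the shape
  found for \<open>chi_stat\<close>, so that the two settings can be matched.\<close>

lemma iid_chi_clt:
  defines "M \<equiv> \<Pi>\<^sub>M k\<in>(UNIV :: nat set). std_normal_distribution"
  shows "weak_conv_m (\<lambda>m. distr M borel (\<lambda>\<omega>. (\<Sum>k<m. (\<omega> k)\<^sup>2 - 1) / sqrt (real m * 2))) std_normal_distribution" (is ?W)
    and "char (distr M borel (\<lambda>\<omega>. (\<Sum>k<m. (\<omega> k)\<^sup>2 - 1) / sqrt (real m * 2))) t = chi_char (t / sqrt (real m * 2)) ^ m" (is ?C)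
    and "prob_space M" and "(\<lambda>\<omega>. (\<Sum>k<m. (\<omega> k)\<^sup>2 - 1) / sqrt (real m * 2)) \<in> borel_measurable M"
proof -
  have N1: "prob_space std_normal_distribution" by (rule prob_space_normal_density) simp
  show "prob_space M" unfolding M_def by (intro prob_space_PiM N1)
  then interpret prob_space M .
  have c[measurable]: "(\<lambda>\<omega>. \<omega> k) \<in> borel_measurable M" for k unfolding M_def by measurable
  show "(\<lambda>\<omega>. (\<Sum>k<m. (\<omega> k)\<^sup>2 - 1) / sqrt (real m * 2)) \<in> borel_measurable M" by measurable
  have d: "distr M borel (\<lambda>\<omega>. \<omega> k) = std_normal_distribution" for k
  proof -
    have "distr M borel (\<lambda>\<omega>. \<omega> k) = distr M std_normal_distribution (\<lambda>\<omega>. \<omega> k)"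
      by (rule distr_cong) auto
    also have "\<dots> = std_normal_distribution"
      unfolding M_def by (rule distr_PiM_component) (auto intro: N1)
    finally show ?thesis .
  qed
  have ind: "indep_vars (\<lambda>_. borel) (\<lambda>k \<omega>. \<omega> k) UNIV"
  proof (subst indep_vars_iff_distr_eq_PiM)
    have "sets M = sets (\<Pi>\<^sub>M i\<in>UNIV. (borel :: real measure))"
      unfolding M_def by (intro sets_PiM_cong) auto
    then have "distr M (\<Pi>\<^sub>M i\<in>UNIV. borel) (\<lambda>x. \<lambda>i\<in>UNIV. x i) = M"
      by (simp add: restrict_UNIV distr_id2)
    then show "distr M (\<Pi>\<^sub>M i\<in>UNIV. borel) (\<lambda>x. \<lambda>i\<in>UNIV. x i) = (\<Pi>\<^sub>M i\<in>UNIV. distr M borel (\<lambda>\<omega>. \<omega> i))"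
      by (simp add: d) (simp add: M_def)
  qed auto
  have integral: "(\<integral>\<omega>. g (\<omega> k) \<partial>M) = (\<integral>x. g x \<partial>std_normal_distribution)" if [measurable]: "g \<in> borel_measurable borel" for g :: "real \<Rightarrow> real" and k
    by (subst d[of k, symmetric], subst integral_distr) auto
  have "weak_conv_m (\<lambda>m. distr M borel (\<lambda>\<omega>. (\<Sum>k<m. (\<omega> k)\<^sup>2 - 1) / sqrt (real m * (sqrt 2)\<^sup>2))) std_normal_distribution"
  proof (rule central_limit_theorem_zero_mean)
    show "indep_vars (\<lambda>i. borel) (\<lambda>k \<omega>. (\<omega> k)\<^sup>2 - 1) UNIV"
      by (rule indep_vars_compose2[OF ind]) auto
    show m0: "expectation (\<lambda>\<omega>. (\<omega> k)\<^sup>2 - 1) = 0" for k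
      using integral[of "\<lambda>x. x\<^sup>2 - 1"] by (simp add: std_normal_integrals)
    show "integrable M (\<lambda>x. ((x k)\<^sup>2 - 1)\<^sup>2)" for k
    proof -
      have "integrable (distr M borel (\<lambda>\<omega>. \<omega> k)) (\<lambda>x. (x\<^sup>2 - 1)\<^sup>2)"
        unfolding d by (rule std_normal_integrals)
      then show ?thesis by (subst (asm) integrable_distr_eq) auto
    qed
    show "variance (\<lambda>\<omega>. (\<omega> k)\<^sup>2 - 1) = (sqrt 2)\<^sup>2" for k
      unfolding m0 using integral[of "\<lambda>x. (x\<^sup>2 - 1)\<^sup>2"] by (simp add: std_normal_integrals)
    show "distr M borel (\<lambda>\<omega>. (\<omega> k)\<^sup>2 - 1) = distr std_normal_distribution borel (\<lambda>x. x\<^sup>2 - 1)" for k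
      by (subst d[of k, symmetric], subst distr_distr) (auto simp: comp_def)
  qed simp
  then show ?W by simp
  show ?C
  proof -
    define s where "s = sqrt (real m * 2)"
    have "char (distr M borel (\<lambda>\<omega>. \<Sum>k<m. ((\<omega> k)\<^sup>2 - 1) / s)) t = (\<Prod>k<m. char (distr M borel (\<lambda>\<omega>. ((\<omega> k)\<^sup>2 - 1) / s)) t)"
      by (intro char_distr_sum indep_vars_subset[OF indep_vars_compose2[OF ind]]) auto
    moreover have "char (distr M borel (\<lambda>\<omega>. ((\<omega> k)\<^sup>2 - 1) / s)) t = chi_char (t / s)" for k
    proof -
      have "distr M borel (\<lambda>\<omega>. ((\<omega> k)\<^sup>2 - 1) / s) = distr std_normal_distribution borel (\<lambda>x. (x\<^sup>2 - 1) / s)"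
        by (subst d[of k, symmetric], subst distr_distr) (auto simp: comp_def)
      then show ?thesis unfolding char_def chi_char_def by (simp add: integral_distr)
    qed
    ultimately show ?thesis by (simp add: s_def sum_divide_distrib)
  qed
qed

text \<open>By Levy uniqueness the law of \<open>chi_stat\<close> is that of the iid statistic with
  \<open>n * p\<close> terms. The limit for the array is thus the central limit theorem along a
  reindexed sequence.\<close>

lemma cdf_chi_stat_tendsto:
  fixes n p :: "nat \<Rightarrow> nat"
  assumes "filterlim (\<lambda>k. n k * p k) at_top sequentially"
  shows "(\<lambda>k. cdf (distr (null_law (n k) (p k)) borel (chi_stat (n k) (p k))) x) \<longlonglongrightarrow> cdf std_normal_distribution x"
proof -
  define M where "M = (\<Pi>\<^sub>M k\<in>(UNIV :: nat set). std_normal_distribution)"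
  define K where "K m = distr M borel (\<lambda>\<omega>. (\<Sum>k<m. (\<omega> k)\<^sup>2 - 1) / sqrt (real m * 2))" for m :: nat
  note W = iid_chi_clt[folded M_def]
  interpret M: prob_space M by (rule W(3))
  have eq: "distr (null_law n p) borel (chi_stat n p) = K (n * p)" for n p
  proof (rule Levy_uniqueness)
    interpret N: prob_space "null_law n p" by (rule prob_space_null_law)
    show "real_distribution (distr (null_law n p) borel (chi_stat n p))"
      by (intro N.real_distribution_distr) measurable
    show "real_distribution (K (n * p))"
      unfolding K_def by (intro M.real_distribution_distr W(4))
    show "char (distr (null_law n p) borel (chi_stat n p)) = char (K (n * p))"
      unfolding K_def by (rule ext) (simp only: char_chi_stat W(2))
  qed
  interpret N1: real_distribution std_normal_distribution by (rule real_dist_normal_dist)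
  have "isCont (cdf std_normal_distribution) x"
    unfolding N1.isCont_cdf by (simp add: measure_def emeasure_density)
  with W(1) have "(\<lambda>m. cdf (K m) x) \<longlonglongrightarrow> cdf std_normal_distribution x"
    by (simp add: weak_conv_m_def weak_conv_def K_def)
  then show ?thesis unfolding eq by (rule filterlim_compose[OF _ assms])
qed

subsection \<open>Limit of the log-likelihood ratio\<close>

text \<open>Monotonicity encloses \<open>F k (xs k)\<close> between the values at the fixed points
  \<open>x - d / 2\<close> and \<open>x + d / 2\<close>. The moving point will be the threshold for
  \<open>chi_stat\<close>, which varies with the sample size.\<close>

lemma mono_tendsto_at_moving_point:
  fixes F :: "nat \<Rightarrow> real \<Rightarrow> real"
  assumes mono: "\<And>k u v. u \<le> v \<Longrightarrow> F k u \<le> F k v" and lim: "\<And>u. (\<lambda>k. F k u) \<longlonglongrightarrow> G u"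
    and cont: "isCont G x" and x: "xs \<longlonglongrightarrow> x"
  shows "(\<lambda>k. F k (xs k)) \<longlonglongrightarrow> G x"
proof (rule LIMSEQ_I)
  fix e :: real assume e: "0 < e"
  then obtain d where d: "d > 0" "\<And>u. \<bar>u - x\<bar> < d \<Longrightarrow> \<bar>G u - G x\<bar> < e / 2"
    using cont unfolding continuous_at_eps_delta dist_real_def by (metis half_gt_zero)
  have up: "\<forall>\<^sub>F k in sequentially. F k (x + d / 2) < G x + e" "\<forall>\<^sub>F k in sequentially. G x - e < F k (x - d / 2)"
  proof -
    have "\<bar>G (x + d / 2) - G x\<bar> < e / 2" "\<bar>G (x - d / 2) - G x\<bar> < e / 2"
      by (rule d(2), use d(1) in simp)+
    then have "G (x + d / 2) < G x + e" "G x - e < G (x - d / 2)" using e by linarith+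
    then show "\<forall>\<^sub>F k in sequentially. F k (x + d / 2) < G x + e" "\<forall>\<^sub>F k in sequentially. G x - e < F k (x - d / 2)"
      by (auto intro: order_tendstoD[OF lim])
  qed
  have "\<forall>\<^sub>F k in sequentially. xs k < x + d / 2" "\<forall>\<^sub>F k in sequentially. x - d / 2 < xs k"
    using d(1) by (auto intro!: order_tendstoD[OF x])
  with up have "\<forall>\<^sub>F k in sequentially. norm (F k (xs k) - G x) < e"
  proof eventually_elim
    case (elim k)
    then show ?case using mono[of "xs k" "x + d / 2" k] mono[of "x - d / 2" "xs k" k] by auto
  qed
  then show "\<exists>no. \<forall>k\<ge>no. norm (F k (xs k) - G x) < e" by (simp add: eventually_sequentially)
qed

text \<open>Slutsky's argument for distribution functions: \<open>D k \<epsilon>\<close> stands for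
  a bound on the probability that the two variables differ by at least
  \<open>\<epsilon>\<close>.\<close>

lemma tendsto_of_perturbation:
  fixes F G D :: "nat \<Rightarrow> real \<Rightarrow> real" and H :: "real \<Rightarrow> real"
  assumes y: "0 < y" and G: "\<And>z. 0 < z \<Longrightarrow> (\<lambda>k. G k z) \<longlonglongrightarrow> H z" and H: "isCont H y"
    and D: "\<And>\<epsilon>. 0 < \<epsilon> \<Longrightarrow> (\<lambda>k. D k \<epsilon>) \<longlonglongrightarrow> 0"
    and up: "\<And>\<epsilon>. 0 < \<epsilon> \<Longrightarrow> \<forall>\<^sub>F k in sequentially. F k y \<le> G k (y + \<epsilon>) + D k \<epsilon>"
    and lo: "\<And>\<epsilon>. 0 < \<epsilon> \<Longrightarrow> \<forall>\<^sub>F k in sequentially. G k (y - \<epsilon>) \<le> F k y + D k \<epsilon>"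
  shows "(\<lambda>k. F k y) \<longlonglongrightarrow> H y"
proof (rule LIMSEQ_I)
  fix e :: real assume e: "0 < e"
  then obtain d where d: "d > 0" "\<And>u. \<bar>u - y\<bar> < d \<Longrightarrow> \<bar>H u - H y\<bar> < e / 2"
    using H unfolding continuous_at_eps_delta dist_real_def by (metis half_gt_zero)
  \<comment> \<open>The bound \<open>y / 2\<close> keeps \<open>y - \<epsilon>\<close> positive,
    where the limit of \<open>G\<close> is known.\<close>
  define \<epsilon> where "\<epsilon> = min (d / 2) (y / 2)"
  have \<epsilon>: "0 < \<epsilon>" "\<epsilon> < d" "\<epsilon> < y" using d(1) y by (auto simp: \<epsilon>_def)
  have "(\<lambda>k. G k (y + \<epsilon>) + D k \<epsilon>) \<longlonglongrightarrow> H (y + \<epsilon>) + 0" "(\<lambda>k. G k (y - \<epsilon>) - D k \<epsilon>) \<longlonglongrightarrow> H (y - \<epsilon>) - 0"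
    using \<epsilon> y by (intro tendsto_add tendsto_diff G D; simp)+
  moreover have "H (y + \<epsilon>) + 0 < H y + e" "H y - e < H (y - \<epsilon>) - 0"
  proof -
    have "\<bar>H (y + \<epsilon>) - H y\<bar> < e / 2" "\<bar>H (y - \<epsilon>) - H y\<bar> < e / 2"
      by (rule d(2), use \<epsilon> in simp)+
    then show "H (y + \<epsilon>) + 0 < H y + e" "H y - e < H (y - \<epsilon>) - 0" using e by linarith+
  qed
  ultimately have "\<forall>\<^sub>F k in sequentially. G k (y + \<epsilon>) + D k \<epsilon> < H y + e" "\<forall>\<^sub>F k in sequentially. H y - e < G k (y - \<epsilon>) - D k \<epsilon>"
    by (auto intro: order_tendstoD)
  then have "\<forall>\<^sub>F k in sequentially. norm (F k y - H y) < e"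
    using up[OF \<epsilon>(1)] lo[OF \<epsilon>(1)] by eventually_elim auto
  then show "\<exists>no. \<forall>k\<ge>no. norm (F k y - H y) < e" by (simp add: eventually_sequentially)
qed

section \<open>Distribution functions of the log-likelihood ratio\<close>

lemma isCont_cdf_std_normal: "isCont (cdf std_normal_distribution) x"
proof -
  interpret real_distribution std_normal_distribution by (rule real_dist_normal_dist)
  show ?thesis unfolding isCont_cdf by (simp add: measure_def emeasure_density)
qed

lemma cdf_normal:
  assumes \<sigma>: "0 < \<sigma>"
  shows "cdf (density lborel (\<lambda>x. ennreal (normal_density m \<sigma> x))) x = cdf std_normal_distribution ((x - m) / \<sigma>)"
proof -
  let ?D = "density lborel (\<lambda>x. ennreal (normal_density m \<sigma> x))"
  interpret D: prob_space ?D by (rule prob_space_normal_density[OF \<sigma>])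
  have "distributed ?D lborel (\<lambda>x. x) (normal_density m \<sigma>)"
    by (auto simp: distributed_def distr_id2)
  then have "distributed ?D lborel (\<lambda>x. (x - m) / \<sigma>) std_normal_density"
    using D.normal_standard_normal_convert[OF \<sigma>, of "\<lambda>x. x" m] by simp
  then have "distr ?D lborel (\<lambda>x. (x - m) / \<sigma>) = std_normal_distribution"
    by (simp add: distributed_def)
  then have "cdf std_normal_distribution ((x - m) / \<sigma>) = measure (distr ?D lborel (\<lambda>x. (x - m) / \<sigma>)) {..(x - m) / \<sigma>}"
    by (simp add: cdf_def)
  also have "\<dots> = measure ?D ((\<lambda>x. (x - m) / \<sigma>) -` {..(x - m) / \<sigma>} \<inter> space ?D)"
    by (rule measure_distr) auto
  also have "(\<lambda>x. (x - m) / \<sigma>) -` {..(x - m) / \<sigma>} \<inter> space ?D = {..x}"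
    using \<sigma> by (auto simp: divide_le_cancel)
  finally show ?thesis by (simp add: cdf_def)
qed

lemma mixture_lr_pos:
  assumes U: "uniform_on_stiefel p r U" and \<delta>: "\<delta> < 1" and X: "X \<in> space (null_law n p)"
  shows "0 < mixture_lr n p r \<delta> U X"
proof -
  have sU: "sets U = sets (stiefel_borel p r)" and "prob_space U"
    using U by (auto simp: uniform_on_stiefel_def)
  interpret U: prob_space U by fact
  have pos: "0 < (\<Prod>i<n. ennreal (spike_lr p r \<delta> Q (X i)))" for Q
    using \<delta> by (simp add: prod_ennreal spike_lr_def prod_pos)
  have "mixture_lr n p r \<delta> U X \<noteq> 0"
  proof
    assume "mixture_lr n p r \<delta> U X = 0"
    then have "AE Q in U. (\<Prod>i<n. ennreal (spike_lr p r \<delta> Q (X i))) = 0"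
      unfolding mixture_lr_def by (subst (asm) nn_integral_0_iff_AE) (auto intro: measurable_spike_lr_prod_fst[OF sU X])
    then have "AE Q in U. False" by eventually_elim (use pos in \<open>metis less_irrefl\<close>)
    then show False by simp
  qed
  then show ?thesis by (simp add: zero_less_iff_neq_zero)
qed

text \<open>\<open>enn2real\<close> sends infinity to 0, and \<open>ln\<close> has no meaningful
  value at 0. Positivity and almost sure finiteness exclude both, so \<open>exp\<close> undoes
  \<open>ln\<close>.\<close>

lemma AE_exp_log_LR:
  assumes U: "uniform_on_stiefel p r U" and \<delta>: "0 \<le> \<delta>" "\<delta> < 1"
    and fin: "AE X in null_law n p. mixture_lr n p r \<delta> U X < \<infinity>"
  shows "AE X in null_law n p. mixture_lr n p r \<delta> U X = ennreal (exp (log_LR n p \<delta> U X))"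
  using AE_log_LR[OF U \<delta>] fin AE_space
proof eventually_elim
  case (elim X)
  have "0 < mixture_lr n p r \<delta> U X" by (rule mixture_lr_pos[OF U \<delta>(2) elim(3)])
  then show ?case using elim by (cases "mixture_lr n p r \<delta> U X") auto
qed

lemma cdf_log_LR_null:
  assumes U: "uniform_on_stiefel p r U" and \<delta>: "0 \<le> \<delta>" "\<delta> < 1"
    and fin: "AE X in null_law n p. mixture_lr n p r \<delta> U X < \<infinity>"
  shows "cdf (distr (null_law n p) borel (log_LR n p \<delta> U)) x
    = measure (null_law n p) {X \<in> space (null_law n p). enn2real (mixture_lr n p r \<delta> U X) \<le> exp x}"
proof -
  interpret N: prob_space "null_law n p" by (rule prob_space_null_law)
  note [measurable] = borel_measurable_log_LR[OF U] borel_measurable_mixture_lr[OF U]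
  have "cdf (distr (null_law n p) borel (log_LR n p \<delta> U)) x = measure (null_law n p) (log_LR n p \<delta> U -` {..x} \<inter> space (null_law n p))"
    unfolding cdf_def by (rule measure_distr) auto
  also have "\<dots> = measure (null_law n p) {X \<in> space (null_law n p). enn2real (mixture_lr n p r \<delta> U X) \<le> exp x}"
    using AE_exp_log_LR[OF assms] by (intro N.finite_measure_eq_AE) (auto elim!: eventually_mono)
  finally show ?thesis .
qed

lemma cdf_log_LR_alt:
  assumes U: "uniform_on_stiefel p r U" and \<delta>: "0 \<le> \<delta>" "\<delta> < 1"
    and fin: "AE X in null_law n p. mixture_lr n p r \<delta> U X < \<infinity>"
  shows "cdf (distr (alt_law n p \<delta> U) borel (log_LR n p \<delta> U)) x
    = (\<integral>w. exp w * indicator {..x} w \<partial>distr (null_law n p) borel (log_LR n p \<delta> U))"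
proof -
  interpret N: prob_space "null_law n p" by (rule prob_space_null_law)
  note [measurable] = borel_measurable_log_LR[OF U] borel_measurable_mixture_lr[OF U]
  define f where "f w = exp w * indicator {..x} w" for w :: real
  \<comment> \<open>The cut at \<open>x\<close> bounds the tilt by \<open>exp x\<close>, which makes
    it integrable here.\<close>
  have f: "0 \<le> f w" "f w \<le> exp x" for w by (auto simp: f_def indicator_def)
  have [measurable]: "f \<in> borel_measurable borel" unfolding f_def by measurable
  have meas: "log_LR n p \<delta> U \<in> alt_law n p \<delta> U \<rightarrow>\<^sub>M borel"
    by (subst measurable_cong_sets[OF sets_alt_law[OF U \<delta>] refl]) measurable
  have "emeasure (alt_law n p \<delta> U) (log_LR n p \<delta> U -` {..x} \<inter> space (alt_law n p \<delta> U))
    = (\<integral>\<^sup>+X. mixture_lr n p r \<delta> U X * indicator (log_LR n p \<delta> U -` {..x} \<inter> space (null_law n p)) X \<partial>null_law n p)"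
    unfolding alt_law_eq[OF U \<delta>] by (subst emeasure_density) auto
  also have "\<dots> = (\<integral>\<^sup>+X. ennreal (f (log_LR n p \<delta> U X)) \<partial>null_law n p)"
    using AE_exp_log_LR[OF assms] AE_space
    by (intro nn_integral_cong_AE, eventually_elim) (auto simp: f_def indicator_def)
  also have "\<dots> = ennreal (\<integral>X. f (log_LR n p \<delta> U X) \<partial>null_law n p)"
    by (rule nn_integral_eq_integral) (auto intro!: N.integrable_const_bound[of _ "exp x"] simp: f)
  finally have "measure (alt_law n p \<delta> U) (log_LR n p \<delta> U -` {..x} \<inter> space (alt_law n p \<delta> U)) = (\<integral>X. f (log_LR n p \<delta> U X) \<partial>null_law n p)"
    using f by (simp add: measure_def integral_nonneg_AE)
  moreover have "cdf (distr (alt_law n p \<delta> U) borel (log_LR n p \<delta> U)) x = measure (alt_law n p \<delta> U) (log_LR n p \<delta> U -` {..x} \<inter> space (alt_law n p \<delta> U))"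
    unfolding cdf_def by (rule measure_distr[OF meas]) auto
  ultimately show ?thesis
    unfolding f_def[symmetric] by (simp add: integral_distr)
qed

text \<open>Tilting a normal law by \<open>exp w\<close> moves its mean up by its variance; the mean
  \<open>- \<theta>\<^sup>2 / 2\<close> is the one for which no normalising constant
  appears.\<close>

lemma integral_exp_normal:
  assumes \<theta>: "0 < \<theta>"
  shows "(\<integral>w. exp w * indicator {..x} w \<partial>density lborel (\<lambda>x. ennreal (normal_density (- (\<theta>\<^sup>2) / 2) \<theta> x)))
    = cdf (density lborel (\<lambda>x. ennreal (normal_density (\<theta>\<^sup>2 / 2) \<theta> x))) x"
proof -
  have eq: "normal_density (- (\<theta>\<^sup>2) / 2) \<theta> w * exp w = normal_density (\<theta>\<^sup>2 / 2) \<theta> w" for w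
  proof -
    have "- (w - - (\<theta>\<^sup>2) / 2)\<^sup>2 / (2 * \<theta>\<^sup>2) + w = - (w - \<theta>\<^sup>2 / 2)\<^sup>2 / (2 * \<theta>\<^sup>2)"
      using \<theta> by (simp add: field_simps power2_eq_square)
    then show ?thesis by (simp add: normal_density_def mult_exp_exp)
  qed
  have "(\<integral>w. exp w * indicator {..x} w \<partial>density lborel (\<lambda>x. ennreal (normal_density (- (\<theta>\<^sup>2) / 2) \<theta> x)))
    = (\<integral>w. normal_density (\<theta>\<^sup>2 / 2) \<theta> w * indicator {..x} w \<partial>lborel)"
    by (subst integral_density) (auto simp: eq[simplified] mult.assoc[symmetric])
  also have "\<dots> = (\<integral>w. indicator {..x} w \<partial>density lborel (\<lambda>x. ennreal (normal_density (\<theta>\<^sup>2 / 2) \<theta> x)))"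
    by (subst integral_density) auto
  also have "\<dots> = cdf (density lborel (\<lambda>x. ennreal (normal_density (\<theta>\<^sup>2 / 2) \<theta> x))) x"
    by (simp add: cdf_def)
  finally show ?thesis .
qed

text \<open>The logarithm of \<open>scale_lr\<close> is affine in \<open>chi_stat\<close>: the slope
  is \<open>a / 2 * sqrt (n * p * 2)\<close> and the intercept
  \<open>n * p / 2 * (ln (1 - a) + a)\<close>. Their limits are the standard deviation and the mean
  of the limit law.\<close>

lemma scale_lr_le_iff:
  assumes np: "0 < n" "0 < p" and a: "0 < a" "a < 1" and y: "0 < y"
  shows "scale_lr n p a X \<le> y \<longleftrightarrow>
    chi_stat n p X \<le> (ln y - real n * real p / 2 * (ln (1 - a) + a)) / (a / 2 * sqrt (real n * real p * 2))"
proof -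
  define m where "m = real n * real p"
  define S where "S = (\<Sum>i<n. \<Sum>j<p. (X i j)\<^sup>2)"
  have m: "0 < m" using np by (simp add: m_def)
  have "(\<Sum>i<n. \<Sum>j<p. (X i j)\<^sup>2 - 1) = S - m"
    by (simp add: S_def m_def sum_subtractf)
  then have chi: "chi_stat n p X = (S - m) / sqrt (m * 2)"
    by (simp add: chi_stat_def m_def)
  have "ln (scale_lr n p a X) = m / 2 * ln (1 - a) + a / 2 * S"
    using a by (simp add: scale_lr_def S_def m_def ln_mult ln_realpow ln_sqrt)
  also have "\<dots> = (a / 2 * sqrt (m * 2)) * chi_stat n p X + m / 2 * (ln (1 - a) + a)"
  proof -
    have "(a / 2 * sqrt (m * 2)) * chi_stat n p X = a / 2 * (S - m)"
      using m by (simp add: chi)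
    then show ?thesis by (simp only:) (simp add: field_simps)
  qed
  finally have ln: "ln (scale_lr n p a X) = (a / 2 * sqrt (m * 2)) * chi_stat n p X + m / 2 * (ln (1 - a) + a)" .
  have "scale_lr n p a X \<le> y \<longleftrightarrow> ln (scale_lr n p a X) \<le> ln y"
    using scale_lr_pos[OF a(2)] y by (simp add: ln_le_cancel_iff)
  also have "\<dots> \<longleftrightarrow> chi_stat n p X \<le> (ln y - m / 2 * (ln (1 - a) + a)) / (a / 2 * sqrt (m * 2))"
    unfolding ln using a m by (subst pos_le_divide_eq) (auto simp: algebra_simps)
  finally show ?thesis by (simp add: m_def)
qed

text \<open>The second-order Taylor coefficient. Multiplied by the limit
  \<open>\<theta>\<^sup>2\<close> of \<open>n * p * a\<^sup>2 / 2\<close>, it produces the mean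
  \<open>- \<theta>\<^sup>2 / 2\<close>.\<close>

lemma tendsto_ln_one_minus_remainder:
  "((\<lambda>a::real. (ln (1 - a) + a) / a\<^sup>2) \<longlongrightarrow> - 1 / 2) (at_right 0)"
  by real_asymp

text \<open>The eventual conditions are exported with the limit because the change to the
  alternative law needs a finite mixture ratio as well.\<close>

lemma log_LR_null_tendsto:
  fixes \<theta> \<gamma> :: real and p r :: "nat \<Rightarrow> nat" and \<delta> :: "nat \<Rightarrow> real" and U :: "nat \<Rightarrow> real Matrix.mat measure"
  assumes \<theta>: "0 < \<theta>" and \<gamma>: "0 < \<gamma>" and np: "(\<lambda>n. real n / real (p n)) \<longlonglongrightarrow> 1 / \<gamma>"
    and p: "filterlim (\<lambda>n. real (p n)) at_top sequentially" and r: "filterlim (\<lambda>n. real (r n)) at_top sequentially"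
    and \<delta>: "\<And>n. \<delta> n = inverse (real (r n)) * \<theta> * sqrt (2 * \<gamma>)"
    and U: "\<And>n. uniform_on_stiefel (p n) (r n) (U n)"
  shows "\<forall>\<^sub>F n in sequentially. 0 \<le> \<delta> n \<and> \<delta> n < 1 \<and>
      (AE X in null_law n (p n). mixture_lr n (p n) (r n) (\<delta> n) (U n) X < \<infinity>)"
    and "(\<lambda>n. cdf (distr (null_law n (p n)) borel (log_LR n (p n) (\<delta> n) (U n))) x)
      \<longlonglongrightarrow> cdf (density lborel (\<lambda>x. ennreal (normal_density (- (\<theta>\<^sup>2) / 2) \<theta> x))) x"
proof -
  \<comment> \<open>All three moment exponents below tend to
    \<open>c\<^sup>2 / (2 * \<gamma>)\<close>, which is \<open>\<theta>\<^sup>2\<close>; this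
    explains the root of \<open>2 * \<gamma>\<close>.\<close>
  define c where "c = \<theta> * sqrt (2 * \<gamma>)"
  have c: "c > 0" and c2: "c\<^sup>2 / \<gamma> = 2 * \<theta>\<^sup>2"
    using \<theta> \<gamma> by (auto simp: c_def power_mult_distrib)
  define \<eta> where "\<eta> n = \<delta> n / (1 - \<delta> n)" for n
  define a where "a n = c / real (p n)" for n
  define T where "T n = real (r n) * (\<eta> n)\<^sup>2" for n
  define \<nu> where "\<nu> n = real n * T n / (2 * (1 - T n)) / real (p n)" for n
  \<comment> \<open>\<open>A\<close> and \<open>B\<close> are the upper bounds for the second
    moments of the mixture ratio and of \<open>scale_lr\<close>, and \<open>C\<close> is the lower
    bound for their mixed moment.\<close>
  define A where "A n = exp (real (r n) * \<nu> n / (1 - 2 * \<nu> n))" for n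
  define B where "B n = exp (real n * real (p n) * (a n)\<^sup>2 / (2 * (1 - 2 * a n)))" for n
  define C where "C n = exp (real n * real (r n) * (\<eta> n * a n / (1 - a n)) / 2)" for n
  have ir: "(\<lambda>n. inverse (real (r n))) \<longlonglongrightarrow> 0" and ip: "(\<lambda>n. inverse (real (p n))) \<longlonglongrightarrow> 0"
    using r p by (auto intro: tendsto_inverse_0_at_top)
  have rpos: "\<forall>\<^sub>F n in sequentially. 0 < r n" and ppos: "\<forall>\<^sub>F n in sequentially. 0 < p n"
    using filterlim_at_top_dense[THEN iffD1, OF r, rule_format, of 0] filterlim_at_top_dense[THEN iffD1, OF p, rule_format, of 0]
    by auto
  have npos: "\<forall>\<^sub>F n in sequentially. 0 < (n::nat)" by (rule eventually_gt_at_top)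
  have \<delta>lim: "\<delta> \<longlonglongrightarrow> 0"
    unfolding \<delta> using tendsto_mult_left[OF ir, of c] by (simp add: c_def ac_simps)
  have alim: "a \<longlonglongrightarrow> 0"
    unfolding a_def using tendsto_mult_left[OF ip, of c] by (simp add: divide_inverse)
  have elim: "(\<lambda>n. real (r n) * \<eta> n) \<longlonglongrightarrow> c"
  proof -
    have "(\<lambda>n. c / (1 - \<delta> n)) \<longlonglongrightarrow> c / (1 - 0)" by (intro tendsto_intros \<delta>lim) auto
    then have "(\<lambda>n. c / (1 - \<delta> n)) \<longlonglongrightarrow> c" by simp
    then show ?thesis
      by (rule Lim_transform_eventually) (use rpos in eventually_elim, simp add: \<eta>_def \<delta> c_def field_simps)
  qed
  \<comment> \<open>\<open>T\<close>, and with it \<open>\<nu>\<close>, is of order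
    \<open>1 / r\<close>: the corrections \<open>1 - T\<close> and \<open>1 - 2 * \<nu>\<close>
    disappear, while the products with \<open>r\<close> keep a limit.\<close>
  have rTlim: "(\<lambda>n. real (r n) * T n) \<longlonglongrightarrow> c\<^sup>2"
    using tendsto_power[OF elim, of 2] by (simp add: T_def power2_eq_square ac_simps)
  have Tlim: "T \<longlonglongrightarrow> 0"
  proof -
    have "(\<lambda>n. inverse (real (r n)) * (real (r n) * T n)) \<longlonglongrightarrow> 0 * c\<^sup>2" by (intro tendsto_mult ir rTlim)
    then have "(\<lambda>n. inverse (real (r n)) * (real (r n) * T n)) \<longlonglongrightarrow> 0" by simp
    then show ?thesis by (rule Lim_transform_eventually) (use rpos in eventually_elim, simp)
  qed
  have r\<nu>lim: "(\<lambda>n. real (r n) * \<nu> n) \<longlonglongrightarrow> \<theta>\<^sup>2"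
  proof -
    have "(\<lambda>n. real n / real (p n) * (real (r n) * T n) / (2 * (1 - T n))) \<longlonglongrightarrow> 1 / \<gamma> * c\<^sup>2 / (2 * (1 - 0))"
      by (intro tendsto_intros np rTlim Tlim) auto
    also have "1 / \<gamma> * c\<^sup>2 / (2 * (1 - 0)) = \<theta>\<^sup>2" using c2 by simp
    finally show ?thesis by (simp add: \<nu>_def ac_simps)
  qed
  have \<nu>lim: "\<nu> \<longlonglongrightarrow> 0"
  proof -
    have "(\<lambda>n. inverse (real (r n)) * (real (r n) * \<nu> n)) \<longlonglongrightarrow> 0 * \<theta>\<^sup>2" by (intro tendsto_mult ir r\<nu>lim)
    then have "(\<lambda>n. inverse (real (r n)) * (real (r n) * \<nu> n)) \<longlonglongrightarrow> 0" by simp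
    then show ?thesis by (rule Lim_transform_eventually) (use rpos in eventually_elim, simp)
  qed
  have Alim: "A \<longlonglongrightarrow> exp (\<theta>\<^sup>2)"
  proof -
    have "A \<longlonglongrightarrow> exp (\<theta>\<^sup>2 / (1 - 2 * 0))" unfolding A_def by (intro tendsto_intros r\<nu>lim \<nu>lim) auto
    then show ?thesis by simp
  qed
  have npa: "\<forall>\<^sub>F n in sequentially. real n * real (p n) * (a n)\<^sup>2 = real n / real (p n) * c\<^sup>2"
    using ppos by eventually_elim (simp add: a_def power2_eq_square)
  have Blim: "B \<longlonglongrightarrow> exp (\<theta>\<^sup>2)"
  proof -
    have "(\<lambda>n. exp (real n / real (p n) * c\<^sup>2 / (2 * (1 - 2 * a n)))) \<longlonglongrightarrow> exp (1 / \<gamma> * c\<^sup>2 / (2 * (1 - 2 * 0)))"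
      by (intro tendsto_intros np alim) auto
    also have "1 / \<gamma> * c\<^sup>2 / (2 * (1 - 2 * 0)) = \<theta>\<^sup>2" using c2 by simp
    finally show ?thesis
      by (rule Lim_transform_eventually) (use npa in eventually_elim, simp add: B_def)
  qed
  have Clim: "C \<longlonglongrightarrow> exp (\<theta>\<^sup>2)"
  proof -
    have eq: "real n * real (r n) * (\<eta> n * a n / d) / 2 = real n / real (p n) * c * (real (r n) * \<eta> n) / d / 2" for n d
      by (simp add: a_def)
    have "(\<lambda>n. exp (real n / real (p n) * c * (real (r n) * \<eta> n) / (1 - a n) / 2)) \<longlonglongrightarrow> exp (1 / \<gamma> * c * c / (1 - 0) / 2)"
      by (intro tendsto_intros np alim elim) auto
    also have "1 / \<gamma> * c * c / (1 - 0) / 2 = \<theta>\<^sup>2" using c2 by (simp add: power2_eq_square)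
    finally show ?thesis unfolding C_def eq .
  qed
  have gap: "(\<lambda>n. (A n + B n - 2 * C n) / \<epsilon>\<^sup>2) \<longlonglongrightarrow> 0" for \<epsilon>
  proof -
    have "(\<lambda>n. (A n + B n - 2 * C n) / \<epsilon>\<^sup>2) \<longlonglongrightarrow> (exp (\<theta>\<^sup>2) + exp (\<theta>\<^sup>2) - 2 * exp (\<theta>\<^sup>2)) / \<epsilon>\<^sup>2"
      unfolding divide_inverse by (intro tendsto_intros Alim Blim Clim)
    then show ?thesis by simp
  qed
  have \<delta>0: "0 \<le> \<delta> n" for n unfolding \<delta> using \<theta> \<gamma> by simp
  have "(\<lambda>n. \<eta> n * a n / (1 - a n)) \<longlonglongrightarrow> (0 / (1 - 0)) * 0 / (1 - 0)"
    unfolding \<eta>_def by (intro tendsto_intros alim \<delta>lim) auto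
  then have \<eta>a: "\<forall>\<^sub>F n in sequentially. \<eta> n * a n / (1 - a n) < 1"
    by (auto elim: order_tendstoD)
  have small: "\<forall>\<^sub>F n in sequentially. \<delta> n < 1" "\<forall>\<^sub>F n in sequentially. a n < 1 / 2"
    "\<forall>\<^sub>F n in sequentially. T n < 1" "\<forall>\<^sub>F n in sequentially. \<nu> n < 1 / 2"
    using order_tendstoD(2)[OF \<delta>lim, of 1] order_tendstoD(2)[OF alim, of "1 / 2"]
      order_tendstoD(2)[OF Tlim, of 1] order_tendstoD(2)[OF \<nu>lim, of "1 / 2"] by simp_all
  have good: "\<forall>\<^sub>F n in sequentially. 0 < n \<and> 0 < p n \<and> \<delta> n < 1 \<and> a n < 1 / 2 \<and> 0 < a n
     \<and> (AE X in null_law n (p n). mixture_lr n (p n) (r n) (\<delta> n) (U n) X < \<infinity>)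
     \<and> (\<forall>\<epsilon>>0. measure (null_law n (p n)) {X \<in> space (null_law n (p n)). \<epsilon> \<le> \<bar>enn2real (mixture_lr n (p n) (r n) (\<delta> n) (U n) X) - scale_lr n (p n) (a n) X\<bar>}
        \<le> (A n + B n - 2 * C n) / \<epsilon>\<^sup>2)"
    using npos ppos rpos \<eta>a small
  proof eventually_elim
    case (elim n)
    have a0: "0 < a n" using c elim by (simp add: a_def)
    have a1: "2 * a n < 1" "a n < 1" using elim by auto
    have \<nu>1: "2 * \<nu> n < 1" using elim by auto
    note dev = deviation_le_of_second_moments[OF prob_space_null_law borel_measurable_mixture_lr[OF U] borel_measurable_scale_lr less_imp_le[OF scale_lr_pos[OF a1(2)]]
        nn_integral_mixture_lr_square_le[OF U \<delta>0 \<open>\<delta> n < 1\<close> \<open>0 < r n\<close> \<open>0 < p n\<close> T_def[unfolded \<eta>_def] \<open>T n < 1\<close> \<nu>_def \<nu>1]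
        nn_integral_scale_lr_square_le[OF less_imp_le[OF a0] a1(1)]
        nn_integral_mixture_lr_scale_lr_ge[OF U \<delta>0 \<open>\<delta> n < 1\<close> less_imp_le[OF a0] a1(2) elim(4)[unfolded \<eta>_def]] exp_ge_zero exp_ge_zero exp_ge_zero]
    show ?case
      using elim a0 dev[of 1] dev unfolding A_def B_def C_def \<eta>_def by auto
  qed
  show "\<forall>\<^sub>F n in sequentially. 0 \<le> \<delta> n \<and> \<delta> n < 1 \<and>
      (AE X in null_law n (p n). mixture_lr n (p n) (r n) (\<delta> n) (U n) X < \<infinity>)"
    using good by eventually_elim (use \<delta>0 in auto)
  define F where "F n y = measure (null_law n (p n)) {X \<in> space (null_law n (p n)). enn2real (mixture_lr n (p n) (r n) (\<delta> n) (U n) X) \<le> y}" for n y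
  define G where "G n y = measure (null_law n (p n)) {X \<in> space (null_law n (p n)). scale_lr n (p n) (a n) X \<le> y}" for n y
  define H where "H y = cdf std_normal_distribution ((ln y + \<theta>\<^sup>2 / 2) / \<theta>)" for y
  \<comment> \<open>The slope of the logarithm of \<open>scale_lr\<close> in
    \<open>chi_stat\<close>, hence the limiting standard deviation.\<close>
  have blim: "(\<lambda>n. a n / 2 * sqrt (real n * real (p n) * 2)) \<longlonglongrightarrow> \<theta>"
  proof -
    have "(\<lambda>n. c / 2 * sqrt (real n / real (p n) * 2)) \<longlonglongrightarrow> c / 2 * sqrt (1 / \<gamma> * 2)"
      by (intro tendsto_intros np)
    also have "c / 2 * sqrt (1 / \<gamma> * 2) = \<theta>"
      using \<gamma> by (simp add: c_def real_sqrt_mult real_sqrt_divide)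
    finally show ?thesis
    proof (rule Lim_transform_eventually)
      show "\<forall>\<^sub>F n in sequentially. c / 2 * sqrt (real n / real (p n) * 2) = a n / 2 * sqrt (real n * real (p n) * 2)"
        using ppos
      proof eventually_elim
        case (elim n)
        have "sqrt (real n * real (p n) * 2) = real (p n) * sqrt (real n / real (p n) * 2)"
        proof -
          have "real n * real (p n) * 2 = (real (p n))\<^sup>2 * (real n / real (p n) * 2)"
            using elim by (simp add: power2_eq_square)
          then show ?thesis by (simp only: real_sqrt_mult[of "(real (p n))\<^sup>2"] real_sqrt_abs abs_of_nat)
        qed
        then show ?case using elim by (simp add: a_def)
      qed
    qed
  qed
  \<comment> \<open>The intercept, hence the limiting mean.\<close>
  have clim: "(\<lambda>n. real n * real (p n) / 2 * (ln (1 - a n) + a n)) \<longlonglongrightarrow> - (\<theta>\<^sup>2) / 2"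
  proof -
    \<comment> \<open>The Taylor limit is one-sided at 0, so eventual positivity of \<open>a\<close>
      is used along with its limit.\<close>
    have "filterlim a (at_right 0) sequentially"
      unfolding filterlim_at using alim good by (auto elim: eventually_mono)
    then have "(\<lambda>n. (ln (1 - a n) + a n) / (a n)\<^sup>2) \<longlonglongrightarrow> - 1 / 2"
      by (rule filterlim_compose[OF tendsto_ln_one_minus_remainder])
    moreover have "(\<lambda>n. real n / real (p n) * c\<^sup>2 / 2) \<longlonglongrightarrow> 1 / \<gamma> * c\<^sup>2 / 2"
      by (intro tendsto_intros np) auto
    ultimately have "(\<lambda>n. real n / real (p n) * c\<^sup>2 / 2 * ((ln (1 - a n) + a n) / (a n)\<^sup>2)) \<longlonglongrightarrow> 1 / \<gamma> * c\<^sup>2 / 2 * (- 1 / 2)"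
      by (intro tendsto_mult)
    also have "1 / \<gamma> * c\<^sup>2 / 2 * (- 1 / 2) = - (\<theta>\<^sup>2) / 2" using c2 by simp
    finally show ?thesis
    proof (rule Lim_transform_eventually)
      show "\<forall>\<^sub>F n in sequentially. real n / real (p n) * c\<^sup>2 / 2 * ((ln (1 - a n) + a n) / (a n)\<^sup>2) = real n * real (p n) / 2 * (ln (1 - a n) + a n)"
        using npa good
      proof eventually_elim
        case (elim n)
        then have "a n \<noteq> 0" by auto
        then show ?case unfolding elim(1)[symmetric] by simp
      qed
    qed
  qed
  have Glim: "(\<lambda>n. G n y) \<longlonglongrightarrow> H y" if y: "0 < y" for y
  proof -
    \<comment> \<open>The threshold that \<open>scale_lr \<le> y\<close> imposes on
      \<open>chi_stat\<close>; it moves with \<open>n\<close>.\<close>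
    define xs where "xs n = (ln y - real n * real (p n) / 2 * (ln (1 - a n) + a n)) / (a n / 2 * sqrt (real n * real (p n) * 2))" for n
    have xs: "xs \<longlonglongrightarrow> (ln y + \<theta>\<^sup>2 / 2) / \<theta>"
    proof -
      have "xs \<longlonglongrightarrow> (ln y - - (\<theta>\<^sup>2) / 2) / \<theta>"
        unfolding xs_def using \<theta> by (intro tendsto_intros blim clim) auto
      then show ?thesis by simp
    qed
    have "filterlim (\<lambda>n. n * p n) at_top sequentially"
    proof (rule filterlim_at_top_mono)
      show "filterlim (\<lambda>n. n) at_top sequentially" by (rule filterlim_ident)
      show "\<forall>\<^sub>F n in sequentially. n \<le> n * p n" using ppos by eventually_elim auto
    qed
    note clt = cdf_chi_stat_tendsto[OF this]
    have "(\<lambda>n. cdf (distr (null_law n (p n)) borel (chi_stat n (p n))) (xs n)) \<longlonglongrightarrow> H y"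
      unfolding H_def
    proof (rule mono_tendsto_at_moving_point[OF _ clt isCont_cdf_std_normal xs])
      fix n and u v :: real assume "u \<le> v"
      interpret N: prob_space "null_law n (p n)" by (rule prob_space_null_law)
      interpret D: real_distribution "distr (null_law n (p n)) borel (chi_stat n (p n))"
        by (rule N.real_distribution_distr) measurable
      show "cdf (distr (null_law n (p n)) borel (chi_stat n (p n))) u \<le> cdf (distr (null_law n (p n)) borel (chi_stat n (p n))) v"
        by (rule D.cdf_nondecreasing) fact
    qed
    then show ?thesis
    proof (rule Lim_transform_eventually)
      show "\<forall>\<^sub>F n in sequentially. cdf (distr (null_law n (p n)) borel (chi_stat n (p n))) (xs n) = G n y"
        using good
      proof eventually_elim
        case (elim n)
        have "cdf (distr (null_law n (p n)) borel (chi_stat n (p n))) (xs n)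
          = measure (null_law n (p n)) (chi_stat n (p n) -` {..xs n} \<inter> space (null_law n (p n)))"
          unfolding cdf_def by (rule measure_distr) auto
        also have "chi_stat n (p n) -` {..xs n} \<inter> space (null_law n (p n)) = {X \<in> space (null_law n (p n)). scale_lr n (p n) (a n) X \<le> y}"
          using elim y by (subst scale_lr_le_iff) (auto simp: xs_def)
        finally show ?case by (simp add: G_def)
      qed
    qed
  qed
  have "(\<lambda>n. F n (exp x)) \<longlonglongrightarrow> H (exp x)"
  proof (rule tendsto_of_perturbation[OF _ Glim _ gap])
    show "isCont H (exp x)"
      unfolding H_def using \<theta> by (intro isCont_o2[OF _ isCont_cdf_std_normal] continuous_intros) auto
    fix \<epsilon> :: real assume \<epsilon>: "0 < \<epsilon>"
    have "\<forall>\<^sub>F n in sequentially. F n (exp x) \<le> G n (exp x + \<epsilon>) + (A n + B n - 2 * C n) / \<epsilon>\<^sup>2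
      \<and> G n (exp x - \<epsilon>) \<le> F n (exp x) + (A n + B n - 2 * C n) / \<epsilon>\<^sup>2"
      using good
    proof eventually_elim
      case (elim n)
      interpret N: prob_space "null_law n (p n)" by (rule prob_space_null_law)
      note [measurable] = borel_measurable_mixture_lr[OF U]
      \<comment> \<open>Off \<open>E\<close> the two ratios differ by less than
        \<open>\<epsilon>\<close>, so a bound on one of them is a bound on the other with its
        threshold shifted by \<open>\<epsilon>\<close>.\<close>
      define E where "E = {X \<in> space (null_law n (p n)). \<epsilon> \<le> \<bar>enn2real (mixture_lr n (p n) (r n) (\<delta> n) (U n) X) - scale_lr n (p n) (a n) X\<bar>}"
      have [measurable]: "E \<in> sets (null_law n (p n))" unfolding E_def by measurable
      have E: "measure (null_law n (p n)) E \<le> (A n + B n - 2 * C n) / \<epsilon>\<^sup>2"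
        using elim \<epsilon> by (auto simp: E_def)
      have "F n (exp x) \<le> measure (null_law n (p n)) ({X \<in> space (null_law n (p n)). scale_lr n (p n) (a n) X \<le> exp x + \<epsilon>} \<union> E)"
        unfolding F_def by (rule N.finite_measure_mono) (auto simp: E_def abs_real_def)
      also have "\<dots> \<le> G n (exp x + \<epsilon>) + measure (null_law n (p n)) E"
        unfolding G_def by (rule measure_Un_le) auto
      finally have 1: "F n (exp x) \<le> G n (exp x + \<epsilon>) + measure (null_law n (p n)) E" .
      have "G n (exp x - \<epsilon>) \<le> measure (null_law n (p n)) ({X \<in> space (null_law n (p n)). enn2real (mixture_lr n (p n) (r n) (\<delta> n) (U n) X) \<le> exp x} \<union> E)"
        unfolding G_def by (rule N.finite_measure_mono) (auto simp: E_def abs_real_def)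
      also have "\<dots> \<le> F n (exp x) + measure (null_law n (p n)) E"
        unfolding F_def by (rule measure_Un_le) auto
      finally show ?case using 1 E by linarith
    qed
    then show "\<forall>\<^sub>F n in sequentially. F n (exp x) \<le> G n (exp x + \<epsilon>) + (A n + B n - 2 * C n) / \<epsilon>\<^sup>2"
      "\<forall>\<^sub>F n in sequentially. G n (exp x - \<epsilon>) \<le> F n (exp x) + (A n + B n - 2 * C n) / \<epsilon>\<^sup>2"
      by (auto elim: eventually_mono)
  qed simp_all
  moreover have "H (exp x) = cdf (density lborel (\<lambda>x. ennreal (normal_density (- (\<theta>\<^sup>2) / 2) \<theta> x))) x"
    unfolding cdf_normal[OF \<theta>] by (simp add: H_def)
  moreover have "\<forall>\<^sub>F n in sequentially. F n (exp x) = cdf (distr (null_law n (p n)) borel (log_LR n (p n) (\<delta> n) (U n))) x"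
    using good by eventually_elim (simp add: F_def cdf_log_LR_null[OF U \<delta>0])
  ultimately show "(\<lambda>n. cdf (distr (null_law n (p n)) borel (log_LR n (p n) (\<delta> n) (U n))) x)
      \<longlonglongrightarrow> cdf (density lborel (\<lambda>x. ennreal (normal_density (- (\<theta>\<^sup>2) / 2) \<theta> x))) x"
    by (auto intro: Lim_transform_eventually)
qed

theorem theorem1p6:
  fixes \<beta> \<theta> \<gamma> :: real
    and p r :: "nat \<Rightarrow> nat"
    and \<delta> :: "nat \<Rightarrow> real"
    and U :: "nat \<Rightarrow> real Matrix.mat measure"
  assumes "0 < \<beta>" and "\<beta> < 1" and "0 < \<theta>" and "1 \<le> \<gamma>"
    and "\<And>n. n \<le> p n"
    and "(\<lambda>n. real (p n) / real n) \<longlonglongrightarrow> \<gamma>"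
    and "\<And>n. int (r n) = \<lfloor>real n powr (1 - \<beta>)\<rfloor> \<or> int (r n) = \<lceil>real n powr (1 - \<beta>)\<rceil>"
    and "\<And>n. \<delta> n = inverse (real (r n)) * \<theta> * sqrt (2 * \<gamma>)"
    and "\<And>n. uniform_on_stiefel (p n) (r n) (U n)"
  shows "weak_conv_m (\<lambda>n. distr (null_law n (p n)) borel (log_LR n (p n) (\<delta> n) (U n)))
           (density lborel (\<lambda>x. ennreal (normal_density (- (\<theta>\<^sup>2) / 2) \<theta> x)))
       \<and> weak_conv_m (\<lambda>n. distr (alt_law n (p n) (\<delta> n) (U n)) borel (log_LR n (p n) (\<delta> n) (U n)))
           (density lborel (\<lambda>x. ennreal (normal_density (\<theta>\<^sup>2 / 2) \<theta> x)))"
proof -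
  have \<gamma>: "0 < \<gamma>" using assms by simp
  have np: "(\<lambda>n. real n / real (p n)) \<longlonglongrightarrow> 1 / \<gamma>"
    using tendsto_inverse[OF assms(6)] \<gamma> by (simp add: inverse_eq_divide)
  have p: "filterlim (\<lambda>n. real (p n)) at_top sequentially"
    by (rule filterlim_at_top_mono[OF filterlim_real_sequentially]) (simp add: assms(5))
  have r: "filterlim (\<lambda>n. real (r n)) at_top sequentially"
  proof (rule filterlim_at_top_mono)
    show "filterlim (\<lambda>n::nat. real n powr (1 - \<beta>) - 1) at_top sequentially"
      using assms(2) by real_asymp
    \<comment> \<open>Rounding down or up loses at most 1.\<close>
    have "real n powr (1 - \<beta>) - 1 \<le> real (r n)" for n
      using assms(7)[of n] by linarith
    then show "\<forall>\<^sub>F n in sequentially. real n powr (1 - \<beta>) - 1 \<le> real (r n)" by simp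
  qed
  note null = log_LR_null_tendsto[OF assms(3) \<gamma> np p r assms(8,9)]
  let ?N0 = "density lborel (\<lambda>x. ennreal (normal_density (- (\<theta>\<^sup>2) / 2) \<theta> x))"
  let ?N1 = "density lborel (\<lambda>x. ennreal (normal_density (\<theta>\<^sup>2 / 2) \<theta> x))"
  let ?P = "\<lambda>n. distr (null_law n (p n)) borel (log_LR n (p n) (\<delta> n) (U n))"
  have W: "weak_conv_m ?P ?N0"
    unfolding weak_conv_m_def weak_conv_def using null(2) by blast
  have "(\<lambda>n. cdf (distr (alt_law n (p n) (\<delta> n) (U n)) borel (log_LR n (p n) (\<delta> n) (U n))) x) \<longlonglongrightarrow> cdf ?N1 x" for x
  proof -
    have "(\<lambda>n. \<integral>w. exp w * indicator {..x} w \<partial>?P n) \<longlonglongrightarrow> (\<integral>w. exp w * indicator {..x} w \<partial>?N0)"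
    proof (rule weak_conv_imp_bdd_ae_continuous_conv[OF _ _ W])
      show "real_distribution (?P n)" for n
      proof -
        interpret prob_space "null_law n (p n)" by (rule prob_space_null_law)
        show ?thesis by (intro real_distribution_distr borel_measurable_log_LR[OF assms(9)])
      qed
      show "real_distribution ?N0"
        using prob_space_normal_density[OF assms(3)] by (auto simp: real_distribution_def real_distribution_axioms_def)
      \<comment> \<open>The test function jumps at \<open>x\<close> only, and the limit law has no
        atoms, so weak convergence still passes to its integral.\<close>
      have "isCont (\<lambda>w. exp w * indicator {..x} w :: real) w" if "w \<noteq> x" for w
      proof (cases "w < x")
        case True
        then have "\<forall>\<^sub>F v in nhds w. exp v * indicator {..x} v = exp v"
          by (auto intro!: eventually_mono[OF eventually_nhds_in_open[of "{..<x}"]])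
        then have "isCont (\<lambda>w. exp w * indicator {..x} w :: real) w \<longleftrightarrow> isCont exp w"
          by (rule isCont_cong)
        then show ?thesis by simp
      next
        case False
        then have "\<forall>\<^sub>F v in nhds w. exp v * indicator {..x} v = (0::real)"
          using that by (auto intro!: eventually_mono[OF eventually_nhds_in_open[of "{x<..}"]])
        then have "isCont (\<lambda>w. exp w * indicator {..x} w :: real) w \<longleftrightarrow> isCont (\<lambda>_. 0 :: real) w"
          by (rule isCont_cong)
        then show ?thesis by simp
      qed
      then have "{w. \<not> isCont (\<lambda>w. exp w * indicator {..x} w :: real) w} \<subseteq> {x}" by auto
      moreover have "emeasure ?N0 {x} = 0" by (simp add: emeasure_density)
      ultimately show "emeasure ?N0 {w. \<not> isCont (\<lambda>w. exp w * indicator {..x} w :: real) w} = 0"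
        by (metis (no_types, lifting) emeasure_mono le_zero_eq sets_density sets_lborel borel_singleton sets.empty_sets)
      show "norm (exp w * indicator {..x} w :: real) \<le> exp x" for w
        by (auto simp: indicator_def)
    qed measurable
    then have "(\<lambda>n. \<integral>w. exp w * indicator {..x} w \<partial>?P n) \<longlonglongrightarrow> cdf ?N1 x"
      by (simp only: integral_exp_normal[OF assms(3)])
    then show ?thesis
    proof (rule Lim_transform_eventually)
      \<comment> \<open>The tilt formula requires \<open>\<delta> n < 1\<close> and an almost surely
        finite mixture ratio, which hold from some \<open>n\<close> on.\<close>
      show "\<forall>\<^sub>F n in sequentially. (\<integral>w. exp w * indicator {..x} w \<partial>?P n) = cdf (distr (alt_law n (p n) (\<delta> n) (U n)) borel (log_LR n (p n) (\<delta> n) (U n))) x"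
        using null(1) by eventually_elim (simp add: cdf_log_LR_alt[OF assms(9)])
    qed
  qed
  then have "weak_conv_m (\<lambda>n. distr (alt_law n (p n) (\<delta> n) (U n)) borel (log_LR n (p n) (\<delta> n) (U n))) ?N1"
    unfolding weak_conv_m_def weak_conv_def by blast
  with W show ?thesis by blast
qed

end
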